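(* Suppose that $3<p<\infty$, that $g\in\dot{B}^{s_p}_{p,\infty}(\mathbb{R}^3)$, and that $\mathrm{div}\,g=0$ in the sense of tempered distributions. Then there exist $p<p_2<\infty$, $0<\delta_2<-s_{p_2}$, $\gamma_1=\gamma_1(p)>0$ and $\gamma_2=\gamma_2(p)>0$ such that for any $N>0$ there exist divergence free tempered distributions $\bar g^N\in\dot{B}^{s_{p_2}+\delta_2}_{p_2,p_2}(\mathbb{R}^3)\cap\dot{B}^{s_p}_{p,\infty}(\mathbb{R}^3)$ and $\widetilde g^N\in L_2(\mathbb{R}^3)\cap\dot{B}^{s_p}_{p,\infty}(\mathbb{R}^3)$ with $$g=\bar g^N+\widetilde g^N,$$ $$\|\bar g^N\|_{\dot{B}^{s_{p_2}+\delta_2}_{p_2,p_2}}\le N^{\gamma_1}C(p,\|g\|_{\dot{B}^{s_p}_{p,\infty}}),\qquad \|\widetilde g^N\|_{L_2}\le N^{-\gamma_2}C(p,\|g\|_{\dot{B}^{s_p}_{p,\infty}}),$$ and furthermore $$\|\bar g^N\|_{\dot{B}^{s_p}_{p,\infty}}\le C(p,\|g\|_{\dot{B}^{s_p}_{p,\infty}}),\qquad\|\widetilde g^N\|_{\dot{B}^{s_p}_{p,\infty}}\le C(p,\|g\|_{\dot{B}^{s_p}_{p,\infty}}).$$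
   Context: For $r>3$, $s_r:=-1+\frac3r<0$. $C(p,\|g\|_{\dot{B}^{s_p}_{p,\infty}})$ denotes constants depending only on the listed quantities (in particular not on $N$), possibly different in each estimate. The distributions are $\mathbb{R}^3$-valued. Besov spaces. Let $\chi\in C_0^\infty(B(4/3))$ and $\varphi\in C_0^\infty(\{3/4\le|\xi|\le 8/3\})$ take values in $[0,1]$, with $\chi(\xi)+\sum_{j\ge0}\varphi(2^{-j}\xi)=1$ for all $\xi\in\mathbb{R}^3$ and $\sum_{j\in\mathbb{Z}}\varphi(2^{-j}\xi)=1$ for $\xi\neq0$. Put $\dot\Delta_j a=\mathcal{F}^{-1}(\varphi(2^{-j}\cdot)\mathcal{F}a)$, $\dot S_j a=\mathcal{F}^{-1}(\chi(2^{-j}\cdot)\mathcal{F}a)$. The space $\dot B^s_{p,q}(\mathbb{R}^3)$ consists of tempered distributions $a$ with $\lim_{j\to-\infty}\|\dot S_ja\|_{L_\infty}=0$ and $\|a\|_{\dot B^s_{p,q}}=\big(\sum_{j}2^{jsq}\|\dot\Delta_ja\|_{L_p}^q\big)^{1/q}<\infty$ (supremum over $j$ if $q=\infty$). *)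

theory Defs
  imports "HOL-Analysis.Analysis" "HOL-Probability.Essential_Supremum"
begin

section \<open>Schwartz functions and the Fourier transform on \<open>\<real>\<^sup>3\<close>\<close>

definition partial_deriv ::
    "3 \<Rightarrow> (real^3 \<Rightarrow> 'a) \<Rightarrow> real^3 \<Rightarrow> 'a::real_normed_vector" where
  "partial_deriv i f x = frechet_derivative f (at x) (axis i 1)"

text \<open>Iterated partial derivatives are indexed by lists of directions rather than by multi-indices;
  for smooth functions the order of the list is irrelevant.\<close>

definition iter_deriv ::
    "3 list \<Rightarrow> (real^3 \<Rightarrow> 'a) \<Rightarrow> real^3 \<Rightarrow> 'a::real_normed_vector" where
  "iter_deriv \<alpha> f = foldr partial_deriv \<alpha> f"

definition smooth :: "(real^3 \<Rightarrow> 'a::real_normed_vector) \<Rightarrow> bool" where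
  "smooth f \<longleftrightarrow> (\<forall>\<alpha> x. iter_deriv \<alpha> f differentiable (at x))"

definition schwartz :: "(real^3 \<Rightarrow> complex) set" where
  "schwartz = {\<theta>. smooth \<theta> \<and>
     (\<forall>(m::nat) \<alpha>. bounded (range (\<lambda>x. (1 + norm x) ^ m *\<^sub>R iter_deriv \<alpha> \<theta> x)))}"

definition schwartz_norm :: "nat \<Rightarrow> (real^3 \<Rightarrow> complex) \<Rightarrow> real" where
  "schwartz_norm m \<theta> =
     (SUP (\<alpha>, x) \<in> {\<alpha>. length \<alpha> \<le> m} \<times> UNIV. (1 + norm x) ^ m * norm (iter_deriv \<alpha> \<theta> x))"

definition fourier :: "(real^3 \<Rightarrow> complex) \<Rightarrow> real^3 \<Rightarrow> complex" where
  "fourier f \<xi> = (\<integral>x. cis (- (x \<bullet> \<xi>)) * f x \<partial>lborel)"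

definition inv_fourier :: "(real^3 \<Rightarrow> complex) \<Rightarrow> real^3 \<Rightarrow> complex" where
  "inv_fourier f x = (\<integral>\<xi>. cis (x \<bullet> \<xi>) * f \<xi> \<partial>lborel) / of_real ((2 * pi) ^ 3)"


section \<open>Vector-valued tempered distributions\<close>

text \<open>A vector-valued distribution is a functional on complex test functions with values in
  \<open>\<complex>\<^sup>3\<close>. Its values outside of \<open>schwartz\<close> are irrelevant; in particular equality of distributions
  means \<open>dist_eq\<close>.\<close>

type_synonym dist3 = "(real^3 \<Rightarrow> complex) \<Rightarrow> complex^3"

text \<open>The \<open>\<real>\<^sup>3\<close>-valued tempered distributions are those that map real test functions to real
  vectors; linearity determines them by their values there.\<close>

definition tempered :: "dist3 set" where
  "tempered = {T.
     (\<forall>\<theta>\<in>schwartz. \<forall>\<eta>\<in>schwartz. T (\<lambda>x. \<theta> x + \<eta> x) = T \<theta> + T \<eta>) \<and>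
     (\<forall>\<theta>\<in>schwartz. \<forall>c. T (\<lambda>x. c * \<theta> x) = c *s T \<theta>) \<and>
     (\<exists>C m. \<forall>\<theta>\<in>schwartz. norm (T \<theta>) \<le> C * schwartz_norm m \<theta>) \<and>
     (\<forall>\<theta>\<in>schwartz. (\<forall>x. \<theta> x \<in> \<real>) \<longrightarrow> (\<forall>i. T \<theta> $ i \<in> \<real>))}"

definition dist_eq :: "dist3 \<Rightarrow> dist3 \<Rightarrow> bool" where
  "dist_eq T U \<longleftrightarrow> (\<forall>\<theta>\<in>schwartz. T \<theta> = U \<theta>)"

definition dist_add :: "dist3 \<Rightarrow> dist3 \<Rightarrow> dist3" where
  "dist_add T U = (\<lambda>\<theta>. T \<theta> + U \<theta>)"

definition dist_div :: "dist3 \<Rightarrow> (real^3 \<Rightarrow> complex) \<Rightarrow> complex" where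
  "dist_div T = (\<lambda>\<theta>. - (\<Sum>i\<in>UNIV. T (partial_deriv i \<theta>) $ i))"

definition div_free :: "dist3 \<Rightarrow> bool" where
  "div_free T \<longleftrightarrow> (\<forall>\<theta>\<in>schwartz. dist_div T \<theta> = 0)"

definition dist_fourier :: "dist3 \<Rightarrow> dist3" where
  "dist_fourier T = (\<lambda>\<theta>. T (fourier \<theta>))"

definition dist_inv_fourier :: "dist3 \<Rightarrow> dist3" where
  "dist_inv_fourier T = (\<lambda>\<theta>. T (inv_fourier \<theta>))"

definition dist_mult :: "(real^3 \<Rightarrow> real) \<Rightarrow> dist3 \<Rightarrow> dist3" where
  "dist_mult m T = (\<lambda>\<theta>. T (\<lambda>\<xi>. of_real (m \<xi>) * \<theta> \<xi>))"


section \<open>Lebesgue norms of distributions\<close>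

text \<open>Powers with a positive real exponent.\<close>

definition epowr :: "ennreal \<Rightarrow> real \<Rightarrow> ennreal" where
  "epowr x r = (if x = \<infinity> then \<infinity> else ennreal (enn2real x powr r))"

definition Lp_norm :: "ennreal \<Rightarrow> (real^3 \<Rightarrow> complex^3) \<Rightarrow> ennreal" where
  "Lp_norm p f =
     (if p = \<infinity> then esssup lborel (\<lambda>x. ennreal (norm (f x)))
      else epowr (\<integral>\<^sup>+x. epowr (ennreal (norm (f x))) (enn2real p) \<partial>lborel) (1 / enn2real p))"

definition represents :: "(real^3 \<Rightarrow> complex^3) \<Rightarrow> dist3 \<Rightarrow> bool" where
  "represents f T \<longleftrightarrow> f \<in> borel_measurable borel \<and>
     (\<forall>\<theta>\<in>schwartz. integrable lborel (\<lambda>x. \<theta> x *s f x) \<and> T \<theta> = (\<integral>x. \<theta> x *s f x \<partial>lborel))"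

text \<open>Representing functions are unique up to null sets, so the infimum below is the norm of the
  representing function if there is one, and \<open>\<infinity>\<close> otherwise.\<close>

definition dist_Lp_norm :: "ennreal \<Rightarrow> dist3 \<Rightarrow> ennreal" where
  "dist_Lp_norm p T = Inf {Lp_norm p f |f. represents f T}"

definition Lp_space :: "ennreal \<Rightarrow> dist3 set" where
  "Lp_space p = {T \<in> tempered. dist_Lp_norm p T < \<infinity>}"


section \<open>Homogeneous Besov spaces\<close>

definition littlewood_paley :: "(real^3 \<Rightarrow> real) \<Rightarrow> (real^3 \<Rightarrow> real) \<Rightarrow> bool" where
  "littlewood_paley \<chi>\<^sub>0 \<phi> \<longleftrightarrow>
     smooth \<chi>\<^sub>0 \<and> closure {\<xi>. \<chi>\<^sub>0 \<xi> \<noteq> 0} \<subseteq> ball 0 (4/3) \<and> range \<chi>\<^sub>0 \<subseteq> {0..1} \<and>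
     smooth \<phi> \<and> closure {\<xi>. \<phi> \<xi> \<noteq> 0} \<subseteq> {\<xi>. 3/4 \<le> norm \<xi> \<and> norm \<xi> \<le> 8/3} \<and>
     range \<phi> \<subseteq> {0..1} \<and>
     (\<forall>\<xi>. ((\<lambda>j::int. \<phi> (2 powi (-j) *\<^sub>R \<xi>)) has_sum (1 - \<chi>\<^sub>0 \<xi>)) {0..}) \<and>
     (\<forall>\<xi>. \<xi> \<noteq> 0 \<longrightarrow> ((\<lambda>j::int. \<phi> (2 powi (-j) *\<^sub>R \<xi>)) has_sum 1) UNIV)"

text \<open>With \<open>\<phi>\<close> for \<open>m\<close> this is the dyadic block \<open>\<Delta>\<^sub>j\<close>, with \<open>\<chi>\<^sub>0\<close> the low-frequency cut-off \<open>S\<^sub>j\<close>.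
  Since \<open>m\<close> need not be even, the result may be complex-valued.\<close>

definition dyadic_cutoff :: "(real^3 \<Rightarrow> real) \<Rightarrow> int \<Rightarrow> dist3 \<Rightarrow> dist3" where
  "dyadic_cutoff m j T =
     dist_inv_fourier (dist_mult (\<lambda>\<xi>. m (2 powi (-j) *\<^sub>R \<xi>)) (dist_fourier T))"

definition besov_norm :: "(real^3 \<Rightarrow> real) \<Rightarrow> real \<Rightarrow> ennreal \<Rightarrow> ennreal \<Rightarrow> dist3 \<Rightarrow> ennreal" where
  "besov_norm \<phi> s p q T =
     (if q = \<infinity>
      then (SUP j::int. ennreal (2 powr (of_int j * s)) * dist_Lp_norm p (dyadic_cutoff \<phi> j T))
      else epowr (\<Sum>\<^sub>\<infinity>j::int. ennreal (2 powr (of_int j * s * enn2real q))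
                    * epowr (dist_Lp_norm p (dyadic_cutoff \<phi> j T)) (enn2real q))
             (1 / enn2real q))"

definition besov ::
    "(real^3 \<Rightarrow> real) \<Rightarrow> (real^3 \<Rightarrow> real) \<Rightarrow> real \<Rightarrow> ennreal \<Rightarrow> ennreal \<Rightarrow> dist3 set" where
  "besov \<chi>\<^sub>0 \<phi> s p q =
     {T \<in> tempered. ((\<lambda>j::int. dist_Lp_norm \<infinity> (dyadic_cutoff \<chi>\<^sub>0 j T)) \<longlongrightarrow> 0) at_bot \<and>
        besov_norm \<phi> s p q T < \<infinity>}"

definition crit :: "real \<Rightarrow> real" where
  "crit r = - 1 + 3 / r"

end

theory Submission
  imports Defs "HOL-Probability.Probability"
begin

text \<open>The blocks \<open>\<Delta>\<^sub>j g\<close> are represented by functions \<open>f\<^sub>j\<close> with \<open>\<parallel>f\<^sub>j\<parallel>\<^sub>p \<le> K 2\<^bsup>-js\<^esup>\<close>, \<open>s = s\<^sub>p\<close>.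
  Let \<open>2\<^sup>J\<close> be comparable to \<open>N\<close>. For \<open>j > J\<close> the part of \<open>f\<^sub>j\<close> above a height \<open>\<lambda>\<^sub>j\<close> that grows
  geometrically in \<open>j\<close> is small in \<open>L\<^sub>2\<close>; these parts, localised again to frequencies of size
  \<open>2\<^sup>j\<close> and projected onto divergence free fields, sum up to \<open>h\<close>. What is left, \<open>g - h\<close>,
  consists of the low frequencies, which Bernstein's inequality puts into \<open>L\<^bsub>2p\<^esub>\<close>, and of the parts of
  \<open>f\<^sub>j\<close> below the height \<open>\<lambda>\<^sub>j\<close>, which lie in \<open>L\<^bsub>2p\<^esub>\<close> as well. Since \<open>h\<close> is the only series that
  is summed, the convergence of \<open>\<Sum>\<^sub>j \<Delta>\<^sub>j g\<close> to \<open>g\<close> is never used: each \<open>\<Delta>\<^sub>k\<close> sees finitely many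
  blocks. All multipliers have compactly supported smooth symbols, so they are convolutions with
  Schwartz kernels, and Fubini's theorem, Fourier inversion for Schwartz functions and a pointwise
  Jensen inequality are the only analytic tools.\<close>

section \<open>Smooth functions\<close>

text \<open>Two obstacles shape the construction. The symbol \<open>\<phi>\<close> need not be even,
  so the blocks of the real distribution \<open>g\<close> may be complex, while cutting by height is
  nonlinear and has to return real fields. The blocks are therefore taken with the even part
  \<open>\<eta>\<close> of \<open>\<phi>\<close>, which replaces representing functions by their
  real parts, and the kernels that build \<open>h\<close> have even symbols, hence are real. Cutting
  by height also destroys the divergence condition, and the Leray projector is singular at frequency
  0; it enters only through the annular symbols \<open>leray\<close>, which agree with it wherever
  \<open>\<eta>\<close> at the same scale is nonzero. For divergence free \<open>g\<close> the k-th
  block is a finite linear expression in neighbouring even blocks (\<open>div_free_block\<close>),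
  and the k-th block of \<open>h\<close> is the same expression in their tall parts
  (\<open>series_block\<close>). Subtracting the two describes \<open>g - h\<close> without any
  limit. As \<open>h\<close> has no low frequencies, the condition at frequency 0 in the Besov space
  passes from \<open>g\<close> to \<open>g - h\<close>. The exponent 2p makes both interpolation
  exponents between height and \<open>L_p\<close> norm equal to 1/2.\<close>

lemma iter_deriv_Nil [simp]: "iter_deriv [] f = f"
  by (simp add: iter_deriv_def)

lemma iter_deriv_Cons [simp]: "iter_deriv (i # \<alpha>) f = partial_deriv i (iter_deriv \<alpha> f)"
  by (simp add: iter_deriv_def)

lemma iter_deriv_append: "iter_deriv (\<alpha> @ \<beta>) f = iter_deriv \<alpha> (iter_deriv \<beta> f)"
  by (simp add: iter_deriv_def)

lemma partial_deriv_eq: "(f has_derivative D) (at x) \<Longrightarrow> partial_deriv i f x = D (axis i 1)"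
  using frechet_derivative_at by (force simp: partial_deriv_def)

lemma smooth_imp_differentiable: "smooth f \<Longrightarrow> f differentiable (at x)"
  unfolding smooth_def using iter_deriv_Nil by metis

lemma smooth_has_derivative:
  "smooth f \<Longrightarrow> (f has_derivative frechet_derivative f (at x)) (at x)"
  using smooth_imp_differentiable frechet_derivative_works by blast

lemma smooth_imp_continuous: "smooth f \<Longrightarrow> continuous_on UNIV f"
  by (simp add: continuous_at_imp_continuous_on differentiable_imp_continuous_within
      smooth_imp_differentiable)

lemma smooth_imp_measurable [measurable_dest]:
  "smooth f \<Longrightarrow> f \<in> borel_measurable borel"
  by (simp add: borel_measurable_continuous_onI smooth_imp_continuous)

lemma smooth_partial_deriv [intro]: "smooth f \<Longrightarrow> smooth (partial_deriv i f)"
  unfolding smooth_def by (metis iter_deriv_Cons iter_deriv_Nil iter_deriv_append)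

lemma iter_deriv_in_class:
  assumes "\<And>h i. h \<in> A \<Longrightarrow> partial_deriv i h \<in> A" "f \<in> A"
  shows "iter_deriv \<alpha> f \<in> A"
  by (induction \<alpha>) (auto intro: assms)

text \<open>Serves as a coinduction principle. Closure properties are proved by guessing a set of
  functions that absorbs the terms produced by one differentiation, which avoids Leibniz and chain
  formulas for iterated derivatives.\<close>

lemma smooth_class:
  assumes "\<And>h x. h \<in> A \<Longrightarrow> h differentiable (at x)"
    and "\<And>h i. h \<in> A \<Longrightarrow> partial_deriv i h \<in> A" and "f \<in> A"
  shows "smooth f"
  unfolding smooth_def using iter_deriv_in_class[of A f] assms by blast

lemma partial_deriv_add:
  assumes "smooth f" "smooth g"
  shows "partial_deriv i (\<lambda>x. f x + g x) = (\<lambda>x. partial_deriv i f x + partial_deriv i g x)"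
proof
  fix x
  show "partial_deriv i (\<lambda>x. f x + g x) x = partial_deriv i f x + partial_deriv i g x"
    unfolding partial_deriv_eq[OF has_derivative_add[OF smooth_has_derivative[OF assms(1)]
        smooth_has_derivative[OF assms(2)]]]
    by (simp add: partial_deriv_def)
qed

lemma smooth_add [intro]:
  assumes "smooth f" "smooth g"
  shows "smooth (\<lambda>x. f x + g x)"
proof (rule smooth_class[where A = "{h. \<exists>f g. smooth f \<and> smooth g \<and> h = (\<lambda>x. f x + g x)}"])
  fix h :: "real^3 \<Rightarrow> 'a" and i
  assume "h \<in> {h. \<exists>f g. smooth f \<and> smooth g \<and> h = (\<lambda>x. f x + g x)}"
  then show "partial_deriv i h \<in> {h. \<exists>f g. smooth f \<and> smooth g \<and> h = (\<lambda>x. f x + g x)}"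
    using partial_deriv_add smooth_partial_deriv by blast
qed (use assms in \<open>auto intro!: differentiable_add intro: smooth_imp_differentiable\<close>)

lemma partial_deriv_const: "partial_deriv i (\<lambda>x. c) = (\<lambda>x. 0)"
  by (auto simp: partial_deriv_def)

lemma smooth_const [simp, intro]: "smooth (\<lambda>x. c)"
  by (rule smooth_class[where A = "range (\<lambda>c x. c)"]) (auto simp: partial_deriv_const)

lemma smooth_sum:
  assumes "\<And>i. i \<in> I \<Longrightarrow> smooth (f i)"
  shows "smooth (\<lambda>x. \<Sum>i\<in>I. f i x)"
  using assms by (induction I rule: infinite_finite_induct) auto

lemma partial_deriv_linear:
  assumes "bounded_linear L" "smooth f"
  shows "partial_deriv i (\<lambda>x. L (f x)) = (\<lambda>x. L (partial_deriv i f x))"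
proof
  fix x
  show "partial_deriv i (\<lambda>x. L (f x)) x = L (partial_deriv i f x)"
    unfolding partial_deriv_eq[OF bounded_linear.has_derivative[OF assms(1)
          smooth_has_derivative[OF assms(2)]]]
    by (simp add: partial_deriv_def)
qed

lemma smooth_linear:
  assumes "bounded_linear L" "smooth f"
  shows "smooth (\<lambda>x. L (f x))"
proof (rule smooth_class[where A = "{h. \<exists>f. smooth f \<and> h = (\<lambda>x. L (f x))}"])
  fix h :: "real^3 \<Rightarrow> 'b" and i
  assume h: "h \<in> {h. \<exists>f. smooth f \<and> h = (\<lambda>x. L (f x))}"
  then show "partial_deriv i h \<in> {h. \<exists>f. smooth f \<and> h = (\<lambda>x. L (f x))}"
    using partial_deriv_linear[OF assms(1)] smooth_partial_deriv by blast
  fix x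
  show "h differentiable at x"
    using h bounded_linear.has_derivative[OF assms(1) smooth_has_derivative]
    unfolding differentiable_def by blast
qed (use assms in auto)

lemma smooth_of_real: "smooth f \<Longrightarrow> smooth (\<lambda>x. of_real (f x) :: complex)"
  by (rule smooth_linear[OF bounded_linear_of_real])

lemma smooth_coord: "smooth (\<lambda>x. x $ i)"
proof (rule smooth_class[where A = "insert (\<lambda>x. x $ i) {h. \<exists>c. h = (\<lambda>x. c)}"])
  have *: "((\<lambda>x::real^3. x $ i) has_derivative (\<lambda>x. x $ i)) (at x)" for x
    by (intro bounded_linear_imp_has_derivative bounded_linear_vec_nth)
  fix h :: "real^3 \<Rightarrow> real" and k
  assume h: "h \<in> insert (\<lambda>x. x $ i) {h. \<exists>c. h = (\<lambda>x. c)}"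
  have "partial_deriv k (\<lambda>x::real^3. x $ i) = (\<lambda>x. axis k 1 $ i)"
    using partial_deriv_eq[OF *] by auto
  then show "partial_deriv k h \<in> insert (\<lambda>x. x $ i) {h. \<exists>c. h = (\<lambda>x. c)}"
    using h by (auto simp: partial_deriv_const)
  fix x
  show "h differentiable at x"
    using h has_derivative_const differentiable_def * by (smt (verit, best) insertE mem_Collect_eq)
qed auto

lemma partial_deriv_coord: "partial_deriv k (\<lambda>x::real^3. x $ i) = (\<lambda>x. if i = k then 1 else 0)"
proof
  fix x :: "real^3"
  have "((\<lambda>x::real^3. x $ i) has_derivative (\<lambda>x. x $ i)) (at x)"
    by (intro bounded_linear_imp_has_derivative bounded_linear_vec_nth)
  from partial_deriv_eq[OF this] show "partial_deriv k (\<lambda>x::real^3. x $ i) x = (if i = k then 1 else 0)"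
    by (auto simp: axis_def)
qed

lemma partial_deriv_mult:
  fixes f g :: "real^3 \<Rightarrow> 'a::real_normed_algebra"
  assumes "smooth f" "smooth g"
  shows "partial_deriv i (\<lambda>x. f x * g x) = (\<lambda>x. f x * partial_deriv i g x + partial_deriv i f x * g x)"
proof
  fix x
  show "partial_deriv i (\<lambda>x. f x * g x) x = f x * partial_deriv i g x + partial_deriv i f x * g x"
    unfolding partial_deriv_eq[OF has_derivative_mult[OF smooth_has_derivative[OF assms(1)]
        smooth_has_derivative[OF assms(2)]]]
    by (simp add: partial_deriv_def)
qed

text \<open>The Leibniz rule turns one product into two, so products alone are not stable under
  differentiation; their sums are.\<close>

inductive_set product_sums :: "(real^3 \<Rightarrow> 'a::real_normed_algebra) set" where
  prod: "smooth f \<Longrightarrow> smooth g \<Longrightarrow> (\<lambda>x. f x * g x) \<in> product_sums"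
| add: "f \<in> product_sums \<Longrightarrow> g \<in> product_sums \<Longrightarrow> (\<lambda>x. f x + g x) \<in> product_sums"

lemma smooth_mult [intro]:
  fixes f g :: "real^3 \<Rightarrow> 'a::real_normed_algebra"
  assumes "smooth f" "smooth g"
  shows "smooth (\<lambda>x. f x * g x)"
proof (rule smooth_class[where A = product_sums])
  have diff: "h differentiable at x" if "h \<in> product_sums" for h :: "real^3 \<Rightarrow> 'a" and x
    using that
    by (induction arbitrary: x)
      (simp_all add: smooth_imp_differentiable)
  then show "\<And>(h :: real^3 \<Rightarrow> 'a) x. h \<in> product_sums \<Longrightarrow> h differentiable at x" .
  show "partial_deriv i h \<in> product_sums" if "h \<in> product_sums" for h :: "real^3 \<Rightarrow> 'a" and i
    using that
  proof induction
    case (prod f g)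
    then show ?case
      by (auto simp: partial_deriv_mult intro!: product_sums.intros)
  next
    case (add f g)
    \<comment> \<open>\<open>partial_deriv_add\<close> asks for smooth summands. Members of the
      class are so far only known to be differentiable, so the sum rule is applied directly to their
      derivatives.\<close>
    have "partial_deriv i (\<lambda>x. f x + g x) = (\<lambda>x. partial_deriv i f x + partial_deriv i g x)"
    proof
      fix x
      show "partial_deriv i (\<lambda>x. f x + g x) x = partial_deriv i f x + partial_deriv i g x"
        using partial_deriv_eq[OF has_derivative_add, of f "frechet_derivative f (at x)" x g
            "frechet_derivative g (at x)"] diff[OF add.hyps(1)] diff[OF add.hyps(2)]
        by (simp add: partial_deriv_def frechet_derivative_works)
    qed
    then show ?case
      by (simp add: product_sums.add add)
  qed
qed (auto intro: product_sums.intros assms)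

lemma smooth_uminus: "smooth f \<Longrightarrow> smooth (\<lambda>x. - f x)"
  by (rule smooth_linear[OF bounded_linear_minus[OF bounded_linear_ident]])

lemma partial_deriv_scale:
  assumes "smooth f"
  shows "partial_deriv i (\<lambda>x. f (c *\<^sub>R x)) = (\<lambda>x. c *\<^sub>R partial_deriv i f (c *\<^sub>R x))"
proof
  fix x
  have D: "((\<lambda>x::real^3. c *\<^sub>R x) has_derivative (\<lambda>h. c *\<^sub>R h)) (at x)"
    by (auto intro!: derivative_eq_intros)
  have lin: "linear (frechet_derivative f (at (c *\<^sub>R x)))"
    using smooth_has_derivative[OF assms] has_derivative_linear by blast
  show "partial_deriv i (\<lambda>x. f (c *\<^sub>R x)) x = c *\<^sub>R partial_deriv i f (c *\<^sub>R x)"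
    using partial_deriv_eq[OF has_derivative_compose[OF D smooth_has_derivative[OF assms]]] lin
    by (simp add: partial_deriv_def linear_cmul)
qed

lemma smooth_scale [intro]:
  assumes "smooth f"
  shows "smooth (\<lambda>x. f (c *\<^sub>R x))"
proof (rule smooth_class[where A = "{h. \<exists>f. smooth f \<and> h = (\<lambda>x. f (c *\<^sub>R x))}"])
  fix h :: "real^3 \<Rightarrow> 'a" and i
  assume "h \<in> {h. \<exists>f. smooth f \<and> h = (\<lambda>x. f (c *\<^sub>R x))}"
  then obtain f where f: "smooth f" "h = (\<lambda>x. f (c *\<^sub>R x))" by auto
  have "smooth (\<lambda>x. c *\<^sub>R partial_deriv i f x)"
    using f by (intro smooth_linear[OF bounded_linear_scaleR_right] smooth_partial_deriv)
  then show "partial_deriv i h \<in> {h. \<exists>f. smooth f \<and> h = (\<lambda>x. f (c *\<^sub>R x))}"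
    using f by (auto simp: partial_deriv_scale)
  fix x
  have D: "((\<lambda>x::real^3. c *\<^sub>R x) has_derivative (\<lambda>h. c *\<^sub>R h)) (at x)"
    by (auto intro!: derivative_eq_intros)
  show "h differentiable at x"
    using has_derivative_compose[OF D smooth_has_derivative[OF f(1)]] f(2)
    by (auto simp: differentiable_def)
qed (use assms in auto)

lemma partial_deriv_eq_0_outside:
  assumes "\<And>x. x \<in> S \<Longrightarrow> f x = 0" "open S" "x \<in> S"
  shows "partial_deriv i f x = 0"
proof -
  have "(f has_derivative (\<lambda>h. 0)) (at x)"
    by (rule has_derivative_transform_within_open[where f = "\<lambda>x. 0" and s = S]) (use assms in auto)
  from partial_deriv_eq[OF this] show ?thesis .
qed

text \<open>The quotient rule changes the numerator and raises the exponent by one, so the stable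
  class ranges over all exponents and all smooth numerators vanishing near 0. The lemma makes the
  Leray symbol smooth once it is cut off near the origin.\<close>

lemma smooth_divide_norm_power:
  fixes f :: "real^3 \<Rightarrow> real"
  assumes "smooth f" "r > 0" "\<And>x. norm x < r \<Longrightarrow> f x = 0"
  shows "smooth (\<lambda>x. f x / (x \<bullet> x) ^ n)"
proof (rule smooth_class[where
      A = "{h. \<exists>f n. smooth f \<and> (\<forall>x. norm x < r \<longrightarrow> f x = 0) \<and> h = (\<lambda>x. f x / (x \<bullet> x) ^ n)}"])
  let ?A = "{h. \<exists>f n. smooth f \<and> (\<forall>x. norm x < r \<longrightarrow> f x = 0) \<and> h = (\<lambda>x. f x / (x \<bullet> x) ^ n)}"
  fix h :: "real^3 \<Rightarrow> real"
  assume "h \<in> ?A"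
  then obtain f :: "real^3 \<Rightarrow> real" and n
    where f: "smooth f" "\<And>x. norm x < r \<Longrightarrow> f x = 0" and h: "h = (\<lambda>x. f x / (x \<bullet> x) ^ n)"
    by auto
  have h0: "x \<in> ball 0 r \<Longrightarrow> h x = 0" for x
    using f(2)[of x] by (auto simp: h)
  have D: "(h has_derivative
      (\<lambda>y. (frechet_derivative f (at x) y * (x \<bullet> x) - 2 * real n * f x * (x \<bullet> y)) / (x \<bullet> x) ^ Suc n))
      (at x)" if "x \<noteq> 0" for x
  proof -
    have *: "(x \<bullet> x) \<noteq> 0" using that by simp
    have "(h has_derivative
      (\<lambda>y. (frechet_derivative f (at x) y * (x \<bullet> x) ^ n
         - f x * (of_nat n * (x \<bullet> y + y \<bullet> x) * (x \<bullet> x) ^ (n - 1))) / ((x \<bullet> x) ^ n * (x \<bullet> x) ^ n))) (at x)"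
      unfolding h
      by (intro has_derivative_divide' has_derivative_power has_derivative_inner
          smooth_has_derivative f has_derivative_ident) (use that in auto)
    moreover have "(d * (x \<bullet> x) ^ n - f x * (of_nat n * (x \<bullet> y + y \<bullet> x) * (x \<bullet> x) ^ (n - 1))) /
       ((x \<bullet> x) ^ n * (x \<bullet> x) ^ n) = (d * (x \<bullet> x) - 2 * real n * f x * (x \<bullet> y)) / (x \<bullet> x) ^ Suc n"
      for y d
    \<comment> \<open>The split is due to \<open>n - 1\<close>, which is truncated at
      \<open>n = 0\<close>; there the factor \<open>of_nat n\<close> removes the term.\<close>
    proof (cases n)
      case (Suc k)
      with * show ?thesis
        by (simp add: divide_simps inner_commute) (simp add: algebra_simps)
    qed (use * in \<open>simp add: divide_simps\<close>)
    ultimately show ?thesis by simp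
  qed
  show "h differentiable at x" for x :: "real^3"
  proof (cases "x = 0")
    case True
    have "(h has_derivative (\<lambda>h. 0)) (at 0)"
      by (rule has_derivative_transform_within_open[where f = "\<lambda>x. 0" and s = "ball 0 r"])
        (use h0 \<open>r > 0\<close> in auto)
    then show ?thesis using True by (auto simp: differentiable_def)
  next
    case False
    then show ?thesis using D by (auto simp: differentiable_def)
  qed
  fix i
  \<comment> \<open>The new numerator, read off from \<open>D\<close> in the direction
    \<open>axis i 1\<close>.\<close>
  let ?g = "\<lambda>x. partial_deriv i f x * (x \<bullet> x) + (- 2 * real n) * (f x * (x $ i))"
  have sq: "smooth (\<lambda>x::real^3. x \<bullet> x)"
    unfolding inner_vec_def by (auto intro!: smooth_sum smooth_mult smooth_coord)
  have "smooth ?g"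
    by (intro smooth_add smooth_mult smooth_const smooth_coord smooth_partial_deriv f sq)
  moreover have g0: "?g x = 0" if "norm x < r" for x
    using partial_deriv_eq_0_outside[of "ball 0 r" f x i] that f(2) by auto
  moreover have "partial_deriv i h x = ?g x / (x \<bullet> x) ^ Suc n" for x
  proof (cases "x = 0")
    case True
    then show ?thesis
      using partial_deriv_eq_0_outside[of "ball 0 r" h x i] h0 g0[of x] \<open>r > 0\<close> by auto
  next
    case False
    then show ?thesis
      using partial_deriv_eq[OF D[OF False], of i]
      by (simp add: partial_deriv_def inner_axis)
  qed
  ultimately show "partial_deriv i h \<in> ?A"
    by (intro CollectI exI[of _ ?g] exI[of _ "Suc n"]) auto
qed (use assms in auto)

section \<open>Schwartz functions\<close>

definition rapid :: "(real^3 \<Rightarrow> complex) \<Rightarrow> bool" where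
  "rapid f \<longleftrightarrow> (\<forall>m::nat. \<exists>C. \<forall>x. (1 + norm x) ^ m * norm (f x) \<le> C)"

lemma schwartz_iff: "\<theta> \<in> schwartz \<longleftrightarrow> smooth \<theta> \<and> (\<forall>\<alpha>. rapid (iter_deriv \<alpha> \<theta>))"
  unfolding schwartz_def rapid_def bounded_iff by (auto simp: abs_mult)

lemma schwartz_class:
  assumes "\<And>h x. h \<in> A \<Longrightarrow> h differentiable (at x)"
    and "\<And>h i. h \<in> A \<Longrightarrow> partial_deriv i h \<in> A" and "\<And>h. h \<in> A \<Longrightarrow> rapid h" and "f \<in> A"
  shows "f \<in> schwartz"
  unfolding schwartz_iff using smooth_class[of A f] iter_deriv_in_class[of A f] assms by blast

lemma schwartz_smooth: "\<theta> \<in> schwartz \<Longrightarrow> smooth \<theta>"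
  by (simp add: schwartz_iff)

lemma schwartz_rapid: "\<theta> \<in> schwartz \<Longrightarrow> rapid \<theta>"
  unfolding schwartz_iff using iter_deriv_Nil by metis

lemma schwartz_measurable [measurable_dest]: "\<theta> \<in> schwartz \<Longrightarrow> \<theta> \<in> borel_measurable borel"
  using schwartz_smooth smooth_imp_measurable by blast

lemma schwartz_partial_deriv: "\<theta> \<in> schwartz \<Longrightarrow> partial_deriv i \<theta> \<in> schwartz"
  unfolding schwartz_iff by (metis iter_deriv_Cons iter_deriv_Nil iter_deriv_append smooth_partial_deriv)

lemma rapidE:
  assumes "rapid f"
  obtains C where "C > 0" "\<And>x. (1 + norm x) ^ m * norm (f x) \<le> C"
proof -
  obtain C where "\<forall>x. (1 + norm x) ^ m * norm (f x) \<le> C" using assms by (auto simp: rapid_def)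
  then have "\<And>x. (1 + norm x) ^ m * norm (f x) \<le> max C 1" by (meson max.coboundedI1)
  then show ?thesis using that[of "max C 1"] by simp
qed

lemma rapid_le:
  assumes "rapid f" and "\<And>x. norm (g x) \<le> c * (1 + norm x) ^ k * norm (f x)" and "c \<ge> 0"
  shows "rapid g"
  unfolding rapid_def
proof
  fix m
  obtain C where C: "\<And>x. (1 + norm x) ^ (m + k) * norm (f x) \<le> C" using rapidE[OF assms(1)] by metis
  have "(1 + norm x) ^ m * norm (g x) \<le> c * C" for x
  proof -
    have "(1 + norm x) ^ m * norm (g x) \<le> (1 + norm x) ^ m * (c * (1 + norm x) ^ k * norm (f x))"
      by (intro mult_left_mono assms) auto
    also have "\<dots> = c * ((1 + norm x) ^ (m + k) * norm (f x))" by (simp add: power_add)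
    also have "\<dots> \<le> c * C" by (intro mult_left_mono C assms)
    finally show ?thesis .
  qed
  then show "\<exists>C. \<forall>x. (1 + norm x) ^ m * norm (g x) \<le> C" by blast
qed

lemma rapid_add:
  assumes "rapid f" "rapid g"
  shows "rapid (\<lambda>x. f x + g x)"
  unfolding rapid_def
proof
  fix m
  obtain C D where C: "\<And>x. (1 + norm x) ^ m * norm (f x) \<le> C"
    and D: "\<And>x. (1 + norm x) ^ m * norm (g x) \<le> D"
    using rapidE[OF assms(1)] rapidE[OF assms(2)] by metis
  have "(1 + norm x) ^ m * norm (f x + g x) \<le> C + D" for x
  proof -
    have "(1 + norm x) ^ m * norm (f x + g x) \<le> (1 + norm x) ^ m * (norm (f x) + norm (g x))"
      by (intro mult_left_mono norm_triangle_ineq) auto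
    also have "\<dots> \<le> C + D" using C[of x] D[of x] by (simp add: algebra_simps)
    finally show ?thesis .
  qed
  then show "\<exists>C. \<forall>x. (1 + norm x) ^ m * norm (f x + g x) \<le> C" by blast
qed

lemma schwartz_add:
  assumes "\<theta> \<in> schwartz" "\<eta> \<in> schwartz"
  shows "(\<lambda>x. \<theta> x + \<eta> x) \<in> schwartz"
proof (rule schwartz_class[where
      A = "{h. \<exists>\<theta> \<eta>. \<theta> \<in> schwartz \<and> \<eta> \<in> schwartz \<and> h = (\<lambda>x. \<theta> x + \<eta> x)}"], goal_cases)
  case (1 h x)
  then show ?case by (auto simp: smooth_imp_differentiable schwartz_smooth)
next
  case (2 h i)
  then obtain \<theta> \<eta> where "\<theta> \<in> schwartz" "\<eta> \<in> schwartz" and h: "h = (\<lambda>x. \<theta> x + \<eta> x)" by auto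
  moreover from this have "partial_deriv i h = (\<lambda>x. partial_deriv i \<theta> x + partial_deriv i \<eta> x)"
    by (simp add: partial_deriv_add schwartz_smooth)
  ultimately show ?case using schwartz_partial_deriv by blast
qed (use assms in \<open>auto intro: rapid_add schwartz_rapid\<close>)

lemma schwartz_linear:
  assumes "bounded_linear L" "\<theta> \<in> schwartz"
  shows "(\<lambda>x. L (\<theta> x)) \<in> schwartz"
proof (rule schwartz_class[where A = "{h. \<exists>\<theta>. \<theta> \<in> schwartz \<and> h = (\<lambda>x. L (\<theta> x))}"], goal_cases)
  case (1 h x)
  then show ?case
    using smooth_linear[OF assms(1)] schwartz_smooth smooth_imp_differentiable by blast
next
  case (2 h i)
  then show ?case
    using partial_deriv_linear[OF assms(1)] schwartz_smooth schwartz_partial_deriv by blast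
next
  case (3 h)
  then obtain \<theta> where \<theta>: "\<theta> \<in> schwartz" "h = (\<lambda>x. L (\<theta> x))" by auto
  obtain K where "K > 0" "\<And>x. norm (L x) \<le> norm x * K"
    using bounded_linear.pos_bounded[OF assms(1)] by auto
  then have "norm (h x) \<le> K * (1 + norm x) ^ 0 * norm (\<theta> x)" for x
    using \<theta>(2) by (simp add: mult.commute)
  then show ?case
    using rapid_le[OF schwartz_rapid[OF \<theta>(1)]] \<open>K > 0\<close> by (meson less_imp_le)
qed (use assms in auto)

lemma schwartz_cmult: "\<theta> \<in> schwartz \<Longrightarrow> (\<lambda>x. c * \<theta> x) \<in> schwartz"
  by (rule schwartz_linear[OF bounded_linear_mult_right])

lemma schwartz_cnj: "\<theta> \<in> schwartz \<Longrightarrow> (\<lambda>x. cnj (\<theta> x)) \<in> schwartz"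
  by (rule schwartz_linear[OF bounded_linear_cnj])

lemma schwartz_zero: "(\<lambda>x. 0) \<in> schwartz"
  unfolding schwartz_iff
proof (intro conjI allI)
  fix \<alpha>
  have "iter_deriv \<alpha> (\<lambda>x. 0 :: complex) \<in> {\<lambda>x. 0}"
    by (rule iter_deriv_in_class) (auto simp: partial_deriv_const)
  then show "rapid (iter_deriv \<alpha> (\<lambda>x. 0 :: complex))" by (auto simp: rapid_def)
qed simp

lemma schwartz_sum: "(\<And>i. i \<in> I \<Longrightarrow> \<theta> i \<in> schwartz) \<Longrightarrow> (\<lambda>x. \<Sum>i\<in>I. \<theta> i x) \<in> schwartz"
  by (induction I rule: infinite_finite_induct) (auto intro: schwartz_zero schwartz_add)

lemma smooth_cis_inner: "smooth (\<lambda>x. cis (x \<bullet> \<xi>))"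
  and partial_deriv_cis_inner:
    "partial_deriv i (\<lambda>x. cis (x \<bullet> \<xi>)) = (\<lambda>x. \<i> * of_real (\<xi> $ i) * cis (x \<bullet> \<xi>))"
proof -
  have D: "((\<lambda>x. c * cis (x \<bullet> \<xi>)) has_derivative (\<lambda>h. c * (of_real (h \<bullet> \<xi>) * (\<i> * cis (x \<bullet> \<xi>))))) (at x)"
    for x c
  proof -
    have inn: "((\<lambda>x. x \<bullet> \<xi>) has_derivative (\<lambda>h. h \<bullet> \<xi>)) (at x)"
      by (auto intro!: derivative_eq_intros)
    have "(cis has_derivative (\<lambda>h. of_real h * (\<i> * cis (x \<bullet> \<xi>)))) (at (x \<bullet> \<xi>))"
      using has_derivative_cis[OF has_derivative_ident] by (simp add: scaleR_conv_of_real)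
    from has_derivative_mult_right[OF has_derivative_compose[OF inn this]] show ?thesis .
  qed
  have P: "partial_deriv i (\<lambda>x. c * cis (x \<bullet> \<xi>)) = (\<lambda>x. (c * \<i> * of_real (\<xi> $ i)) * cis (x \<bullet> \<xi>))" for i c
    using partial_deriv_eq[OF D] by (auto simp: inner_axis')
  show "smooth (\<lambda>x. cis (x \<bullet> \<xi>))"
  proof (rule smooth_class[where A = "range (\<lambda>c x. c * cis (x \<bullet> \<xi>))"], goal_cases)
    case (1 h x)
    then show ?case using D by (auto simp: differentiable_def)
  next
    case 3
    show ?case by (rule range_eqI[of _ _ 1]) simp
  qed (use P in auto)
  show "partial_deriv i (\<lambda>x. cis (x \<bullet> \<xi>)) = (\<lambda>x. \<i> * of_real (\<xi> $ i) * cis (x \<bullet> \<xi>))"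
    using P[of i 1] by simp
qed

lemma schwartz_mult_cis:
  assumes "\<theta> \<in> schwartz"
  shows "(\<lambda>x. cis (x \<bullet> \<xi>) * \<theta> x) \<in> schwartz"
proof (rule schwartz_class[where A = "{h. \<exists>\<theta>. \<theta> \<in> schwartz \<and> h = (\<lambda>x. cis (x \<bullet> \<xi>) * \<theta> x)}"], goal_cases)
  case (1 h x)
  then show ?case
    using smooth_mult[OF smooth_cis_inner] schwartz_smooth smooth_imp_differentiable by blast
next
  case (2 h i)
  then obtain \<theta> where \<theta>: "\<theta> \<in> schwartz" "h = (\<lambda>x. cis (x \<bullet> \<xi>) * \<theta> x)" by auto
  have "partial_deriv i h = (\<lambda>x. cis (x \<bullet> \<xi>) * (partial_deriv i \<theta> x + \<i> * of_real (\<xi> $ i) * \<theta> x))"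
    using \<theta> by (simp add: partial_deriv_mult smooth_cis_inner schwartz_smooth
        partial_deriv_cis_inner algebra_simps)
  moreover have "(\<lambda>x. partial_deriv i \<theta> x + \<i> * of_real (\<xi> $ i) * \<theta> x) \<in> schwartz"
    by (intro schwartz_add schwartz_cmult schwartz_partial_deriv \<theta>)
  ultimately show ?case by auto
next
  case (3 h)
  then obtain \<theta> where \<theta>: "\<theta> \<in> schwartz" "h = (\<lambda>x. cis (x \<bullet> \<xi>) * \<theta> x)" by auto
  then show ?case
    by (intro rapid_le[OF schwartz_rapid, of \<theta> h 1 0]) (auto simp: norm_mult)
qed (use assms in auto)

text \<open>Differentiating the coordinate factor leaves a bare Schwartz function behind, so the
  stable class has to contain a second, free summand \<open>\<eta>\<close>.\<close>

lemma schwartz_mult_coord: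
  assumes "\<theta> \<in> schwartz"
  shows "(\<lambda>x. of_real (x $ k) * \<theta> x) \<in> schwartz"
proof -
  have sm: "smooth (\<lambda>x::real^3. of_real (x $ k) :: complex)"
    by (intro smooth_of_real smooth_coord)
  have D: "partial_deriv i (\<lambda>x. of_real (x $ k) * \<theta> x + \<eta> x) =
      (\<lambda>x. of_real (x $ k) * partial_deriv i \<theta> x + ((if k = i then 1 else 0) * \<theta> x + partial_deriv i \<eta> x))"
    if "\<theta> \<in> schwartz" "\<eta> \<in> schwartz" for i \<theta> \<eta>
  proof -
    have pc: "partial_deriv i (\<lambda>x::real^3. of_real (x $ k) :: complex) = (\<lambda>x. if k = i then 1 else 0)"
      unfolding partial_deriv_linear[OF bounded_linear_of_real smooth_coord] partial_deriv_coord
      by (auto simp: fun_eq_iff)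
    show ?thesis
      unfolding partial_deriv_add[OF smooth_mult[OF sm schwartz_smooth[OF that(1)]] schwartz_smooth[OF that(2)]]
        partial_deriv_mult[OF sm schwartz_smooth[OF that(1)]] pc
      by (simp add: add.assoc)
  qed
  have "(\<lambda>x. of_real (x $ k) * \<theta> x + 0) \<in> schwartz"
  proof (rule schwartz_class[where A = "{h. \<exists>\<theta> \<eta>. \<theta> \<in> schwartz \<and> \<eta> \<in> schwartz \<and>
        h = (\<lambda>x. of_real (x $ k) * \<theta> x + \<eta> x)}"], goal_cases)
    case (1 h x)
    then obtain \<theta> \<eta> where "\<theta> \<in> schwartz" "\<eta> \<in> schwartz" "h = (\<lambda>x. of_real (x $ k) * \<theta> x + \<eta> x)"
      by auto
    then have "smooth h" by (simp only:) (intro smooth_add smooth_mult sm schwartz_smooth)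
    then show ?case by (rule smooth_imp_differentiable)
  next
    case (2 h i)
    then obtain \<theta> \<eta> where "\<theta> \<in> schwartz" "\<eta> \<in> schwartz" "h = (\<lambda>x. of_real (x $ k) * \<theta> x + \<eta> x)"
      by auto
    then have "partial_deriv i \<theta> \<in> schwartz"
      "(\<lambda>x. (if k = i then 1 else 0) * \<theta> x + partial_deriv i \<eta> x) \<in> schwartz"
      "partial_deriv i h = (\<lambda>x. of_real (x $ k) * partial_deriv i \<theta> x +
        ((if k = i then 1 else 0) * \<theta> x + partial_deriv i \<eta> x))"
      using D[of \<theta> \<eta> i]
      by (simp_all only: schwartz_partial_deriv schwartz_add schwartz_cmult)
    then show ?case by blast
  next
    case (3 h)
    then obtain \<theta> \<eta> where *: "\<theta> \<in> schwartz" "\<eta> \<in> schwartz" "h = (\<lambda>x. of_real (x $ k) * \<theta> x + \<eta> x)"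
      by auto
    have "norm (of_real (x $ k) * \<theta> x) \<le> 1 * (1 + norm x) ^ 1 * norm (\<theta> x)" for x
    proof -
      have "\<bar>x $ k\<bar> \<le> 1 + norm x" using component_le_norm_cart[of x k] by simp
      then show ?thesis by (simp add: norm_mult mult_right_mono)
    qed
    then have "rapid (\<lambda>x. of_real (x $ k) * \<theta> x)"
      by (rule rapid_le[OF schwartz_rapid[OF *(1)]]) simp
    then show ?case
      unfolding *(3) by (rule rapid_add) (rule schwartz_rapid[OF *(2)])
  next
    case 4
    then show ?case using assms schwartz_zero by blast
  qed
  then show ?thesis by simp
qed

lemma schwartz_reflect:
  assumes "\<theta> \<in> schwartz"
  shows "(\<lambda>x. \<theta> (- x)) \<in> schwartz"
proof (rule schwartz_class[where A = "{h. \<exists>\<theta>. \<theta> \<in> schwartz \<and> h = (\<lambda>x. \<theta> (- x))}"], goal_cases)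
  case (1 h x)
  then obtain \<theta> where "\<theta> \<in> schwartz" "h = (\<lambda>x. \<theta> (- x))" by auto
  then show ?case
    using smooth_scale[of \<theta> "-1"] schwartz_smooth smooth_imp_differentiable by auto
next
  case (2 h i)
  then obtain \<theta> where "\<theta> \<in> schwartz" "h = (\<lambda>x. \<theta> (- x))" by auto
  then have "partial_deriv i h = (\<lambda>x. (\<lambda>x. (-1) * partial_deriv i \<theta> x) (- x))"
    "(\<lambda>x. (-1) * partial_deriv i \<theta> x) \<in> schwartz"
    using partial_deriv_scale[of \<theta> i "-1"] schwartz_smooth
      schwartz_cmult[of "partial_deriv i \<theta>" "-1"] schwartz_partial_deriv
    by auto
  then show ?case by blast
next
  case (3 h)
  then obtain \<theta> where *: "\<theta> \<in> schwartz" "h = (\<lambda>x. \<theta> (- x))" by auto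
  show ?case unfolding rapid_def
  proof
    fix m
    obtain C where C: "\<And>x. (1 + norm x) ^ m * norm (\<theta> x) \<le> C"
      using rapidE[OF schwartz_rapid[OF *(1)]] by metis
    then have "(1 + norm x) ^ m * norm (h x) \<le> C" for x
      using C[of "-x"] *(2) by simp
    then show "\<exists>C. \<forall>x. (1 + norm x) ^ m * norm (h x) \<le> C" by blast
  qed
qed (use assms in auto)

lemma schwartz_compact_support:
  assumes "smooth f" "\<And>x. norm x > R \<Longrightarrow> f x = 0"
  shows "f \<in> schwartz"
proof (rule schwartz_class[where A = "{h. smooth h \<and> (\<forall>x. norm x > R \<longrightarrow> h x = 0)}"], goal_cases)
  case (1 h x)
  then show ?case by (simp add: smooth_imp_differentiable)
next
  case (2 h i)
  have "open {x::real^3. norm x > R}"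
    by (intro open_Collect_less continuous_intros)
  with 2 show ?case
    by (auto intro!: smooth_partial_deriv partial_deriv_eq_0_outside[where S = "{x. norm x > R}"])
next
  case (3 h)
  show ?case unfolding rapid_def
  proof
    fix m
    have "smooth h" and h0: "\<And>x. norm x > R \<Longrightarrow> h x = 0" using 3 by auto
    have "continuous_on (cball 0 R) h"
      using smooth_imp_continuous[OF \<open>smooth h\<close>] continuous_on_subset by blast
    then have "continuous_on (cball 0 R) (\<lambda>x. (1 + norm x) ^ m * norm (h x))"
      by (intro continuous_on_mult continuous_on_power continuous_on_add continuous_on_norm
          continuous_on_const continuous_on_id)
    then have "bounded ((\<lambda>x. (1 + norm x) ^ m * norm (h x)) ` cball 0 R)"
      using compact_continuous_image compact_imp_bounded compact_cball by blast
    then obtain C where C: "\<forall>y\<in>(\<lambda>x. (1 + norm x) ^ m * norm (h x)) ` cball 0 R. norm y \<le> C"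
      unfolding bounded_iff by blast
    have "(1 + norm x) ^ m * norm (h x) \<le> max C 0" for x
    proof (cases "norm x > R")
      case False
      then have "x \<in> cball 0 R" by simp
      with C have "norm ((1 + norm x) ^ m * norm (h x)) \<le> C" by blast
      then show ?thesis by (simp add: abs_mult)
    qed (simp add: h0)
    then show "\<exists>C. \<forall>x. (1 + norm x) ^ m * norm (h x) \<le> C" by blast
  qed
qed (use assms in auto)

subsection \<open>Integration\<close>

text \<open>By \<open>lborel_eq\<close>, Lebesgue measure is the image of a product measure indexed
  by \<open>Basis\<close>. \<open>G\<close> relabels the factors from components to basis vectors,
  so that the product theorems for sigma-finite measures apply. Both the weight below and the
  Gaussian are handled this way.\<close>

lemma
  fixes g :: "3 \<Rightarrow> real \<Rightarrow> 'a::{real_normed_field,banach,second_countable_topology}"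
  assumes g: "\<And>i. integrable lborel (g i)"
  shows integrable_prod_coord: "integrable lborel (\<lambda>x::real^3. \<Prod>i\<in>UNIV. g i (x $ i))" (is ?I)
    and integral_prod_coord:
      "integral\<^sup>L lborel (\<lambda>x::real^3. \<Prod>i\<in>UNIV. g i (x $ i)) = (\<Prod>i\<in>UNIV. \<integral>t. g i t \<partial>lborel)" (is ?E)
proof -
  let ?ax = "\<lambda>i::3. axis i (1::real)"
  define G where "G b = g (inv ?ax b)" for b :: "real^3"
  have inj: "inj ?ax" by (auto simp: inj_def axis_eq_axis)
  have B: "(Basis :: (real^3) set) = range ?ax" by (auto simp: Basis_vec_def)
  have Gax: "G (?ax i) = g i" for i using inv_f_f[OF inj, of i] by (simp add: G_def)
  interpret product_sigma_finite "\<lambda>_::real^3. lborel :: real measure" ..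
  let ?f = "\<lambda>x::real^3. \<Prod>i\<in>UNIV. g i (x $ i)"
  let ?T = "\<lambda>f. \<Sum>b\<in>(Basis::(real^3) set). f b *\<^sub>R b"
  have GI: "integrable lborel (G b)" if "b \<in> Basis" for b
    using that g Gax by (auto simp: B)
  have [measurable]: "g i \<in> borel_measurable borel" for i
    using g borel_measurable_integrable by force
  have m: "?f \<in> borel_measurable borel" by measurable
  have T: "?T \<in> measurable (\<Pi>\<^sub>M b\<in>Basis. lborel) borel" by measurable
  have comp: "?f (?T f) = (\<Prod>b\<in>Basis. G b (f b))" for f
  proof -
    have "(?T f) $ i = f (?ax i)" for i
    proof -
      have "(?T f) \<bullet> ?ax i = f (?ax i)"
        by (rule inner_sum_left_Basis) (auto simp: B)
      then show ?thesis by (simp add: inner_axis)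
    qed
    then have "?f (?T f) = (\<Prod>i\<in>UNIV. G (?ax i) (f (?ax i)))" by (simp add: Gax)
    also have "\<dots> = (\<Prod>b\<in>Basis. G b (f b))"
      unfolding B by (rule prod.reindex_cong[symmetric]) (use inj in auto)
    finally show ?thesis .
  qed
  show ?I
    unfolding lborel_eq[where 'a="real^3"] integrable_distr_eq[OF T m] comp
    by (rule product_integrable_prod) (use GI in auto)
  have "integral\<^sup>L lborel ?f = (\<integral>f. (\<Prod>b\<in>Basis. G b (f b)) \<partial>(\<Pi>\<^sub>M b\<in>Basis. lborel))"
    unfolding lborel_eq[where 'a="real^3"] integral_distr[OF T m] comp ..
  also have "\<dots> = (\<Prod>b\<in>Basis. \<integral>t. G b t \<partial>lborel)"
    by (rule product_integral_prod) (use GI in auto)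
  also have "\<dots> = (\<Prod>i\<in>UNIV. \<integral>t. G (?ax i) t \<partial>lborel)"
    unfolding B by (rule prod.reindex_cong[OF inj]) auto
  finally show ?E by (simp add: Gax)
qed

text \<open>Each \<open>1 + (x $ i)\<^sup>2\<close> is at most the square of
  \<open>1 + norm x\<close>, and there are three coordinates; this is the origin of the exponent 6
  used as decay rate from here on.\<close>

lemma integrable_weight: "integrable lborel (\<lambda>x::real^3. inverse ((1 + norm x) ^ 6))"
proof (rule Bochner_Integration.integrable_bound)
  have "integrable lborel (\<lambda>t::real. inverse (1 + t\<^sup>2))"
    using integrable_inverse_1_plus_square by (simp add: set_integrable_def)
  then show "integrable lborel (\<lambda>x::real^3. \<Prod>i\<in>UNIV. inverse (1 + (x $ i)\<^sup>2))"
    by (intro integrable_prod_coord) auto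
  show "AE x::real^3 in lborel. norm (inverse ((1 + norm x) ^ 6)) \<le> norm (\<Prod>i\<in>UNIV. inverse (1 + (x $ i)\<^sup>2))"
  proof (rule AE_I2)
    fix x :: "real^3"
    have *: "1 + (x $ i)\<^sup>2 \<le> (1 + norm x)\<^sup>2" for i
    proof -
      have "(x $ i)\<^sup>2 \<le> (norm x)\<^sup>2"
        using component_le_norm_cart[of x i] by (simp add: abs_le_square_iff[symmetric])
      then show ?thesis using norm_ge_zero[of x] unfolding power2_sum one_power2 mult_1_right by linarith
    qed
    have pos: "0 < 1 + (x $ i)\<^sup>2" for i by (simp add: add_pos_nonneg)
    have "(\<Prod>i\<in>UNIV. 1 + (x $ i)\<^sup>2) \<le> (\<Prod>i\<in>(UNIV::3 set). (1 + norm x)\<^sup>2)"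
      by (intro prod_mono) (use * pos less_imp_le in blast)
    also have "\<dots> = (1 + norm x) ^ 6" by (simp flip: power_mult)
    finally have "inverse ((1 + norm x) ^ 6) \<le> inverse (\<Prod>i\<in>UNIV. 1 + (x $ i)\<^sup>2)"
      by (intro le_imp_inverse_le prod_pos) (use pos in auto)
    then show "norm (inverse ((1 + norm x) ^ 6)) \<le> norm (\<Prod>i\<in>UNIV. inverse (1 + (x $ i)\<^sup>2))"
      using pos by (simp add: prod_inversef[unfolded comp_def] prod_nonneg less_imp_le)
  qed
qed simp

lemma le_weight:
  assumes "(1 + norm x) ^ 6 * a \<le> C"
  shows "a \<le> C * inverse ((1 + norm x) ^ 6)"
proof -
  have "(1 + norm x) ^ 6 > 0" by (intro zero_less_power) (simp add: add_pos_nonneg)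
  then show ?thesis using assms by (simp add: field_simps)
qed

lemma rapid_integrable:
  assumes "rapid f" "f \<in> borel_measurable borel"
  shows "integrable lborel f"
proof -
  obtain C where C: "C > 0" "\<And>x. (1 + norm x) ^ 6 * norm (f x) \<le> C" using rapidE[OF assms(1)] by metis
  show ?thesis
  proof (rule Bochner_Integration.integrable_bound)
    show "integrable lborel (\<lambda>x::real^3. C * inverse ((1 + norm x) ^ 6))"
      using integrable_weight by simp
    have "norm (f x) \<le> norm (C * inverse ((1 + norm x) ^ 6))" for x
      using le_weight[OF C(2)] by (metis abs_ge_self order_trans real_norm_def)
    then show "AE x in lborel. norm (f x) \<le> norm (C * inverse ((1 + norm x) ^ 6))" by simp
  qed (use assms in simp)
qed

lemma schwartz_integrable: "\<theta> \<in> schwartz \<Longrightarrow> integrable lborel \<theta>"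
  by (simp add: rapid_integrable schwartz_rapid schwartz_measurable)

lemma schwartz_bounded:
  assumes "\<theta> \<in> schwartz"
  obtains C where "C > 0" "\<And>x. norm (\<theta> x) \<le> C"
  using rapidE[OF schwartz_rapid[OF assms], of 0] by auto

text \<open>Only finitely many lists have length at most \<open>m\<close>, so the separate bounds
  have a maximum. Without boundedness the real supremum in \<open>schwartz_norm\<close> would carry
  no information.\<close>

lemma schwartz_norm_bdd:
  assumes "\<theta> \<in> schwartz"
  shows "bdd_above ((\<lambda>(\<alpha>, x). (1 + norm x) ^ m * norm (iter_deriv \<alpha> \<theta> x)) ` ({\<alpha>. length \<alpha> \<le> m} \<times> UNIV))"
proof -
  define F where "F = (\<lambda>(\<alpha>, x). (1 + norm x) ^ m * norm (iter_deriv \<alpha> \<theta> x))"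
  have fin: "finite {\<alpha> :: 3 list. length \<alpha> \<le> m}"
    using finite_lists_length_le[of "UNIV :: 3 set" m] by simp
  have "\<exists>C. \<forall>x. F (\<alpha>, x) \<le> C" for \<alpha>
    using assms by (auto simp: F_def schwartz_iff rapid_def)
  then obtain C where C: "\<And>\<alpha> x. F (\<alpha>, x) \<le> C \<alpha>" by metis
  have "bdd_above (F ` ({\<alpha>. length \<alpha> \<le> m} \<times> UNIV))"
  proof (rule bdd_aboveI2)
    fix y assume "y \<in> {\<alpha> :: 3 list. length \<alpha> \<le> m} \<times> (UNIV :: (real^3) set)"
    then obtain \<alpha> x where y: "y = (\<alpha>, x)" "length \<alpha> \<le> m" by auto
    have "F y \<le> C \<alpha>" using C y by simp
    also have "\<dots> \<le> (MAX \<alpha>\<in>{\<alpha>. length \<alpha> \<le> m}. C \<alpha>)"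
      using fin y by (intro Max_ge) auto
    finally show "F y \<le> (MAX \<alpha>\<in>{\<alpha>. length \<alpha> \<le> m}. C \<alpha>)" .
  qed
  then show ?thesis by (simp add: F_def)
qed

lemma schwartz_norm_ge:
  assumes "\<theta> \<in> schwartz"
  shows "(1 + norm x) ^ m * norm (\<theta> x) \<le> schwartz_norm m \<theta>"
  using cSUP_upper[OF _ schwartz_norm_bdd[OF assms, of m], of "([], x)"]
  by (simp add: schwartz_norm_def)

lemma integral_translate:
  fixes f :: "real^3 \<Rightarrow> 'a::{banach,second_countable_topology}"
  assumes "f \<in> borel_measurable borel"
  shows "(\<integral>x. f (c + x) \<partial>lborel) = (\<integral>x. f x \<partial>lborel)"
proof -
  have "(\<integral>x. f x \<partial>distr lborel borel ((+) c)) = (\<integral>x. f (c + x) \<partial>lborel)"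
    by (rule integral_distr) (use assms in auto)
  then show ?thesis by (simp add: lborel_distr_plus)
qed

lemma integrable_translate:
  fixes f :: "real^3 \<Rightarrow> 'a::{banach,second_countable_topology}"
  assumes "integrable lborel f"
  shows "integrable lborel (\<lambda>x. f (c + x))"
proof -
  have "integrable (distr lborel borel ((+) c)) f" using assms by (simp add: lborel_distr_plus)
  then show ?thesis
    by (subst (asm) integrable_distr_eq) (use assms in auto)
qed

lemma vector_derivative_quotient:
  fixes f :: "'b::real_normed_vector \<Rightarrow> 'a::real_normed_vector"
  assumes "((\<lambda>s. f (s *\<^sub>R e + x)) has_vector_derivative v) (at 0)"
  shows "((\<lambda>s. (f (s *\<^sub>R e + x) - f x) /\<^sub>R s) \<longlongrightarrow> v) (at 0)"
proof -
  have "((\<lambda>s. norm (f (s *\<^sub>R e + x) - f x - s *\<^sub>R v) / norm s) \<longlongrightarrow> 0) (at 0)"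
    using assms by (simp add: has_vector_derivative_def has_derivative_iff_norm)
  then show ?thesis
    unfolding LIM_zero_iff[of _ v, symmetric] tendsto_norm_zero_iff[of "\<lambda>s. _ s - v", symmetric]
  proof (rule Lim_transform_eventually)
    have "norm (f (s *\<^sub>R e + x) - f x - s *\<^sub>R v) / norm s = norm ((f (s *\<^sub>R e + x) - f x) /\<^sub>R s - v)"
      if "s \<noteq> 0" for s
    proof -
      have "f (s *\<^sub>R e + x) - f x - s *\<^sub>R v = s *\<^sub>R ((f (s *\<^sub>R e + x) - f x) /\<^sub>R s - v)"
        using that by (simp add: scaleR_diff_right)
      then show ?thesis using that by simp
    qed
    then show "\<forall>\<^sub>F s in at 0. norm (f (s *\<^sub>R e + x) - f x - s *\<^sub>R v) / norm s =
        norm ((f (s *\<^sub>R e + x) - f x) /\<^sub>R s - v)"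
      by (auto simp: eventually_at_filter)
  qed
qed

text \<open>Translation invariance makes the integral of every difference quotient vanish, and
  dominated convergence carries this over to the derivative. Applied to a product, it gives the
  integration by parts behind \<open>fourier_partial_deriv\<close>.\<close>

lemma integral_partial_deriv:
  assumes h: "h \<in> schwartz"
  shows "(\<integral>x. partial_deriv i h x \<partial>lborel) = 0"
proof -
  define e :: "real^3" where "e = axis i 1"
  define t :: "nat \<Rightarrow> real" where "t n = 1 / real (Suc n)" for n
  have t: "0 < t n" "t n \<le> 1" for n by (auto simp: t_def)
  have tne: "t n \<noteq> 0" for n by (simp add: t_def)
  have t0: "t \<longlonglongrightarrow> 0" unfolding t_def by (rule LIMSEQ_Suc[OF lim_1_over_n])
  obtain C where C: "C > 0" "\<And>x. (1 + norm x) ^ 6 * norm (partial_deriv i h x) \<le> C"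
    using rapidE[OF schwartz_rapid[OF schwartz_partial_deriv[OF h]]] by metis
  have [measurable]: "h \<in> borel_measurable borel" "partial_deriv i h \<in> borel_measurable borel"
    using h schwartz_partial_deriv by (auto simp: schwartz_measurable)
  have line: "((\<lambda>s. h (s *\<^sub>R e + x)) has_derivative (\<lambda>u. u *\<^sub>R partial_deriv i h (s *\<^sub>R e + x))) (at s within S)"
    for s x and S :: "real set"
  proof -
    have "((\<lambda>s. s *\<^sub>R e + x) has_derivative (\<lambda>u. u *\<^sub>R e)) (at s within S)"
      by (auto intro!: derivative_eq_intros)
    moreover have "(h has_derivative frechet_derivative h (at (s *\<^sub>R e + x))) (at (s *\<^sub>R e + x))"
      by (simp add: smooth_has_derivative schwartz_smooth h)
    ultimately have "((\<lambda>s. h (s *\<^sub>R e + x)) has_derivative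
        (\<lambda>u. frechet_derivative h (at (s *\<^sub>R e + x)) (u *\<^sub>R e))) (at s within S)"
      by (rule has_derivative_compose)
    moreover have "linear (frechet_derivative h (at (s *\<^sub>R e + x)))"
      using smooth_has_derivative[OF schwartz_smooth[OF h]] has_derivative_linear by blast
    ultimately show ?thesis by (simp add: partial_deriv_def e_def linear_cmul)
  qed
  \<comment> \<open>Mean value inequality along a segment of length at most 1. Moving a point by at
    most 1 changes \<open>1 + norm x\<close> by a factor of at most 2, whence
    \<open>2 ^ 6\<close>.\<close>
  have bnd: "norm (h (t n *\<^sub>R e + x) - h x) \<le> (2 ^ 6 * C * inverse ((1 + norm x) ^ 6)) * t n" for n x
  proof -
    have "norm ((\<lambda>s. h (s *\<^sub>R e + x)) (t n) - (\<lambda>s. h (s *\<^sub>R e + x)) 0)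
        \<le> (2 ^ 6 * C * inverse ((1 + norm x) ^ 6)) * norm (t n - 0)"
    proof (rule differentiable_bound[where S = "{0..1}"])
      fix s :: real assume s: "s \<in> {0..1}"
      show "((\<lambda>s. h (s *\<^sub>R e + x)) has_derivative (\<lambda>u. u *\<^sub>R partial_deriv i h (s *\<^sub>R e + x))) (at s within {0..1})"
        by (rule line)
      have ne: "norm e = 1" by (simp add: e_def norm_axis_1)
      have n1: "norm (s *\<^sub>R e) \<le> 1" using s ne by simp
      have "1 + norm x \<le> 2 * (1 + norm (s *\<^sub>R e + x))"
        using norm_triangle_ineq4[of "s *\<^sub>R e + x" "s *\<^sub>R e"] n1
        by (smt (verit) add_diff_cancel_left' norm_ge_zero)
      then have "(1 + norm x) ^ 6 \<le> (2 * (1 + norm (s *\<^sub>R e + x))) ^ 6"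
        by (rule power_mono) simp
      then have "(1 + norm x) ^ 6 * norm (partial_deriv i h (s *\<^sub>R e + x))
          \<le> (2 ^ 6 * (1 + norm (s *\<^sub>R e + x)) ^ 6) * norm (partial_deriv i h (s *\<^sub>R e + x))"
        unfolding power_mult_distrib by (rule mult_right_mono) simp
      also have "\<dots> \<le> 2 ^ 6 * C" using C(2)[of "s *\<^sub>R e + x"] by simp
      finally have "norm (partial_deriv i h (s *\<^sub>R e + x)) \<le> 2 ^ 6 * C * inverse ((1 + norm x) ^ 6)"
        by (rule le_weight)
      then have B: "norm (u *\<^sub>R partial_deriv i h (s *\<^sub>R e + x)) \<le> 2 ^ 6 * C * inverse ((1 + norm x) ^ 6) * norm u" for u
        unfolding norm_scaleR real_norm_def mult.commute[of "\<bar>u\<bar>"] by (rule mult_right_mono) simp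
      show "onorm (\<lambda>u. u *\<^sub>R partial_deriv i h (s *\<^sub>R e + x)) \<le> 2 ^ 6 * C * inverse ((1 + norm x) ^ 6)"
        by (rule onorm_le) (rule B)
    qed (use t[of n] in auto)
    then show ?thesis using t[of n] by simp
  qed
  have "(\<lambda>n. \<integral>x. (h (t n *\<^sub>R e + x) - h x) /\<^sub>R t n \<partial>lborel) \<longlonglongrightarrow> (\<integral>x. partial_deriv i h x \<partial>lborel)"
  proof (rule integral_dominated_convergence[where w = "\<lambda>x. 2 ^ 6 * C * inverse ((1 + norm x) ^ 6)"])
    show "integrable lborel (\<lambda>x::real^3. 2 ^ 6 * C * inverse ((1 + norm x) ^ 6))"
      using integrable_weight by simp
    show "AE x in lborel. norm ((h (t n *\<^sub>R e + x) - h x) /\<^sub>R t n) \<le> 2 ^ 6 * C * inverse ((1 + norm x) ^ 6)" for n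
    proof (rule AE_I2)
      fix x
      have "norm ((h (t n *\<^sub>R e + x) - h x) /\<^sub>R t n) = norm (h (t n *\<^sub>R e + x) - h x) / t n"
        using t(1)[of n] by (simp add: divide_inverse)
      also have "\<dots> \<le> 2 ^ 6 * C * inverse ((1 + norm x) ^ 6)"
        using bnd[of n x] pos_divide_le_eq[OF t(1)] by blast
      finally show "norm ((h (t n *\<^sub>R e + x) - h x) /\<^sub>R t n) \<le> 2 ^ 6 * C * inverse ((1 + norm x) ^ 6)" .
    qed
    show "AE x in lborel. (\<lambda>n. (h (t n *\<^sub>R e + x) - h x) /\<^sub>R t n) \<longlonglongrightarrow> partial_deriv i h x"
    proof (rule AE_I2)
      fix x
      have "((\<lambda>s. h (s *\<^sub>R e + x)) has_vector_derivative partial_deriv i h x) (at 0)"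
        using line[of x 0 UNIV] by (simp add: has_vector_derivative_def)
      then have "((\<lambda>s. (h (s *\<^sub>R e + x) - h x) /\<^sub>R s) \<longlongrightarrow> partial_deriv i h x) (at 0)"
        by (rule vector_derivative_quotient)
      moreover have "filterlim t (at 0) sequentially"
        using t0 tne by (simp add: filterlim_at)
      ultimately show "(\<lambda>n. (h (t n *\<^sub>R e + x) - h x) /\<^sub>R t n) \<longlonglongrightarrow> partial_deriv i h x"
        by (rule filterlim_compose)
    qed
  qed measurable
  moreover have "(\<integral>x. (h (t n *\<^sub>R e + x) - h x) /\<^sub>R t n \<partial>lborel) = 0" for n
    using schwartz_integrable[OF h] integrable_translate[OF schwartz_integrable[OF h]]
      integral_translate[of h "t n *\<^sub>R e"]
    by simp
  ultimately have "(\<lambda>n. 0 :: complex) \<longlonglongrightarrow> (\<integral>x. partial_deriv i h x \<partial>lborel)" by (simp only:)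
  from LIMSEQ_unique[OF this tendsto_const] show ?thesis .
qed

section \<open>The Fourier transform\<close>

lemma cis_inner_measurable [measurable]:
  "(\<lambda>x::real^3. cis (x \<bullet> \<xi>)) \<in> borel_measurable borel"
  "(\<lambda>x::real^3. cis (- (x \<bullet> \<xi>))) \<in> borel_measurable borel"
  "(\<lambda>x::real^3. cis (\<xi> \<bullet> x)) \<in> borel_measurable borel"
  by (auto intro!: borel_measurable_continuous_onI continuous_intros simp: cis_conv_exp)

lemma cis_inner2_measurable [measurable]:
  "(\<lambda>(x, y). cis ((x::real^3) \<bullet> y)) \<in> borel_measurable (borel \<Otimes>\<^sub>M borel)"
  "(\<lambda>(x, y). cis (- ((x::real^3) \<bullet> y))) \<in> borel_measurable (borel \<Otimes>\<^sub>M borel)"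
  unfolding borel_prod split_beta
  by (auto intro!: borel_measurable_continuous_onI continuous_intros simp: cis_conv_exp)

lemma integrable_cis_mult:
  fixes f :: "real^3 \<Rightarrow> complex"
  assumes "integrable lborel f"
  shows "integrable lborel (\<lambda>x. cis (x \<bullet> \<xi>) * f x)" "integrable lborel (\<lambda>x. cis (- (x \<bullet> \<xi>)) * f x)"
proof -
  have [measurable]: "f \<in> borel_measurable borel" using assms by auto
  show "integrable lborel (\<lambda>x. cis (x \<bullet> \<xi>) * f x)"
    by (rule Bochner_Integration.integrable_bound[OF assms]) (auto simp: norm_mult)
  show "integrable lborel (\<lambda>x. cis (- (x \<bullet> \<xi>)) * f x)"
    by (rule Bochner_Integration.integrable_bound[OF assms]) (auto simp: norm_mult)
qed

lemma norm_fourier_le: "norm (fourier f \<xi>) \<le> (\<integral>x. norm (f x) \<partial>lborel)"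
  unfolding fourier_def by (rule order_trans[OF integral_norm_bound]) (simp add: norm_mult)

lemma cis_linear_approx: "norm (cis t - 1 - \<i> * of_real t) \<le> t\<^sup>2 / 2"
  using iexp_approx1[of t 1] by (simp add: cis_conv_exp power2_eq_square diff_diff_eq)

text \<open>The second-order remainder of \<open>cis\<close> is at most
  \<open>t\<^sup>2 / 2\<close>, and the square of the norm is integrable against a Schwartz
  function. This yields the full Frechet derivative with an explicit quadratic error, rather than
  only directional derivatives under the integral.\<close>

lemma fourier_has_derivative:
  assumes \<theta>: "\<theta> \<in> schwartz"
  shows "(fourier \<theta> has_derivative
    (\<lambda>h. \<Sum>k\<in>UNIV. (h $ k) *\<^sub>R fourier (\<lambda>x. - \<i> * (of_real (x $ k) * \<theta> x)) \<xi>)) (at \<xi>)"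
proof -
  let ?\<psi> = "\<lambda>k x. - \<i> * (of_real (x $ k) * \<theta> x)"
  let ?D = "\<lambda>h. \<Sum>k\<in>UNIV. (h $ k) *\<^sub>R fourier (?\<psi> k) \<xi>"
  have \<psi>: "?\<psi> k \<in> schwartz" for k by (intro schwartz_cmult schwartz_mult_coord \<theta>)
  have [measurable]: "\<theta> \<in> borel_measurable borel" using \<theta> by (rule schwartz_measurable)
  have bl: "bounded_linear ?D"
    by (rule bounded_linear_sum, rule bounded_linear_compose[OF bounded_linear_scaleR_left],
        rule bounded_linear_vec_nth)
  have sq: "integrable lborel (\<lambda>x. (norm x)\<^sup>2 / 2 * norm (\<theta> x))"
  proof -
    have "rapid (\<lambda>x. of_real ((norm x)\<^sup>2 / 2 * norm (\<theta> x)))"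
    proof (rule rapid_le[OF schwartz_rapid[OF \<theta>], of _ 1 2])
      fix x :: "real^3"
      have "(norm x)\<^sup>2 / 2 \<le> (1 + norm x)\<^sup>2"
        using norm_ge_zero[of x] unfolding power2_sum one_power2 mult_1_right
        by (smt (verit) divide_nonneg_nonneg field_sum_of_halves zero_le_power2)
      then show "cmod (complex_of_real ((norm x)\<^sup>2 / 2 * cmod (\<theta> x))) \<le> 1 * (1 + norm x)\<^sup>2 * cmod (\<theta> x)"
        using mult_right_mono[of "(norm x)\<^sup>2 / 2" "(1 + norm x)\<^sup>2" "norm (\<theta> x)"]
        unfolding norm_of_real by (subst abs_of_nonneg) simp_all
    qed simp
    then have "integrable lborel (\<lambda>x. complex_of_real ((norm x)\<^sup>2 / 2 * norm (\<theta> x)))"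
      by (rule rapid_integrable) measurable
    from integrable_Re[OF this] show ?thesis by simp
  qed
  define C where "C = (\<integral>x. (norm x)\<^sup>2 / 2 * norm (\<theta> x) \<partial>lborel)"
  have est: "norm (fourier \<theta> (\<xi> + h) - fourier \<theta> \<xi> - ?D h) \<le> C * (norm h)\<^sup>2" for h
  proof -
    let ?r = "\<lambda>x. cis (- (x \<bullet> \<xi>)) * (cis (- (x \<bullet> h)) - 1 - \<i> * of_real (- (x \<bullet> h))) * \<theta> x"
    have Dh: "?D h = (\<integral>x. cis (- (x \<bullet> \<xi>)) * (\<i> * of_real (- (x \<bullet> h))) * \<theta> x \<partial>lborel)"
    proof -
      have "?D h = (\<integral>x. (\<Sum>k\<in>UNIV. (h $ k) *\<^sub>R (cis (- (x \<bullet> \<xi>)) * ?\<psi> k x)) \<partial>lborel)"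
        unfolding fourier_def
        using integrable_cis_mult(2)[OF schwartz_integrable[OF \<psi>]]
        by (subst Bochner_Integration.integral_sum) auto
      also have "\<dots> = (\<integral>x. cis (- (x \<bullet> \<xi>)) * (\<i> * of_real (- (x \<bullet> h))) * \<theta> x \<partial>lborel)"
        by (intro Bochner_Integration.integral_cong)
          (auto simp: inner_vec_def sum_distrib_left sum_distrib_right scaleR_conv_of_real
            sum_negf algebra_simps intro!: sum.cong)
      finally show ?thesis .
    qed
    have I1: "integrable lborel (\<lambda>x. cis (- (x \<bullet> (\<xi> + h))) * \<theta> x)"
      and I2: "integrable lborel (\<lambda>x. cis (- (x \<bullet> \<xi>)) * \<theta> x)"
      using integrable_cis_mult(2)[OF schwartz_integrable[OF \<theta>]] by auto
    have I3: "integrable lborel (\<lambda>x. cis (- (x \<bullet> \<xi>)) * (\<i> * of_real (- (x \<bullet> h))) * \<theta> x)"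
    proof -
      have "integrable lborel (\<lambda>x. \<Sum>k\<in>UNIV. (h $ k) *\<^sub>R (cis (- (x \<bullet> \<xi>)) * ?\<psi> k x))"
        using integrable_cis_mult(2)[OF schwartz_integrable[OF \<psi>]] by auto
      moreover have "(\<lambda>x. \<Sum>k\<in>UNIV. (h $ k) *\<^sub>R (cis (- (x \<bullet> \<xi>)) * ?\<psi> k x)) =
          (\<lambda>x. cis (- (x \<bullet> \<xi>)) * (\<i> * of_real (- (x \<bullet> h))) * \<theta> x)"
        by (auto simp: fun_eq_iff inner_vec_def sum_distrib_left sum_distrib_right scaleR_conv_of_real
            sum_negf algebra_simps intro!: sum.cong)
      ultimately show ?thesis by simp
    qed
    have split: "cis (- (x \<bullet> (\<xi> + h))) = cis (- (x \<bullet> \<xi>)) * cis (- (x \<bullet> h))" for x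
      by (simp add: cis_mult inner_add_right)
    have "fourier \<theta> (\<xi> + h) - fourier \<theta> \<xi> - ?D h = (\<integral>x. ?r x \<partial>lborel)"
      unfolding Dh unfolding fourier_def
        Bochner_Integration.integral_diff[OF I1 I2, symmetric]
        Bochner_Integration.integral_diff[OF Bochner_Integration.integrable_diff[OF I1 I2] I3, symmetric]
      by (rule Bochner_Integration.integral_cong[OF refl]) (simp only: split, simp add: algebra_simps)
    also have "norm \<dots> \<le> (\<integral>x. (norm h)\<^sup>2 * ((norm x)\<^sup>2 / 2 * norm (\<theta> x)) \<partial>lborel)"
    proof (rule order_trans[OF integral_norm_bound integral_mono])
      show "integrable lborel (\<lambda>x. norm (?r x))"
      proof (rule integrable_norm, rule Bochner_Integration.integrable_cong[THEN iffD1, OF refl])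
        show "integrable lborel (\<lambda>x. cis (- (x \<bullet> (\<xi> + h))) * \<theta> x - cis (- (x \<bullet> \<xi>)) * \<theta> x
            - cis (- (x \<bullet> \<xi>)) * (\<i> * of_real (- (x \<bullet> h))) * \<theta> x)"
          by (intro Bochner_Integration.integrable_diff I1 I2 I3)
      qed (simp only: split, simp add: algebra_simps)
      show "integrable lborel (\<lambda>x. (norm h)\<^sup>2 * ((norm x)\<^sup>2 / 2 * norm (\<theta> x)))"
        by (rule integrable_mult_right) (rule sq)
      fix x
      have "(x \<bullet> h)\<^sup>2 \<le> (norm x * norm h)\<^sup>2"
        using Cauchy_Schwarz_ineq2[of x h] by (simp add: abs_le_square_iff[symmetric])
      then have "norm (cis (- (x \<bullet> h)) - 1 - \<i> * of_real (- (x \<bullet> h))) \<le> (norm x * norm h)\<^sup>2 / 2"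
        using cis_linear_approx[of "- (x \<bullet> h)"] by simp
      then have "norm (cis (- (x \<bullet> h)) - 1 - \<i> * of_real (- (x \<bullet> h))) * norm (\<theta> x)
          \<le> (norm x * norm h)\<^sup>2 / 2 * norm (\<theta> x)" by (rule mult_right_mono) simp
      then show "norm (?r x) \<le> (norm h)\<^sup>2 * ((norm x)\<^sup>2 / 2 * norm (\<theta> x))"
        by (simp add: norm_mult power_mult_distrib mult_ac)
    qed
    also have "\<dots> = C * (norm h)\<^sup>2" by (simp add: C_def)
    finally show ?thesis .
  qed
  show ?thesis
    unfolding has_derivative_at
  proof (intro conjI bl)
    show "(\<lambda>h. norm (fourier \<theta> (\<xi> + h) - fourier \<theta> \<xi> - ?D h) / norm h) \<midarrow>0\<rightarrow> 0"
    proof (rule Lim_null_comparison)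
      show "\<forall>\<^sub>F h in at 0. norm (norm (fourier \<theta> (\<xi> + h) - fourier \<theta> \<xi> - ?D h) / norm h) \<le> C * norm h"
      proof (rule always_eventually, rule allI)
        fix h
        have "0 \<le> C" unfolding C_def by (rule integral_nonneg_AE) simp
        then show "norm (norm (fourier \<theta> (\<xi> + h) - fourier \<theta> \<xi> - ?D h) / norm h) \<le> C * norm h"
          using est[of h] by (cases "h = 0") (simp_all add: divide_le_eq power2_eq_square mult.assoc)
      qed
      show "((\<lambda>h::real^3. C * norm h) \<longlongrightarrow> 0) (at 0)"
        by (rule tendsto_mult_right_zero[OF tendsto_norm_zero[OF tendsto_ident_at]])
    qed
  qed
qed

lemma partial_deriv_fourier:
  assumes "\<theta> \<in> schwartz"
  shows "partial_deriv i (fourier \<theta>) = fourier (\<lambda>x. - \<i> * (of_real (x $ i) * \<theta> x))"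
proof
  fix \<xi>
  have "(\<Sum>k\<in>UNIV. (axis i (1::real) $ k) *\<^sub>R fourier (\<lambda>x. - \<i> * (of_real (x $ k) * \<theta> x)) \<xi>)
      = (\<Sum>k\<in>UNIV. if k = i then fourier (\<lambda>x. - \<i> * (of_real (x $ k) * \<theta> x)) \<xi> else 0)"
    by (intro sum.cong) (auto simp: axis_def)
  then show "partial_deriv i (fourier \<theta>) \<xi> = fourier (\<lambda>x. - \<i> * (of_real (x $ i) * \<theta> x)) \<xi>"
    using partial_deriv_eq[OF fourier_has_derivative[OF assms]] by (simp del: mult_minus_left)
qed

lemma fourier_partial_deriv:
  assumes \<theta>: "\<theta> \<in> schwartz"
  shows "fourier (partial_deriv i \<theta>) \<xi> = \<i> * of_real (\<xi> $ i) * fourier \<theta> \<xi>"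
proof -
  have "(\<integral>x. partial_deriv i (\<lambda>x. cis (x \<bullet> (- \<xi>)) * \<theta> x) x \<partial>lborel) = 0"
    by (intro integral_partial_deriv schwartz_mult_cis \<theta>)
  moreover have "partial_deriv i (\<lambda>x. cis (x \<bullet> (- \<xi>)) * \<theta> x) =
    (\<lambda>x. cis (- (x \<bullet> \<xi>)) * partial_deriv i \<theta> x + - (\<i> * of_real (\<xi> $ i)) * (cis (- (x \<bullet> \<xi>)) * \<theta> x))"
    unfolding partial_deriv_mult[OF smooth_cis_inner schwartz_smooth[OF \<theta>]] partial_deriv_cis_inner
    by (simp add: fun_eq_iff)
  ultimately have "fourier (partial_deriv i \<theta>) \<xi> + - (\<i> * of_real (\<xi> $ i)) * fourier \<theta> \<xi> = 0"
    using integrable_cis_mult(2)[OF schwartz_integrable[OF \<theta>], of \<xi>]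
      integrable_cis_mult(2)[OF schwartz_integrable[OF schwartz_partial_deriv[OF \<theta>, of i]], of \<xi>]
    unfolding fourier_def by simp
  then show ?thesis by (simp add: add_eq_0_iff)
qed

text \<open>The norm is at most the sum of the absolute coordinates, so every further power of
  \<open>1 + norm x\<close> is paid for by members of the class that are, in absolute value,
  coordinate multiples of the given one.\<close>

lemma rapid_if_coord_stable:
  assumes "\<And>h. h \<in> A \<Longrightarrow> \<exists>C. \<forall>x. norm (h x) \<le> C"
    and "\<And>h i. h \<in> A \<Longrightarrow> \<exists>g\<in>A. \<forall>x. norm (g x) = \<bar>x $ i\<bar> * norm (h x)" and "f \<in> A"
  shows "rapid f"
proof -
  have "\<forall>h\<in>A. \<exists>C. \<forall>x. (1 + norm x) ^ m * norm (h x) \<le> C" for m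
  proof (induction m)
    case (Suc m)
    show ?case
    proof
      fix h assume h: "h \<in> A"
      then obtain g where g: "\<And>i. g i \<in> A" "\<And>i x. norm (g i x) = \<bar>x $ i\<bar> * norm (h x)"
        using assms(2)[OF h] by metis
      obtain C where C: "\<And>x. (1 + norm x) ^ m * norm (h x) \<le> C"
        using Suc h by blast
      have "\<forall>i. \<exists>D. \<forall>x. (1 + norm x) ^ m * norm (g i x) \<le> D"
        using Suc g(1) by blast
      then obtain D where D: "\<And>i x. (1 + norm x) ^ m * norm (g i x) \<le> D i"
        unfolding choice_iff by blast
      have "(1 + norm x) ^ Suc m * norm (h x) \<le> C + (\<Sum>i\<in>UNIV. D i)" for x
      proof -
        have "1 + norm x \<le> 1 + (\<Sum>i\<in>UNIV. \<bar>x $ i\<bar>)" using norm_le_l1_cart[of x] by simp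
        then have "(1 + norm x) * ((1 + norm x) ^ m * norm (h x))
            \<le> (1 + (\<Sum>i\<in>UNIV. \<bar>x $ i\<bar>)) * ((1 + norm x) ^ m * norm (h x))"
          by (rule mult_right_mono) simp
        also have "\<dots> = (1 + norm x) ^ m * norm (h x) + (\<Sum>i\<in>UNIV. (1 + norm x) ^ m * norm (g i x))"
          unfolding g(2) distrib_right sum_distrib_right mult_1
          by (intro arg_cong2[where f = "(+)"] refl sum.cong) (simp add: mult_ac)
        also have "\<dots> \<le> C + (\<Sum>i\<in>UNIV. D i)" by (intro add_mono C sum_mono D)
        finally show ?thesis by (simp add: mult.assoc)
      qed
      then show "\<exists>C. \<forall>x. (1 + norm x) ^ Suc m * norm (h x) \<le> C" by blast
    qed
  qed (use assms in simp)
  then show ?thesis using assms(3) by (auto simp: rapid_def)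
qed

text \<open>The set of all transforms is stable in both respects: its derivatives are transforms of
  coordinate multiples, and its coordinate multiples are, up to a factor of modulus 1, transforms of
  derivatives.\<close>

lemma fourier_schwartz:
  assumes "\<theta> \<in> schwartz"
  shows "fourier \<theta> \<in> schwartz"
proof (rule schwartz_class[where A = "fourier ` schwartz"], goal_cases)
  case (1 h x)
  then show ?case using fourier_has_derivative by (auto simp: differentiable_def)
next
  case (2 h i)
  then obtain \<theta> where "\<theta> \<in> schwartz" "h = fourier \<theta>" by auto
  then show ?case
    using partial_deriv_fourier[of \<theta> i] schwartz_cmult[OF schwartz_mult_coord, of \<theta> "- \<i>" i] by simp
next
  case (3 h)
  then show ?case
  proof (rule rapid_if_coord_stable[rotated 2], goal_cases)
    case (1 h)
    then show ?case using norm_fourier_le by blast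
  next
    case (2 h i)
    then obtain \<theta> where \<theta>: "\<theta> \<in> schwartz" "h = fourier \<theta>" by auto
    then show ?case
      using fourier_partial_deriv[OF \<theta>(1)] schwartz_partial_deriv[OF \<theta>(1)]
      by (intro bexI[of _ "fourier (partial_deriv i \<theta>)"]) (auto simp: norm_mult)
  qed
qed (use assms in auto)

lemma inv_fourier_eq: "inv_fourier \<theta> x = fourier \<theta> (- x) / of_real ((2 * pi) ^ 3)"
  by (simp add: inv_fourier_def fourier_def inner_commute)

lemma inv_fourier_schwartz:
  assumes "\<theta> \<in> schwartz"
  shows "inv_fourier \<theta> \<in> schwartz"
proof -
  have "(\<lambda>x. (1 / of_real ((2 * pi) ^ 3)) * fourier \<theta> (- x)) \<in> schwartz"
    by (intro schwartz_cmult schwartz_reflect[of "fourier \<theta>"] fourier_schwartz assms)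
  then show ?thesis by (simp add: inv_fourier_eq[abs_def])
qed

lemma inv_fourier_partial_deriv:
  assumes \<theta>: "\<theta> \<in> schwartz"
  shows "inv_fourier (partial_deriv i \<theta>) \<xi> = - \<i> * of_real (\<xi> $ i) * inv_fourier \<theta> \<xi>"
  by (simp add: inv_fourier_eq fourier_partial_deriv[OF \<theta>])

subsection \<open>Inversion\<close>

lemma
  fixes f :: "real^3 \<Rightarrow> 'a::{banach,second_countable_topology}"
  assumes "integrable lborel f" "c > 0"
  shows integrable_affine: "integrable lborel (\<lambda>x. f (t + c *\<^sub>R x))"
    and integral_affine: "(\<integral>x. f (t + c *\<^sub>R x) \<partial>lborel) = (\<integral>x. f x \<partial>lborel) /\<^sub>R c ^ 3"
proof -
  have [measurable]: "f \<in> borel_measurable borel" using assms by auto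
  let ?T = "\<lambda>x::real^3. t + c *\<^sub>R x"
  have L: "lborel = density (distr lborel borel ?T) (\<lambda>_. ennreal (c ^ 3))"
    using lborel_affine[of c t] assms(2) by (simp add: ennreal_power)
  have "integrable (density (distr lborel borel ?T) (\<lambda>_. ennreal (c ^ 3))) f"
    using assms(1) L by simp
  then have "integrable lborel (\<lambda>x. c ^ 3 *\<^sub>R f (?T x))"
    using assms(2) by (simp add: integrable_density integrable_distr_eq)
  from integrable_scaleR_right[OF this, of "inverse (c ^ 3)"]
  show I: "integrable lborel (\<lambda>x. f (?T x))"
    using assms(2) by simp
  have "(\<integral>x. f x \<partial>lborel) = (\<integral>x. f x \<partial>density (distr lborel borel ?T) (\<lambda>_. ennreal (c ^ 3)))"
    using L by simp
  also have "\<dots> = c ^ 3 *\<^sub>R (\<integral>x. f (?T x) \<partial>lborel)"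
    using assms(2) by (simp add: integral_density integral_distr)
  finally show "(\<integral>x. f (t + c *\<^sub>R x) \<partial>lborel) = (\<integral>x. f x \<partial>lborel) /\<^sub>R c ^ 3"
    using assms(2) by simp
qed

text \<open>Fubini's theorem for a bounded kernel. With \<open>cis (- (x \<bullet> y))\<close> it is
  the multiplication formula of the Fourier transform; the kernel is left general because
  \<open>mult_op_eq_integral\<close> needs the opposite sign.\<close>

lemma integral_swap:
  fixes a b :: "real^3 \<Rightarrow> complex"
  assumes a: "integrable lborel a" and b: "integrable lborel b"
    and K[measurable]: "(\<lambda>(x, y). K x y) \<in> borel_measurable (borel \<Otimes>\<^sub>M borel)"
    and K1: "\<And>x y. norm (K x y) \<le> 1"
  shows "(\<integral>x. (\<integral>y. K x y * b y \<partial>lborel) * a x \<partial>lborel) = (\<integral>y. (\<integral>x. K x y * a x \<partial>lborel) * b y \<partial>lborel)"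
proof -
  have [measurable]: "a \<in> borel_measurable borel" "b \<in> borel_measurable borel" using a b by auto
  have Ib: "integrable lborel (\<lambda>y. K x y * b y)" for x
    by (rule Bochner_Integration.integrable_bound[OF b])
      (auto simp: norm_mult intro!: mult_left_le_one_le K1)
  have int: "integrable (lborel \<Otimes>\<^sub>M lborel) (\<lambda>(x, y). K x y * b y * a x)"
  proof (rule lborel_pair.Fubini_integrable)
    show "integrable lborel (\<lambda>x. \<integral>y. norm (case (x, y) of (x, y) \<Rightarrow> K x y * b y * a x) \<partial>lborel)"
    proof (rule Bochner_Integration.integrable_bound)
      show "integrable lborel (\<lambda>x. (\<integral>y. norm (b y) \<partial>lborel) * norm (a x))" using a by simp
      have "(\<integral>y. norm (K x y * b y * a x) \<partial>lborel) \<le> (\<integral>y. norm (b y) * norm (a x) \<partial>lborel)" for x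
        using Ib[of x, THEN integrable_norm] b
        by (intro integral_mono) (auto simp: norm_mult intro!: mult_right_mono mult_left_le_one_le K1)
      then show "AE x in lborel. norm (\<integral>y. norm (case (x, y) of (x, y) \<Rightarrow> K x y * b y * a x) \<partial>lborel)
          \<le> norm ((\<integral>y. norm (b y) \<partial>lborel) * norm (a x))"
        by (simp add: abs_mult)
    qed measurable
    show "AE x in lborel. integrable lborel (\<lambda>y. case (x, y) of (x, y) \<Rightarrow> K x y * b y * a x)"
      using Ib by simp
  qed measurable
  have "(\<integral>x. (\<integral>y. K x y * b y \<partial>lborel) * a x \<partial>lborel) = (\<integral>x. (\<integral>y. K x y * b y * a x \<partial>lborel) \<partial>lborel)"
    using Ib by simp
  also have "\<dots> = (\<integral>y. (\<integral>x. K x y * b y * a x \<partial>lborel) \<partial>lborel)"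
    using lborel_pair.Fubini_integral[OF int] by simp
  also have "\<dots> = (\<integral>y. (\<integral>x. K x y * a x \<partial>lborel) * b y \<partial>lborel)"
  proof (rule Bochner_Integration.integral_cong[OF refl])
    fix y
    have "integrable lborel (\<lambda>x. K x y * a x)"
      by (rule Bochner_Integration.integrable_bound[OF a])
        (auto simp: norm_mult intro!: mult_left_le_one_le K1)
    then have "(\<integral>x. (K x y * a x) * b y \<partial>lborel) = (\<integral>x. K x y * a x \<partial>lborel) * b y" by simp
    then show "(\<integral>x. K x y * b y * a x \<partial>lborel) = (\<integral>x. K x y * a x \<partial>lborel) * b y"
      by (simp add: mult_ac)
  qed
  finally show ?thesis .
qed

definition gaussian :: "real^3 \<Rightarrow> complex" where
  "gaussian x = of_real (exp (- (x \<bullet> x) / 2))"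

lemma norm_gaussian_le_1: "norm (gaussian x) \<le> 1"
  by (simp add: gaussian_def)

lemma integrable_gaussian_1d: "integrable lborel (\<lambda>t::real. complex_of_real (exp (- t\<^sup>2 / 2)))"
proof -
  have "integrable lborel (\<lambda>t. sqrt (2 * pi) * std_normal_density t)"
    using integrable_std_normal_distribution_moment[of 0] integrable_normal_density[of 1 0] by simp
  then have "integrable lborel (\<lambda>t::real. exp (- t\<^sup>2 / 2))"
    by (simp add: std_normal_density_def)
  then show ?thesis by (rule integrable_of_real)
qed

text \<open>Up to normalisation this is the known characteristic function of the standard normal
  distribution.\<close>

lemma fourier_gaussian_1d:
  "(\<integral>t. cis (- (t * s)) * of_real (exp (- t\<^sup>2 / 2)) \<partial>lborel) = of_real (sqrt (2 * pi) * exp (- s\<^sup>2 / 2))"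
proof -
  have "of_real (exp (- s\<^sup>2 / 2)) = char std_normal_distribution (- s)"
    by (simp add: char_std_normal_distribution)
  also have "\<dots> = (\<integral>t. std_normal_density t *\<^sub>R iexp (- s * t) \<partial>lborel)"
    unfolding char_def by (subst integral_density) (auto simp: normal_density_nonneg)
  also have "\<dots> = (\<integral>t. (1 / sqrt (2 * pi)) *\<^sub>R (cis (- (t * s)) * of_real (exp (- t\<^sup>2 / 2))) \<partial>lborel)"
    by (intro Bochner_Integration.integral_cong)
      (auto simp: std_normal_density_def cis_conv_exp scaleR_conv_of_real mult_ac)
  finally show ?thesis
    by (simp add: scaleR_conv_of_real field_simps)
qed

lemma gaussian_prod: "gaussian x = (\<Prod>i\<in>UNIV. of_real (exp (- (x $ i)\<^sup>2 / 2)))"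
  unfolding gaussian_def of_real_prod[symmetric] exp_sum[OF finite, symmetric]
  by (simp add: inner_vec_def sum_negf sum_divide_distrib[symmetric] power2_eq_square)

lemma gaussian_measurable [measurable]: "gaussian \<in> borel_measurable borel"
  unfolding gaussian_def by measurable

lemma integrable_gaussian: "integrable lborel gaussian"
  unfolding gaussian_prod[abs_def]
  by (rule integrable_prod_coord[where g = "\<lambda>i t. of_real (exp (- t\<^sup>2 / 2))"]) (rule integrable_gaussian_1d)

lemma fourier_gaussian: "fourier gaussian \<xi> = of_real (sqrt (2 * pi) ^ 3) * gaussian \<xi>"
proof -
  let ?g = "\<lambda>i t. cis (- (t * \<xi> $ i)) * complex_of_real (exp (- t\<^sup>2 / 2))"
  have I: "integrable lborel (?g i)" for i
    by (rule Bochner_Integration.integrable_bound[OF integrable_gaussian_1d])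
      (auto simp: norm_mult cis_conv_exp)
  have "cis (- (x \<bullet> \<xi>)) * gaussian x = (\<Prod>i\<in>UNIV. ?g i (x $ i))" for x
    unfolding gaussian_prod prod.distrib cis_conv_exp exp_sum[OF finite, symmetric]
    by (simp add: inner_vec_def sum_negf sum_distrib_left)
  then have "fourier gaussian \<xi> = integral\<^sup>L lborel (\<lambda>x::real^3. \<Prod>i\<in>UNIV. ?g i (x $ i))"
    by (simp add: fourier_def)
  also have "\<dots> = (\<Prod>i\<in>UNIV. \<integral>t. ?g i t \<partial>lborel)" by (rule integral_prod_coord[OF I])
  also have "\<dots> = (\<Prod>i\<in>UNIV. of_real (sqrt (2 * pi)) * of_real (exp (- (\<xi> $ i)\<^sup>2 / 2)))"
    by (intro prod.cong refl) (simp only: fourier_gaussian_1d of_real_mult)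
  also have "\<dots> = of_real (sqrt (2 * pi) ^ 3) * gaussian \<xi>"
    unfolding gaussian_prod prod.distrib by simp
  finally show ?thesis .
qed

lemma integral_gaussian: "(\<integral>x. gaussian x \<partial>lborel) = of_real (sqrt (2 * pi) ^ 3)"
  using fourier_gaussian[of 0] by (simp add: fourier_def gaussian_def)

text \<open>The Fourier transform is moved from a rescaled copy of \<open>\<psi>\<close> to the Gaussian; letting the
  scale \<open>c\<close> tend to \<open>0\<close> on both sides yields the inversion formula.\<close>

lemma gaussian_inversion:
  assumes \<psi>: "\<psi> \<in> schwartz" and c: "c > 0"
  shows "of_real (sqrt (2 * pi) ^ 3) * (\<integral>z. \<psi> (x + c *\<^sub>R z) * gaussian z \<partial>lborel)
       = (\<integral>\<xi>. gaussian (c *\<^sub>R \<xi>) * (cis (x \<bullet> \<xi>) * fourier \<psi> \<xi>) \<partial>lborel)"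
proof -
  let ?\<psi> = "\<lambda>z. \<psi> (x + c *\<^sub>R z)"
  have I: "integrable lborel ?\<psi>" by (rule integrable_affine[OF schwartz_integrable[OF \<psi>] c])
  have F: "(\<integral>z. cis (- (z \<bullet> \<eta>)) * ?\<psi> z \<partial>lborel) = (cis (x \<bullet> (\<eta> /\<^sub>R c)) * fourier \<psi> (\<eta> /\<^sub>R c)) /\<^sub>R c ^ 3" for \<eta>
  proof -
    let ?f = "\<lambda>w. cis (x \<bullet> (\<eta> /\<^sub>R c)) * (cis (- (w \<bullet> (\<eta> /\<^sub>R c))) * \<psi> w)"
    have "cis (- (z \<bullet> \<eta>)) * ?\<psi> z = ?f (x + c *\<^sub>R z)" for z
    proof -
      have "- (z \<bullet> \<eta>) = x \<bullet> (\<eta> /\<^sub>R c) + (- ((x + c *\<^sub>R z) \<bullet> (\<eta> /\<^sub>R c)))"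
        using c by (simp add: inner_add_left field_simps)
      then have "cis (- (z \<bullet> \<eta>)) = cis (x \<bullet> (\<eta> /\<^sub>R c)) * cis (- ((x + c *\<^sub>R z) \<bullet> (\<eta> /\<^sub>R c)))"
        by (simp only: cis_mult)
      then show ?thesis by (simp only: mult.assoc)
    qed
    then have "(\<integral>z. cis (- (z \<bullet> \<eta>)) * ?\<psi> z \<partial>lborel) = (\<integral>z. ?f (x + c *\<^sub>R z) \<partial>lborel)"
      by (rule Bochner_Integration.integral_cong[OF refl])
    also have "\<dots> = (\<integral>w. ?f w \<partial>lborel) /\<^sub>R c ^ 3"
      by (intro integral_affine c integrable_mult_right integrable_cis_mult(2) schwartz_integrable \<psi>)
    also have "(\<integral>w. ?f w \<partial>lborel) = cis (x \<bullet> (\<eta> /\<^sub>R c)) * fourier \<psi> (\<eta> /\<^sub>R c)"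
      unfolding fourier_def by simp
    finally show ?thesis .
  qed
  have "of_real (sqrt (2 * pi) ^ 3) * (\<integral>z. ?\<psi> z * gaussian z \<partial>lborel)
      = (\<integral>z. (\<integral>\<eta>. cis (- (z \<bullet> \<eta>)) * gaussian \<eta> \<partial>lborel) * ?\<psi> z \<partial>lborel)"
  proof -
    have "(\<integral>\<eta>. cis (- (z \<bullet> \<eta>)) * gaussian \<eta> \<partial>lborel) = of_real (sqrt (2 * pi) ^ 3) * gaussian z" for z
      using fourier_gaussian[of z] by (simp add: fourier_def inner_commute)
    then have "(\<integral>z. (\<integral>\<eta>. cis (- (z \<bullet> \<eta>)) * gaussian \<eta> \<partial>lborel) * ?\<psi> z \<partial>lborel)
        = (\<integral>z. of_real (sqrt (2 * pi) ^ 3) * (?\<psi> z * gaussian z) \<partial>lborel)"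
      by (intro Bochner_Integration.integral_cong refl) (simp add: mult_ac)
    then show ?thesis by simp
  qed
  also have "\<dots> = (\<integral>\<eta>. (\<integral>z. cis (- (z \<bullet> \<eta>)) * ?\<psi> z \<partial>lborel) * gaussian \<eta> \<partial>lborel)"
    by (rule integral_swap[OF I integrable_gaussian]) (auto simp: split_beta' intro: cis_inner2_measurable)
  also have "\<dots> = (\<integral>\<eta>. (\<lambda>\<xi>. gaussian (c *\<^sub>R \<xi>) * (cis (x \<bullet> \<xi>) * fourier \<psi> \<xi>) /\<^sub>R c ^ 3) (0 + (1 / c) *\<^sub>R \<eta>) \<partial>lborel)"
    unfolding F using c by (simp add: divide_inverse mult_ac)
  also have "\<dots> = (\<integral>\<xi>. gaussian (c *\<^sub>R \<xi>) * (cis (x \<bullet> \<xi>) * fourier \<psi> \<xi>) /\<^sub>R c ^ 3 \<partial>lborel) /\<^sub>R (1 / c) ^ 3"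
  proof (rule integral_affine)
    show "integrable lborel (\<lambda>\<xi>. gaussian (c *\<^sub>R \<xi>) * (cis (x \<bullet> \<xi>) * fourier \<psi> \<xi>) /\<^sub>R c ^ 3)"
    proof (intro integrable_scaleR_right impI, rule Bochner_Integration.integrable_bound)
      have [measurable]: "fourier \<psi> \<in> borel_measurable borel"
        by (simp add: schwartz_measurable fourier_schwartz \<psi>)
      show "integrable lborel (fourier \<psi>)"
        by (simp add: schwartz_integrable fourier_schwartz \<psi>)
      show "(\<lambda>\<xi>. gaussian (c *\<^sub>R \<xi>) * (cis (x \<bullet> \<xi>) * fourier \<psi> \<xi>)) \<in> borel_measurable lborel" by measurable
      show "AE \<xi> in lborel. norm (gaussian (c *\<^sub>R \<xi>) * (cis (x \<bullet> \<xi>) * fourier \<psi> \<xi>)) \<le> norm (fourier \<psi> \<xi>)"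
        using norm_gaussian_le_1 by (intro AE_I2) (simp add: norm_mult mult_left_le_one_le)
    qed
  qed (use c in simp)
  finally show ?thesis using c by (simp add: power_one_over)
qed

theorem inv_fourier_fourier:
  assumes \<psi>: "\<psi> \<in> schwartz"
  shows "inv_fourier (fourier \<psi>) = \<psi>"
proof
  fix x
  define c where "c n = 1 / real (Suc n)" for n
  have c: "0 < c n" "c n \<le> 1" for n by (auto simp: c_def)
  have c0: "c \<longlonglongrightarrow> 0" unfolding c_def by (rule LIMSEQ_Suc[OF lim_1_over_n])
  have F: "fourier \<psi> \<in> schwartz" by (rule fourier_schwartz[OF \<psi>])
  have [measurable]: "\<psi> \<in> borel_measurable borel" "fourier \<psi> \<in> borel_measurable borel"
    using \<psi> F by (auto simp: schwartz_measurable)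
  obtain C where C: "C > 0" "\<And>y. norm (\<psi> y) \<le> C" using schwartz_bounded[OF \<psi>] by metis
  have "(\<lambda>n. \<integral>z. \<psi> (x + c n *\<^sub>R z) * gaussian z \<partial>lborel) \<longlonglongrightarrow> (\<integral>z. \<psi> x * gaussian z \<partial>lborel)"
  proof (rule integral_dominated_convergence[where w = "\<lambda>z. C * norm (gaussian z)"])
    show "integrable lborel (\<lambda>z. C * norm (gaussian z))" using integrable_gaussian by simp
    show "AE z in lborel. (\<lambda>n. \<psi> (x + c n *\<^sub>R z) * gaussian z) \<longlonglongrightarrow> \<psi> x * gaussian z"
    proof (intro AE_I2 tendsto_mult_right)
      fix z
      have "isCont \<psi> x"
        using smooth_imp_continuous[OF schwartz_smooth[OF \<psi>]] continuous_on_eq_continuous_at by auto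
      moreover have "(\<lambda>n. x + c n *\<^sub>R z) \<longlonglongrightarrow> x + 0 *\<^sub>R z" by (intro tendsto_intros c0)
      ultimately show "(\<lambda>n. \<psi> (x + c n *\<^sub>R z)) \<longlonglongrightarrow> \<psi> x"
        using isCont_tendsto_compose[of x \<psi>] by simp
    qed
    show "AE z in lborel. norm (\<psi> (x + c n *\<^sub>R z) * gaussian z) \<le> C * norm (gaussian z)" for n
      using C by (intro AE_I2) (simp add: norm_mult mult_right_mono)
  qed measurable
  then have L: "(\<lambda>n. of_real (sqrt (2 * pi) ^ 3) * (\<integral>z. \<psi> (x + c n *\<^sub>R z) * gaussian z \<partial>lborel))
      \<longlonglongrightarrow> of_real (sqrt (2 * pi) ^ 3) * (\<psi> x * of_real (sqrt (2 * pi) ^ 3))"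
    by (intro tendsto_mult_left) (simp add: integral_gaussian)
  have "(\<lambda>n. \<integral>\<xi>. gaussian (c n *\<^sub>R \<xi>) * (cis (x \<bullet> \<xi>) * fourier \<psi> \<xi>) \<partial>lborel)
      \<longlonglongrightarrow> (\<integral>\<xi>. cis (x \<bullet> \<xi>) * fourier \<psi> \<xi> \<partial>lborel)"
  proof (rule integral_dominated_convergence[where w = "\<lambda>\<xi>. norm (fourier \<psi> \<xi>)"])
    show "integrable lborel (\<lambda>\<xi>. norm (fourier \<psi> \<xi>))" using schwartz_integrable[OF F] by simp
    show "AE \<xi> in lborel. (\<lambda>n. gaussian (c n *\<^sub>R \<xi>) * (cis (x \<bullet> \<xi>) * fourier \<psi> \<xi>)) \<longlonglongrightarrow> cis (x \<bullet> \<xi>) * fourier \<psi> \<xi>"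
    proof (intro AE_I2)
      fix \<xi> :: "real^3"
      have "(\<lambda>n. exp (- ((c n *\<^sub>R \<xi>) \<bullet> (c n *\<^sub>R \<xi>)) / 2)) \<longlonglongrightarrow> exp (- ((0 *\<^sub>R \<xi>) \<bullet> (0 *\<^sub>R \<xi>)) / 2)"
        by (intro tendsto_intros c0) simp
      then have "(\<lambda>n. gaussian (c n *\<^sub>R \<xi>)) \<longlonglongrightarrow> of_real 1"
        unfolding gaussian_def by (intro tendsto_of_real) simp
      from tendsto_mult_right[OF this, of "cis (x \<bullet> \<xi>) * fourier \<psi> \<xi>"]
      show "(\<lambda>n. gaussian (c n *\<^sub>R \<xi>) * (cis (x \<bullet> \<xi>) * fourier \<psi> \<xi>)) \<longlonglongrightarrow> cis (x \<bullet> \<xi>) * fourier \<psi> \<xi>"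
        by simp
    qed
    show "AE \<xi> in lborel. norm (gaussian (c n *\<^sub>R \<xi>) * (cis (x \<bullet> \<xi>) * fourier \<psi> \<xi>)) \<le> norm (fourier \<psi> \<xi>)" for n
      using norm_gaussian_le_1 by (intro AE_I2) (simp add: norm_mult mult_left_le_one_le)
  qed measurable
  with L have "of_real (sqrt (2 * pi) ^ 3) * (\<psi> x * of_real (sqrt (2 * pi) ^ 3)) = (\<integral>\<xi>. cis (x \<bullet> \<xi>) * fourier \<psi> \<xi> \<partial>lborel)"
    unfolding gaussian_inversion[OF \<psi> c(1)] by (rule LIMSEQ_unique)
  \<comment> \<open>One factor comes from the transform of the Gaussian, the other from its total
    mass; together they make up the normalisation of \<open>inv_fourier\<close>.\<close>
  moreover have "complex_of_real (sqrt (2 * pi) ^ 3) * (\<psi> x * of_real (sqrt (2 * pi) ^ 3)) = of_real ((2 * pi) ^ 3) * \<psi> x"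
  proof -
    have "sqrt (2 * pi) ^ 3 * sqrt (2 * pi) ^ 3 = (2 * pi) ^ 3"
      by (simp flip: power_mult_distrib)
    then have "complex_of_real (sqrt (2 * pi) ^ 3) * of_real (sqrt (2 * pi) ^ 3) = of_real ((2 * pi) ^ 3)"
      by (simp only: of_real_mult[symmetric])
    then show ?thesis by (metis mult.assoc mult.commute)
  qed
  ultimately show "inv_fourier (fourier \<psi>) x = \<psi> x"
    by (simp add: inv_fourier_def field_simps)
qed

section \<open>Fourier multipliers with compactly supported symbol\<close>

definition bump :: "(real^3 \<Rightarrow> real) \<Rightarrow> bool" where
  "bump m \<longleftrightarrow> smooth m \<and> (\<exists>R. \<forall>x. norm x > R \<longrightarrow> m x = 0)"

text \<open>The transpose of the Fourier multiplier with symbol \<open>m\<close>: a multiplier acts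
  on a distribution by composition with this map, which is why the inverse transform comes first.
  See \<open>dyadic_cutoff_eq\<close>.\<close>

definition mult_op :: "(real^3 \<Rightarrow> real) \<Rightarrow> (real^3 \<Rightarrow> complex) \<Rightarrow> real^3 \<Rightarrow> complex" where
  "mult_op m \<theta> = fourier (\<lambda>\<xi>. of_real (m \<xi>) * inv_fourier \<theta> \<xi>)"

definition kern :: "(real^3 \<Rightarrow> real) \<Rightarrow> real^3 \<Rightarrow> complex" where
  "kern m = inv_fourier (\<lambda>\<xi>. of_real (m \<xi>))"

definition dilate :: "int \<Rightarrow> (real^3 \<Rightarrow> real) \<Rightarrow> real^3 \<Rightarrow> real" where
  "dilate j m = (\<lambda>\<xi>. m (2 powi (- j) *\<^sub>R \<xi>))"

lemma dyadic_cutoff_eq: "dyadic_cutoff m j T = (\<lambda>\<theta>. T (mult_op (dilate j m) \<theta>))"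
  by (simp add: dyadic_cutoff_def dist_inv_fourier_def dist_mult_def dist_fourier_def mult_op_def
      dilate_def)

lemma bump_smooth: "bump m \<Longrightarrow> smooth m"
  by (simp add: bump_def)

lemma bump_mult:
  assumes "bump m" "smooth f"
  shows "bump (\<lambda>x. f x * m x)" "bump (\<lambda>x. m x * f x)"
  using assms by (auto simp: bump_def)

lemma bump_add:
  assumes "bump m" "bump n"
  shows "bump (\<lambda>x. m x + n x)"
proof -
  obtain R S where "\<And>x. norm x > R \<Longrightarrow> m x = 0" "\<And>x. norm x > S \<Longrightarrow> n x = 0"
    using assms by (auto simp: bump_def)
  then have "\<forall>x. norm x > max R S \<longrightarrow> m x + n x = 0" by simp
  then show ?thesis using assms unfolding bump_def by blast
qed

lemma bump_zero: "bump (\<lambda>x. 0)"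
  by (auto simp: bump_def)

lemma bump_sum: "(\<And>i. i \<in> I \<Longrightarrow> bump (m i)) \<Longrightarrow> bump (\<lambda>x. \<Sum>i\<in>I. m i x)"
  by (induction I rule: infinite_finite_induct) (auto intro: bump_zero bump_add)

lemma bump_scale:
  assumes "bump m" "c \<noteq> 0"
  shows "bump (\<lambda>x. m (c *\<^sub>R x))"
proof -
  obtain R where R: "\<And>x. norm x > R \<Longrightarrow> m x = 0" using assms by (auto simp: bump_def)
  have "m (c *\<^sub>R x) = 0" if "norm x > R / \<bar>c\<bar>" for x
    using that assms(2) by (intro R) (simp add: field_simps)
  then show ?thesis using assms unfolding bump_def by blast
qed

lemma bump_dilate: "bump m \<Longrightarrow> bump (dilate j m)"
  unfolding dilate_def by (rule bump_scale) auto

lemma bump_reflect: "bump m \<Longrightarrow> bump (\<lambda>x. m (- x))"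
  using bump_scale[of m "-1"] by simp

lemma bump_schwartz:
  assumes "bump m" "smooth f"
  shows "(\<lambda>\<xi>. of_real (m \<xi>) * f \<xi>) \<in> schwartz"
proof -
  obtain R where R: "\<And>x. norm x > R \<Longrightarrow> m x = 0" using assms by (auto simp: bump_def)
  show ?thesis
    by (rule schwartz_compact_support[where R = R])
      (use assms R in \<open>auto intro!: smooth_mult smooth_of_real bump_smooth\<close>)
qed

lemma bump_of_real_schwartz: "bump m \<Longrightarrow> (\<lambda>\<xi>. of_real (m \<xi>)) \<in> schwartz"
  using bump_schwartz[of m "\<lambda>x. 1"] by simp

lemma mult_op_symbol_schwartz:
  "bump m \<Longrightarrow> \<theta> \<in> schwartz \<Longrightarrow> (\<lambda>\<xi>. of_real (m \<xi>) * inv_fourier \<theta> \<xi>) \<in> schwartz"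
  by (intro bump_schwartz schwartz_smooth inv_fourier_schwartz)

lemma mult_op_schwartz: "bump m \<Longrightarrow> \<theta> \<in> schwartz \<Longrightarrow> mult_op m \<theta> \<in> schwartz"
  unfolding mult_op_def by (intro fourier_schwartz mult_op_symbol_schwartz)

text \<open>Fourier inversion is spent here: it cancels the two inner transforms, so that
  composition becomes multiplication of symbols and all interactions of scales reduce to
  supports.\<close>

lemma mult_op_comp:
  assumes "bump n" "\<theta> \<in> schwartz"
  shows "mult_op m (mult_op n \<theta>) = mult_op (\<lambda>\<xi>. m \<xi> * n \<xi>) \<theta>"
  unfolding mult_op_def inv_fourier_fourier[OF mult_op_symbol_schwartz[OF assms]]
  by (simp add: mult.assoc)

lemma fourier_add:
  assumes "\<theta> \<in> schwartz" "\<eta> \<in> schwartz"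
  shows "fourier (\<lambda>x. \<theta> x + \<eta> x) \<xi> = fourier \<theta> \<xi> + fourier \<eta> \<xi>"
  using integrable_cis_mult(2)[OF schwartz_integrable[OF assms(1)], of \<xi>]
    integrable_cis_mult(2)[OF schwartz_integrable[OF assms(2)], of \<xi>]
  unfolding fourier_def by (simp add: distrib_left)

lemma fourier_zero: "fourier (\<lambda>x. 0) \<xi> = 0"
  by (simp add: fourier_def)

lemma fourier_cmult: "fourier (\<lambda>x. c * f x) \<xi> = c * fourier f \<xi>"
proof -
  have "fourier (\<lambda>x. c * f x) \<xi> = (\<integral>x. c * (cis (- (x \<bullet> \<xi>)) * f x) \<partial>lborel)"
    unfolding fourier_def by (intro Bochner_Integration.integral_cong) auto
  then show ?thesis by (simp add: fourier_def)
qed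

lemma mult_op_zero: "mult_op (\<lambda>x. 0) \<theta> = (\<lambda>x. 0)"
  by (auto simp: mult_op_def fourier_zero)

lemma mult_op_add:
  assumes "bump m" "bump n" "\<theta> \<in> schwartz"
  shows "mult_op (\<lambda>\<xi>. m \<xi> + n \<xi>) \<theta> = (\<lambda>x. mult_op m \<theta> x + mult_op n \<theta> x)"
proof
  fix x
  have "fourier (\<lambda>\<xi>. of_real (m \<xi>) * inv_fourier \<theta> \<xi> + of_real (n \<xi>) * inv_fourier \<theta> \<xi>) x
    = mult_op m \<theta> x + mult_op n \<theta> x"
    unfolding mult_op_def using assms by (intro fourier_add mult_op_symbol_schwartz)
  then show "mult_op (\<lambda>\<xi>. m \<xi> + n \<xi>) \<theta> x = mult_op m \<theta> x + mult_op n \<theta> x"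
    by (simp add: mult_op_def[of "\<lambda>\<xi>. _ \<xi> + _ \<xi>"] distrib_right)
qed

lemma mult_op_sum:
  assumes "\<And>i. i \<in> I \<Longrightarrow> bump (m i)" "\<theta> \<in> schwartz"
  shows "mult_op (\<lambda>\<xi>. \<Sum>i\<in>I. m i \<xi>) \<theta> = (\<lambda>x. \<Sum>i\<in>I. mult_op (m i) \<theta> x)"
  using assms(1)
  by (induction I rule: infinite_finite_induct)
    (auto simp: mult_op_zero mult_op_add bump_sum assms(2))

lemma mult_op_partial_deriv:
  assumes "\<theta> \<in> schwartz"
  shows "mult_op m (partial_deriv i \<theta>) x = - \<i> * mult_op (\<lambda>\<xi>. m \<xi> * \<xi> $ i) \<theta> x"
  unfolding mult_op_def fourier_cmult[symmetric] inv_fourier_partial_deriv[OF assms]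
  by (simp add: mult_ac)

lemma partial_deriv_mult_op:
  assumes "bump m" "\<theta> \<in> schwartz"
  shows "partial_deriv i (mult_op m \<theta>) x = - \<i> * mult_op (\<lambda>\<xi>. m \<xi> * \<xi> $ i) \<theta> x"
  unfolding mult_op_def partial_deriv_fourier[OF mult_op_symbol_schwartz[OF assms]]
    fourier_cmult[symmetric]
  by (simp add: mult_ac)

subsection \<open>Convolution kernels\<close>

lemma kern_schwartz: "bump m \<Longrightarrow> kern m \<in> schwartz"
  unfolding kern_def by (intro inv_fourier_schwartz bump_of_real_schwartz)

text \<open>The integration variable stands first in \<open>x - y\<close> because
  \<open>mult_op\<close> is a transpose; moving it to the other factor produces the convolution
  \<open>conv\<close>.\<close>

lemma mult_op_eq_integral:
  assumes m: "bump m" and \<theta>: "\<theta> \<in> schwartz"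
  shows "mult_op m \<theta> y = (\<integral>x. kern m (x - y) * \<theta> x \<partial>lborel)"
proof -
  let ?c = "complex_of_real ((2 * pi) ^ 3)"
  let ?a = "\<lambda>\<xi>. cis (- (\<xi> \<bullet> y)) * of_real (m \<xi>) / ?c"
  have a: "integrable lborel ?a"
    using integrable_cis_mult(2)[OF schwartz_integrable[OF bump_of_real_schwartz[OF m]]]
    by (rule integrable_divide_zero)
  have "mult_op m \<theta> y = (\<integral>\<xi>. (\<integral>x. cis (\<xi> \<bullet> x) * \<theta> x \<partial>lborel) * ?a \<xi> \<partial>lborel)"
    unfolding mult_op_def fourier_def inv_fourier_def
    by (intro Bochner_Integration.integral_cong) (auto simp: mult_ac)
  also have "\<dots> = (\<integral>x. (\<integral>\<xi>. cis (\<xi> \<bullet> x) * ?a \<xi> \<partial>lborel) * \<theta> x \<partial>lborel)"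
    by (rule integral_swap[OF a schwartz_integrable[OF \<theta>]])
      (auto simp: split_beta' intro: cis_inner2_measurable)
  also have "\<dots> = (\<integral>x. kern m (x - y) * \<theta> x \<partial>lborel)"
  proof (rule Bochner_Integration.integral_cong[OF refl])
    fix x
    have "cis (\<xi> \<bullet> x) * ?a \<xi> = cis ((x - y) \<bullet> \<xi>) * of_real (m \<xi>) / ?c" for \<xi>
    proof -
      have "(x - y) \<bullet> \<xi> = \<xi> \<bullet> x + - (\<xi> \<bullet> y)" by (simp add: inner_diff_left inner_commute[of \<xi>])
      then have "cis ((x - y) \<bullet> \<xi>) = cis (\<xi> \<bullet> x) * cis (- (\<xi> \<bullet> y))" by (simp only: cis_mult)
      then show ?thesis by simp
    qed
    then have "(\<integral>\<xi>. cis (\<xi> \<bullet> x) * ?a \<xi> \<partial>lborel) = (\<integral>\<xi>. cis ((x - y) \<bullet> \<xi>) * of_real (m \<xi>) / ?c \<partial>lborel)"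
      by (rule Bochner_Integration.integral_cong[OF refl])
    also have "\<dots> = kern m (x - y)" unfolding kern_def inv_fourier_def by simp
    finally show "(\<integral>\<xi>. cis (\<xi> \<bullet> x) * ?a \<xi> \<partial>lborel) * \<theta> x = kern m (x - y) * \<theta> x" by simp
  qed
  finally show ?thesis .
qed

lemma lborel_reflect: "distr lborel borel (\<lambda>x. t - x) = (lborel :: (real^3) measure)"
proof -
  have "lborel = density (distr lborel borel (\<lambda>x::real^3. t + (- 1) *\<^sub>R x)) (\<lambda>_. ennreal (\<bar>- 1\<bar> ^ DIM(real^3)))"
    using lborel_affine[of "- 1" t] by simp
  also have "\<dots> = distr lborel borel (\<lambda>x. t - x)" by (simp add: density_1)
  finally show ?thesis by simp
qed

lemma
  fixes f :: "real^3 \<Rightarrow> 'a::{banach,second_countable_topology}"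
  assumes "f \<in> borel_measurable borel"
  shows integral_reflect: "(\<integral>x. f (t - x) \<partial>lborel) = (\<integral>x. f x \<partial>lborel)"
    and integrable_reflect: "integrable lborel (\<lambda>x. f (t - x)) \<longleftrightarrow> integrable lborel f"
proof -
  have "(\<integral>x. f x \<partial>distr lborel borel (\<lambda>x. t - x)) = (\<integral>x. f (t - x) \<partial>lborel)"
    by (rule integral_distr) (use assms in auto)
  then show "(\<integral>x. f (t - x) \<partial>lborel) = (\<integral>x. f x \<partial>lborel)" by (simp add: lborel_reflect)
  have "integrable (distr lborel borel (\<lambda>x. t - x)) f \<longleftrightarrow> integrable lborel (\<lambda>x. f (t - x))"
    by (rule integrable_distr_eq) (use assms in auto)
  then show "integrable lborel (\<lambda>x. f (t - x)) \<longleftrightarrow> integrable lborel f" by (simp add: lborel_reflect)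
qed

lemma cnj_kern:
  assumes m: "bump m"
  shows "cnj (kern m x) = kern (\<lambda>\<xi>. m (- \<xi>)) x"
proof -
  have [measurable]: "m \<in> borel_measurable borel" by (rule smooth_imp_measurable[OF bump_smooth[OF m]])
  have "cnj (\<integral>\<xi>. cis (x \<bullet> \<xi>) * of_real (m \<xi>) \<partial>lborel) = (\<integral>\<xi>. cnj (cis (x \<bullet> \<xi>) * of_real (m \<xi>)) \<partial>lborel)"
    by (rule Bochner_Integration.integral_cnj[symmetric])
  also have "\<dots> = (\<integral>\<xi>. (\<lambda>\<eta>. cis (x \<bullet> \<eta>) * of_real (m (- \<eta>))) (0 - \<xi>) \<partial>lborel)"
    by (simp add: cis_cnj)
  also have "\<dots> = (\<integral>\<xi>. cis (x \<bullet> \<xi>) * of_real (m (- \<xi>)) \<partial>lborel)"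
    by (rule integral_reflect) measurable
  finally show ?thesis by (simp add: kern_def inv_fourier_def)
qed

lemma cnj_mult_op:
  assumes m: "bump m" and \<theta>: "\<theta> \<in> schwartz"
  shows "cnj (mult_op m \<theta> y) = mult_op (\<lambda>\<xi>. m (- \<xi>)) (\<lambda>x. cnj (\<theta> x)) y"
  unfolding mult_op_eq_integral[OF assms]
    mult_op_eq_integral[OF bump_reflect[OF m] schwartz_cnj[OF \<theta>]]
  by (simp add: cnj_kern[OF m] flip: Bochner_Integration.integral_cnj)

lemma kern_dilate:
  assumes m: "bump m"
  shows "kern (dilate j m) x = of_real (2 powi j) ^ 3 * kern m (2 powi j *\<^sub>R x)"
proof -
  let ?c = "2 powi (- j) :: real"
  let ?h = "\<lambda>\<eta>. cis ((2 powi j *\<^sub>R x) \<bullet> \<eta>) * complex_of_real (m \<eta>)"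
  have c: "?c > 0" "2 powi j * ?c = 1" by (auto simp: power_int_minus)
  have I: "integrable lborel ?h"
    using integrable_cis_mult(1)[OF schwartz_integrable[OF bump_of_real_schwartz[OF m]], of "2 powi j *\<^sub>R x"]
    by (simp only: inner_commute[of "2 powi j *\<^sub>R x"])
  have "cis (x \<bullet> \<xi>) * of_real (dilate j m \<xi>) = ?h (0 + ?c *\<^sub>R \<xi>)" for \<xi>
  proof -
    have "(2 powi j *\<^sub>R x) \<bullet> (0 + ?c *\<^sub>R \<xi>) = (2 powi j * ?c) * (x \<bullet> \<xi>)"
      by simp
    then show ?thesis unfolding c(2) by (simp only: dilate_def mult_1 add_0)
  qed
  then have "(\<integral>\<xi>. cis (x \<bullet> \<xi>) * of_real (dilate j m \<xi>) \<partial>lborel) = (\<integral>\<xi>. ?h (0 + ?c *\<^sub>R \<xi>) \<partial>lborel)"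
    by (rule Bochner_Integration.integral_cong[OF refl])
  also have "\<dots> = (\<integral>\<eta>. ?h \<eta> \<partial>lborel) /\<^sub>R ?c ^ 3" by (rule integral_affine[OF I c(1)])
  finally show ?thesis
    unfolding kern_def inv_fourier_def
    by (simp add: scaleR_conv_of_real power_int_minus power_inverse)
qed

text \<open>\<open>A\<close> controls convolution from \<open>L_p\<close> to itself, and
  \<open>A\<close> and \<open>B\<close> together control it from \<open>L_p\<close> to the bounded
  functions. All other exponents are reached by interpolation.\<close>

definition kernel_bound :: "(real^3 \<Rightarrow> complex) \<Rightarrow> real \<Rightarrow> real \<Rightarrow> bool" where
  "kernel_bound k A B \<longleftrightarrow> integrable lborel k \<and> 0 < A \<and> 0 < B \<and> (\<integral>x. norm (k x) \<partial>lborel) \<le> A \<and>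
     (\<forall>x. norm (k x) \<le> B)"

lemma kernel_bound_mono: "kernel_bound k A B \<Longrightarrow> A \<le> A' \<Longrightarrow> B \<le> B' \<Longrightarrow> kernel_bound k A' B'"
  unfolding kernel_bound_def by (meson order_trans less_le_trans)

text \<open>Dilating the symbol preserves the \<open>L_1\<close> norm of the kernel and multiplies
  its supremum by the cube of the scale. The larger of the two numbers at scale 0 therefore serves
  for all scales.\<close>

lemma ex_kernel_bound:
  assumes m: "bump m"
  shows "\<exists>A. \<forall>j. kernel_bound (kern (dilate j m)) A (A * (2 powi j) ^ 3)"
proof -
  obtain B where B: "B > 0" "\<And>x. norm (kern m x) \<le> B"
    using schwartz_bounded[OF kern_schwartz[OF m]] by metis
  define A where "A = max B (\<integral>x. norm (kern m x) \<partial>lborel)"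
  have A: "A > 0" "B \<le> A" "(\<integral>x. norm (kern m x) \<partial>lborel) \<le> A" using B by (auto simp: A_def)
  have "kernel_bound (kern (dilate j m)) A (A * (2 powi j) ^ 3)" for j
    unfolding kernel_bound_def
  proof (intro conjI allI)
    show "integrable lborel (kern (dilate j m))"
      by (intro schwartz_integrable kern_schwartz bump_dilate m)
    have *: "norm (kern (dilate j m) x) = (2 powi j) ^ 3 * norm (kern m (0 + 2 powi j *\<^sub>R x))" for x
      by (simp add: kern_dilate[OF m] norm_mult norm_power norm_power_int)
    have "(\<integral>x. norm (kern m (0 + 2 powi j *\<^sub>R x)) \<partial>lborel) = (\<integral>x. norm (kern m x) \<partial>lborel) /\<^sub>R (2 powi j) ^ 3"
      using schwartz_integrable[OF kern_schwartz[OF m]]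
      by (intro integral_affine integrable_norm) simp_all
    then show "(\<integral>x. norm (kern (dilate j m) x) \<partial>lborel) \<le> A"
      unfolding * using A(3) by (simp add: mult.assoc[symmetric])
    show "norm (kern (dilate j m) x) \<le> A * (2 powi j) ^ 3" for x
      unfolding * mult.commute[of A] using order_trans[OF B(2) A(2)] by (intro mult_left_mono) auto
  qed (use A in auto)
  then show ?thesis by blast
qed

section \<open>Convolution estimates\<close>

text \<open>A bound for the \<open>L_p\<close> norm instead of the norm itself keeps the estimates
  in the reals. Strict positivity of \<open>F\<close> keeps its real powers nondegenerate.\<close>

definition lp :: "real \<Rightarrow> (real^3 \<Rightarrow> 'a::real_normed_vector) \<Rightarrow> real \<Rightarrow> bool" where
  "lp p f F \<longleftrightarrow> f \<in> borel_measurable borel \<and> 0 < F \<and>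
     (\<integral>\<^sup>+x. ennreal (norm (f x) powr p) \<partial>lborel) \<le> ennreal (F powr p)"

lemma lp_measurable: "lp p f F \<Longrightarrow> f \<in> borel_measurable borel"
  by (simp add: lp_def)

lemma lp_pos: "lp p f F \<Longrightarrow> 0 < F"
  by (simp add: lp_def)

lemma lp_integrable:
  assumes "lp p f F"
  shows "integrable lborel (\<lambda>x. norm (f x) powr p)"
    and "(\<integral>x. norm (f x) powr p \<partial>lborel) \<le> F powr p"
proof -
  have [measurable]: "f \<in> borel_measurable borel" using assms by (rule lp_measurable)
  have le: "(\<integral>\<^sup>+x. ennreal (norm (f x) powr p) \<partial>lborel) \<le> ennreal (F powr p)"
    using assms by (simp add: lp_def)
  show I: "integrable lborel (\<lambda>x. norm (f x) powr p)"
    using order_le_less_trans[OF le ennreal_less_top] by (intro integrableI_nonneg) auto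
  show "(\<integral>x. norm (f x) powr p \<partial>lborel) \<le> F powr p"
    using le by (subst (asm) nn_integral_eq_integral[OF I]) auto
qed

lemma lp_mono:
  assumes "lp p f F" "F \<le> F'" "p > 0"
  shows "lp p f F'"
proof -
  have "F powr p \<le> F' powr p" using assms by (intro powr_mono2) (auto simp: lp_def)
  then show ?thesis using assms unfolding lp_def by (meson ennreal_leI less_le_trans order_trans)
qed

lemma lp_norm_le:
  assumes "lp p f F" "g \<in> borel_measurable borel" "\<And>x. norm (g x) \<le> norm (f x)" "p > 0"
  shows "lp p g F"
proof -
  have "(\<integral>\<^sup>+x. ennreal (norm (g x) powr p) \<partial>lborel) \<le> (\<integral>\<^sup>+x. ennreal (norm (f x) powr p) \<partial>lborel)"
    using assms by (intro nn_integral_mono ennreal_leI powr_mono2) auto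
  then show ?thesis using assms unfolding lp_def by (meson order_trans)
qed

text \<open>The sum is at most the number of terms times the largest term, whose power is one of the
  summands on the right.\<close>

lemma sum_powr_le:
  fixes a :: "'i \<Rightarrow> real"
  assumes "finite I" "\<And>i. i \<in> I \<Longrightarrow> 0 \<le> a i" "p > 0"
  shows "(\<Sum>i\<in>I. a i) powr p \<le> real (card I) powr p * (\<Sum>i\<in>I. a i powr p)"
proof (cases "I = {}")
  case False
  obtain i where "i \<in> I" "Max (a ` I) = a i"
    using obtains_MAX[OF assms(1) False, of a] by metis
  then have i: "i \<in> I" "\<And>j. j \<in> I \<Longrightarrow> a j \<le> a i"
    using assms(1) by (auto simp flip: \<open>Max (a ` I) = a i\<close>)
  have "(\<Sum>i\<in>I. a i) \<le> real (card I) * a i"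
    using sum_bounded_above[of I a "a i"] i(2) by simp
  then have "(\<Sum>i\<in>I. a i) powr p \<le> (real (card I) * a i) powr p"
    using assms by (intro powr_mono2 sum_nonneg) auto
  also have "\<dots> = real (card I) powr p * a i powr p" using assms i by (simp add: powr_mult)
  also have "\<dots> \<le> real (card I) powr p * (\<Sum>i\<in>I. a i powr p)"
    using assms i by (intro mult_left_mono member_le_sum) auto
  finally show ?thesis .
qed simp

text \<open>A crude form of Minkowski's inequality. The elementary bound for powers of sums gives
  the number of terms to the power \<open>1 + 1 / p\<close>, which is at most its square.\<close>

lemma lp_sum:
  assumes fin: "finite I" and f: "\<And>i. i \<in> I \<Longrightarrow> lp p (f i) F"
    and g: "g \<in> borel_measurable borel" "\<And>x. norm (g x) \<le> (\<Sum>i\<in>I. norm (f i x))"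
    and p: "p \<ge> 1" and I: "I \<noteq> {}"
  shows "lp p g ((real (card I))\<^sup>2 * F)"
proof -
  let ?n = "real (card I)"
  have n: "?n \<ge> 1" using fin I by (simp add: Suc_leI card_gt_0_iff)
  have F: "F > 0" using f I lp_pos by blast
  have "(\<integral>\<^sup>+x. ennreal (norm (g x) powr p) \<partial>lborel)
      \<le> (\<integral>\<^sup>+x. ennreal (?n powr p) * (\<Sum>i\<in>I. ennreal (norm (f i x) powr p)) \<partial>lborel)"
  proof (rule nn_integral_mono)
    fix x
    have "norm (g x) powr p \<le> (\<Sum>i\<in>I. norm (f i x)) powr p"
      using g(2) p by (intro powr_mono2) auto
    also have "\<dots> \<le> ?n powr p * (\<Sum>i\<in>I. norm (f i x) powr p)"
      by (rule sum_powr_le[OF fin]) (use p in auto)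
    finally show "ennreal (norm (g x) powr p) \<le> ennreal (?n powr p) * (\<Sum>i\<in>I. ennreal (norm (f i x) powr p))"
      by (simp add: ennreal_mult'[symmetric] ennreal_leI)
  qed
  also have "\<dots> = ennreal (?n powr p) * (\<Sum>i\<in>I. \<integral>\<^sup>+x. ennreal (norm (f i x) powr p) \<partial>lborel)"
  proof -
    have [measurable]: "i \<in> I \<Longrightarrow> f i \<in> borel_measurable borel" for i using f lp_measurable by blast
    show ?thesis
      by (subst nn_integral_cmult) (auto simp del: sum_ennreal intro!: nn_integral_sum arg_cong2[where f = "(*)"])
  qed
  also have "\<dots> \<le> ennreal (?n powr p) * (\<Sum>i\<in>I. ennreal (F powr p))"
    using f by (intro mult_left_mono sum_mono) (auto simp: lp_def)
  also have "\<dots> = ennreal (?n powr p * (?n * F powr p))"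
    by (simp add: ennreal_mult' ennreal_of_nat_eq_real_of_nat)
  also have "\<dots> \<le> ennreal ((?n\<^sup>2 * F) powr p)"
  proof (rule ennreal_leI)
    have "?n powr 1 \<le> ?n powr p" using n p by (intro powr_mono) auto
    then have "?n * F powr p \<le> ?n powr p * F powr p" using n by (intro mult_right_mono) auto
    then have "?n powr p * (?n * F powr p) \<le> ?n powr p * (?n powr p * F powr p)"
      by (intro mult_left_mono) auto
    also have "\<dots> = (?n\<^sup>2 * F) powr p" using F n by (simp add: powr_mult power2_eq_square)
    finally show "?n powr p * (?n * F powr p) \<le> (?n\<^sup>2 * F) powr p" .
  qed
  finally show ?thesis using g F n by (simp add: lp_def)
qed

text \<open>The tangent at \<open>t\<close> lies below the convex power function; Young's inequality
  with the conjugate exponents \<open>p\<close> and \<open>p / (p - 1)\<close> delivers this without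
  derivatives.\<close>

lemma powr_tangent:
  assumes "p > 1" "v \<ge> 0" "t > (0::real)"
  shows "p * t powr (p - 1) * v - (p - 1) * t powr p \<le> v powr p"
proof -
  let ?q = "p / (p - 1)"
  have q: "?q > 1" "1 / p + 1 / ?q = 1" using assms by (auto simp: field_simps)
  have "v * t powr (p - 1) \<le> v powr p / p + (t powr (p - 1)) powr ?q / ?q"
    by (rule Youngs_inequality) (use assms q in auto)
  also have "(t powr (p - 1)) powr ?q = t powr p" using assms by (simp add: powr_powr)
  finally have "p * (v * t powr (p - 1)) \<le> p * (v powr p / p + t powr p / ?q)"
    using assms by (intro mult_left_mono) auto
  also have "p * (v powr p / p + t powr p / ?q) = v powr p + (p - 1) * t powr p"
    using assms by (simp add: distrib_left)
  finally show ?thesis by (simp add: algebra_simps)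
qed

lemma powr_le_1_add: "v \<ge> (0::real) \<Longrightarrow> p \<ge> 1 \<Longrightarrow> v \<le> 1 + v powr p"
  by (cases "v \<le> 1") (use powr_mono[of 1 p v] in \<open>auto intro: add_increasing2\<close>)

text \<open>Jensen's inequality for the measure with density \<open>u\<close>. Integrating the
  tangent inequality needs no normalisation: the total mass enters with a negative coefficient, so
  the bound \<open>A\<close> for it is enough.\<close>

lemma jensen_powr:
  fixes u v :: "'b \<Rightarrow> real"
  assumes p: "p > 1" and A: "A > 0" and u: "integrable M u" "\<And>x. 0 \<le> u x" "(\<integral>x. u x \<partial>M) \<le> A"
    and v: "v \<in> borel_measurable M" "\<And>x. 0 \<le> v x" and uv: "integrable M (\<lambda>x. u x * v x powr p)"
  shows "integrable M (\<lambda>x. u x * v x)"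
    and "(\<integral>x. u x * v x \<partial>M) powr p \<le> A powr (p - 1) * (\<integral>x. u x * v x powr p \<partial>M)"
proof -
  have [measurable]: "u \<in> borel_measurable M" "v \<in> borel_measurable M" using u v by auto
  show I: "integrable M (\<lambda>x. u x * v x)"
  proof (rule Bochner_Integration.integrable_bound)
    show "integrable M (\<lambda>x. u x + u x * v x powr p)" using u uv by simp
    have "u x * v x \<le> u x * (1 + v x powr p)" for x
      using p by (intro mult_left_mono powr_le_1_add u v) auto
    then show "AE x in M. norm (u x * v x) \<le> norm (u x + u x * v x powr p)"
      using u(2) v(2) by (intro AE_I2) (simp add: distrib_left abs_mult)
  qed measurable
  let ?X = "\<integral>x. u x * v x \<partial>M"
  have X0: "?X \<ge> 0" using u v by (intro integral_nonneg_AE) auto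
  show "?X powr p \<le> A powr (p - 1) * (\<integral>x. u x * v x powr p \<partial>M)"
  proof (cases "?X = 0")
    case True
    have "0 \<le> (\<integral>x. u x * v x powr p \<partial>M)" using u v by (intro integral_nonneg_AE) auto
    then show ?thesis using True A p by simp
  next
    case False
    \<comment> \<open>The point of contact is the mean of \<open>v\<close> under mass
      \<open>A\<close>; with this choice the two terms of the tangent combine to
      \<open>?t powr (p - 1) * ?X\<close>.\<close>
    let ?t = "?X / A"
    have X: "?X > 0" using X0 False by simp
    then have t: "?t > 0" using A by simp
    have "(\<integral>x. p * ?t powr (p - 1) * (u x * v x) - (p - 1) * ?t powr p * u x \<partial>M)
        \<le> (\<integral>x. u x * v x powr p \<partial>M)"
    proof (rule integral_mono)
      show "integrable M (\<lambda>x. p * ?t powr (p - 1) * (u x * v x) - (p - 1) * ?t powr p * u x)"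
        using I u by simp
      show "p * ?t powr (p - 1) * (u x * v x) - (p - 1) * ?t powr p * u x \<le> u x * v x powr p" for x
        using mult_left_mono[OF powr_tangent[OF p v(2)[of x] t] u(2)[of x]]
        by (simp add: algebra_simps)
    qed (rule uv)
    also have "(\<integral>x. p * ?t powr (p - 1) * (u x * v x) - (p - 1) * ?t powr p * u x \<partial>M)
        = p * ?t powr (p - 1) * ?X - (p - 1) * ?t powr p * (\<integral>x. u x \<partial>M)"
      using I u by simp
    finally have "p * ?t powr (p - 1) * ?X - (p - 1) * ?t powr p * (\<integral>x. u x \<partial>M)
        \<le> (\<integral>x. u x * v x powr p \<partial>M)" .
    moreover have "(p - 1) * ?t powr p * (\<integral>x. u x \<partial>M) \<le> (p - 1) * ?t powr p * A"
      using u(3) p by (intro mult_left_mono) auto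
    moreover have "(p - 1) * ?t powr p * A = (p - 1) * (?t powr (p - 1) * ?X)"
      using t A X by (simp add: powr_diff)
    moreover have "p * ?t powr (p - 1) * ?X = (p - 1) * (?t powr (p - 1) * ?X) + ?t powr (p - 1) * ?X"
      by (simp add: algebra_simps)
    ultimately have "?t powr (p - 1) * ?X \<le> (\<integral>x. u x * v x powr p \<partial>M)"
      by linarith
    then have "A powr (p - 1) * (?t powr (p - 1) * ?X) \<le> A powr (p - 1) * (\<integral>x. u x * v x powr p \<partial>M)"
      by (intro mult_left_mono) auto
    moreover have "A powr (p - 1) * (?t powr (p - 1) * ?X) = ?X powr p"
      using A X by (simp add: powr_divide powr_diff)
    ultimately show ?thesis by simp
  qed
qed

definition conv :: "(real^3 \<Rightarrow> complex) \<Rightarrow> (real^3 \<Rightarrow> complex) \<Rightarrow> real^3 \<Rightarrow> complex" where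
  "conv k f x = (\<integral>y. k (x - y) * f y \<partial>lborel)"

lemma conv_measurable [measurable]:
  assumes [measurable]: "k \<in> borel_measurable borel" "f \<in> borel_measurable borel"
  shows "conv k f \<in> borel_measurable borel"
  unfolding conv_def by measurable

context
  fixes k f :: "real^3 \<Rightarrow> complex" and p A B F :: real
  assumes p: "p > 1" and k: "kernel_bound k A B" and f: "lp p f F"
begin

lemma conv_args_measurable [measurable]: "k \<in> borel_measurable borel" "f \<in> borel_measurable borel"
  using k f by (auto simp: kernel_bound_def lp_def)

lemma conv_k_integrable: "integrable lborel (\<lambda>y. norm (k (x - y)))"
  and conv_k_integral: "(\<integral>y. norm (k (x - y)) \<partial>lborel) \<le> A"
  using k by (auto simp: kernel_bound_def integrable_reflect[of "\<lambda>x. norm (k x)"]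
      integral_reflect[of "\<lambda>x. norm (k x)"])

text \<open>All four facts come from Jensen's inequality for the density
  \<open>norm (k (x - y))\<close>. For the last one the kernel on the right-hand side is replaced by
  its supremum \<open>B\<close>.\<close>

lemma
  shows conv_powr_integrable: "integrable lborel (\<lambda>y. norm (k (x - y)) * norm (f y) powr p)"
    and conv_abs_integrable: "integrable lborel (\<lambda>y. norm (k (x - y)) * norm (f y))"
    and conv_abs_powr: "(\<integral>y. norm (k (x - y)) * norm (f y) \<partial>lborel) powr p
        \<le> A powr (p - 1) * (\<integral>y. norm (k (x - y)) * norm (f y) powr p \<partial>lborel)"
    and conv_abs_sup: "(\<integral>y. norm (k (x - y)) * norm (f y) \<partial>lborel)
        \<le> A powr (1 - 1 / p) * B powr (1 / p) * F"
proof -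
  have AB: "A > 0" "B > 0" "F > 0" using k f by (auto simp: kernel_bound_def lp_def)
  have kB: "norm (k z) \<le> B" for z using k by (simp add: kernel_bound_def)
  show 1: "integrable lborel (\<lambda>y. norm (k (x - y)) * norm (f y) powr p)"
  proof (rule Bochner_Integration.integrable_bound)
    show "integrable lborel (\<lambda>y. B * norm (f y) powr p)" using lp_integrable[OF f] by simp
    show "AE y in lborel. norm (norm (k (x - y)) * norm (f y) powr p) \<le> norm (B * norm (f y) powr p)"
      using AB by (intro AE_I2) (auto simp: abs_mult intro!: mult_right_mono kB)
  qed measurable
  have J: "integrable lborel (\<lambda>y. norm (k (x - y)) * norm (f y))"
    "(\<integral>y. norm (k (x - y)) * norm (f y) \<partial>lborel) powr p
        \<le> A powr (p - 1) * (\<integral>y. norm (k (x - y)) * norm (f y) powr p \<partial>lborel)"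
    by (rule jensen_powr[OF p AB(1) conv_k_integrable _ conv_k_integral _ _ 1]; simp)+
  show "integrable lborel (\<lambda>y. norm (k (x - y)) * norm (f y))" by (rule J)
  show "(\<integral>y. norm (k (x - y)) * norm (f y) \<partial>lborel) powr p
        \<le> A powr (p - 1) * (\<integral>y. norm (k (x - y)) * norm (f y) powr p \<partial>lborel)" by (rule J)
  also have "\<dots> \<le> A powr (p - 1) * (\<integral>y. B * norm (f y) powr p \<partial>lborel)"
    using 1 lp_integrable[OF f] by (intro mult_left_mono integral_mono mult_right_mono kB) auto
  also have "\<dots> \<le> A powr (p - 1) * (B * F powr p)"
    using lp_integrable[OF f] AB by (simp add: mult_left_mono)
  also have "\<dots> = (A powr (1 - 1 / p) * B powr (1 / p) * F) powr p"
    using AB p by (simp add: powr_mult powr_powr left_diff_distrib)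
  finally show "(\<integral>y. norm (k (x - y)) * norm (f y) \<partial>lborel) \<le> A powr (1 - 1 / p) * B powr (1 / p) * F"
    using powr_less_mono2[of p "A powr (1 - 1 / p) * B powr (1 / p) * F"] p AB
    by (meson less_le_not_le less_trans linorder_not_less mult_nonneg_nonneg powr_ge_zero zero_less_one less_imp_le)
qed

lemma conv_integrable: "integrable lborel (\<lambda>y. k (x - y) * f y)"
proof -
  have "integrable lborel (\<lambda>y. norm (k (x - y) * f y))" 
    unfolding norm_mult by (rule conv_abs_integrable)
  then show ?thesis by (subst (asm) integrable_norm_iff) measurable
qed

lemma norm_conv_le: "norm (conv k f x) \<le> (\<integral>y. norm (k (x - y)) * norm (f y) \<partial>lborel)"
  unfolding conv_def by (rule order_trans[OF integral_norm_bound]) (simp add: norm_mult)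

lemma conv_sup: "norm (conv k f x) \<le> A powr (1 - 1 / p) * B powr (1 / p) * F"
  using norm_conv_le conv_abs_sup by (rule order_trans)

text \<open>Jensen's inequality at each point contributes \<open>A powr (p - 1)\<close>, and the
  inner integral after exchanging the order of integration contributes another
  \<open>A\<close>.\<close>

lemma lp_conv: "lp p (conv k f) (A * F)"
proof -
  have AB: "A > 0" "B > 0" "F > 0" using k f by (auto simp: kernel_bound_def lp_def)
  have "(\<integral>\<^sup>+x. ennreal (norm (conv k f x) powr p) \<partial>lborel)
      \<le> (\<integral>\<^sup>+x. ennreal (A powr (p - 1)) * (\<integral>\<^sup>+y. ennreal (norm (k (x - y)) * norm (f y) powr p) \<partial>lborel) \<partial>lborel)"
  proof (rule nn_integral_mono)
    fix x
    have "norm (conv k f x) powr p \<le> (\<integral>y. norm (k (x - y)) * norm (f y) \<partial>lborel) powr p"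
      using p by (intro powr_mono2 norm_conv_le) auto
    also have "\<dots> \<le> A powr (p - 1) * (\<integral>y. norm (k (x - y)) * norm (f y) powr p \<partial>lborel)"
      by (rule conv_abs_powr)
    finally show "ennreal (norm (conv k f x) powr p) \<le>
      ennreal (A powr (p - 1)) * (\<integral>\<^sup>+y. ennreal (norm (k (x - y)) * norm (f y) powr p) \<partial>lborel)"
      by (subst nn_integral_eq_integral[OF conv_powr_integrable])
        (auto simp: ennreal_mult'[symmetric] intro!: ennreal_leI)
  qed
  also have "\<dots> = ennreal (A powr (p - 1)) *
      (\<integral>\<^sup>+x. (\<integral>\<^sup>+y. ennreal (norm (k (x - y)) * norm (f y) powr p) \<partial>lborel) \<partial>lborel)"
    by (rule nn_integral_cmult) measurable
  also have "(\<integral>\<^sup>+x. (\<integral>\<^sup>+y. ennreal (norm (k (x - y)) * norm (f y) powr p) \<partial>lborel) \<partial>lborel)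
     = (\<integral>\<^sup>+y. (\<integral>\<^sup>+x. ennreal (norm (k (x - y)) * norm (f y) powr p) \<partial>lborel) \<partial>lborel)"
    by (rule lborel_pair.Fubini'[symmetric]) measurable
  also have "\<dots> = (\<integral>\<^sup>+y. (\<integral>\<^sup>+x. ennreal (norm (k (x - y))) \<partial>lborel) * ennreal (norm (f y) powr p) \<partial>lborel)"
    by (simp add: ennreal_mult' nn_integral_multc)
  also have "\<dots> \<le> (\<integral>\<^sup>+y. ennreal A * ennreal (norm (f y) powr p) \<partial>lborel)"
  proof (intro nn_integral_mono mult_right_mono)
    fix y
    have I: "integrable lborel (\<lambda>x. norm (k (- y + x)))"
      using k by (intro integrable_translate integrable_norm) (simp add: kernel_bound_def)
    have "(\<integral>x. norm (k (- y + x)) \<partial>lborel) = (\<integral>x. norm (k x) \<partial>lborel)"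
      by (rule integral_translate) measurable
    then show "(\<integral>\<^sup>+x. ennreal (norm (k (x - y))) \<partial>lborel) \<le> ennreal A"
      using I k by (simp add: nn_integral_eq_integral kernel_bound_def)
  qed simp
  also have "\<dots> = ennreal A * (\<integral>\<^sup>+y. ennreal (norm (f y) powr p) \<partial>lborel)"
    by (rule nn_integral_cmult) measurable
  also have "\<dots> \<le> ennreal A * ennreal (F powr p)"
    using f by (intro mult_left_mono) (auto simp: lp_def)
  also have "ennreal (A powr (p - 1)) * (ennreal A * ennreal (F powr p)) = ennreal ((A * F) powr p)"
    using AB by (simp add: ennreal_mult'[symmetric] powr_mult powr_diff)
  finally have "(\<integral>\<^sup>+x. ennreal (norm (conv k f x) powr p) \<partial>lborel) \<le> ennreal ((A * F) powr p)"
    by (simp add: mult_left_mono)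
  then show ?thesis using AB by (simp add: lp_def)
qed

end

text \<open>Interpolation between \<open>L\<^sub>p\<close> and \<open>L\<^sub>\<infinity>\<close> replaces Young's inequality for three exponents.\<close>

lemma bernstein:
  assumes p: "p > 1" and q: "q \<ge> p" and k: "kernel_bound k A (A * (2 powi j) ^ 3)" and f: "lp p f F"
  shows "lp q (conv k f) (A * F * 2 powr (3 * of_int j * (1 / p - 1 / q)))"
proof -
  have AF: "A > 0" "F > 0" using k f by (auto simp: kernel_bound_def lp_def)
  have [measurable]: "conv k f \<in> borel_measurable borel"
    using k f by (intro conv_measurable) (auto simp: kernel_bound_def lp_def)
  let ?S = "A * F * 2 powr (3 * of_int j / p)"
  have S: "norm (conv k f x) \<le> ?S" for x
  proof -
    have "A powr (1 - 1 / p) * (A * (2 powi j) ^ 3) powr (1 / p) * F = ?S"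
    proof -
      have "(2 powi j) ^ 3 = ((2::real) powr of_int j) powr 3"
        by (simp add: powr_real_of_int' powr_numeral)
      then have "(2 powi j) ^ 3 = (2::real) powr (3 * of_int j)"
        by (simp add: powr_powr mult.commute)
      then have "(A * (2 powi j) ^ 3) powr (1 / p) = A powr (1 / p) * 2 powr (3 * of_int j / p)"
        using AF by (simp add: powr_mult powr_powr)
      then have "A powr (1 - 1 / p) * (A * (2 powi j) ^ 3) powr (1 / p) * F
          = (A powr (1 - 1 / p) * A powr (1 / p)) * F * 2 powr (3 * of_int j / p)"
        by (simp only: mult_ac)
      also have "A powr (1 - 1 / p) * A powr (1 / p) = A"
        using AF by (simp add: powr_add[symmetric])
      finally show ?thesis .
    qed
    then show ?thesis using conv_sup[OF p k f, of x] by (simp only:)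
  qed
  have Spos: "?S > 0" using AF by simp
  have "(\<integral>\<^sup>+x. ennreal (norm (conv k f x) powr q) \<partial>lborel)
      \<le> (\<integral>\<^sup>+x. ennreal (?S powr (q - p)) * ennreal (norm (conv k f x) powr p) \<partial>lborel)"
  proof (rule nn_integral_mono)
    fix x
    have "norm (conv k f x) powr q = norm (conv k f x) powr (q - p) * norm (conv k f x) powr p"
      by (simp add: powr_add[symmetric])
    also have "\<dots> \<le> ?S powr (q - p) * norm (conv k f x) powr p"
      using q S by (intro mult_right_mono powr_mono2) auto
    finally show "ennreal (norm (conv k f x) powr q) \<le> ennreal (?S powr (q - p)) * ennreal (norm (conv k f x) powr p)"
      by (simp add: ennreal_mult'[symmetric] ennreal_leI)
  qed
  also have "\<dots> = ennreal (?S powr (q - p)) * (\<integral>\<^sup>+x. ennreal (norm (conv k f x) powr p) \<partial>lborel)"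
    by (rule nn_integral_cmult) measurable
  also have "\<dots> \<le> ennreal (?S powr (q - p)) * ennreal ((A * F) powr p)"
    using lp_conv[OF p k f] by (intro mult_left_mono) (auto simp: lp_def)
  also have "\<dots> = ennreal ((A * F * 2 powr (3 * of_int j * (1 / p - 1 / q))) powr q)"
  proof -
    have "?S powr (q - p) * (A * F) powr p = ((A * F) powr (q - p) * (A * F) powr p) * 2 powr (3 * of_int j / p * (q - p))"
      using AF by (simp add: powr_mult powr_powr mult_ac)
    also have "(A * F) powr (q - p) * (A * F) powr p = (A * F) powr q"
      by (simp add: powr_add[symmetric])
    also have "3 * of_int j / p * (q - p) = 3 * of_int j * (1 / p - 1 / q) * q"
      using p q by (simp add: field_simps)
    also have "(A * F) powr q * 2 powr (3 * of_int j * (1 / p - 1 / q) * q) = (A * F * 2 powr (3 * of_int j * (1 / p - 1 / q))) powr q"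
      using AF by (simp add: powr_mult powr_powr)
    finally show ?thesis by (simp add: ennreal_mult'[symmetric])
  qed
  finally show ?thesis using AF by (simp add: lp_def)
qed

text \<open>The inequality \<open>v \<le> 1 + v powr p\<close> takes the place of Hoelder's
  inequality, since a Schwartz function is both integrable and bounded.\<close>

lemma lp_schwartz_integrable:
  assumes p: "p > 1" and f: "lp p f F" and \<theta>: "\<theta> \<in> schwartz"
  shows "integrable lborel (\<lambda>x. \<theta> x * f x)"
proof -
  obtain C where C: "C > 0" "\<And>x. norm (\<theta> x) \<le> C" using schwartz_bounded[OF \<theta>] by metis
  have [measurable]: "f \<in> borel_measurable borel" "\<theta> \<in> borel_measurable borel"
    using f \<theta> by (auto simp: lp_def schwartz_measurable)
  show ?thesis
  proof (rule Bochner_Integration.integrable_bound)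
    show "integrable lborel (\<lambda>x. norm (\<theta> x) + C * norm (f x) powr p)"
      using lp_integrable[OF f] schwartz_integrable[OF \<theta>] by simp
    show "AE x in lborel. norm (\<theta> x * f x) \<le> norm (norm (\<theta> x) + C * norm (f x) powr p)"
    proof (rule AE_I2)
      fix x
      have "norm (\<theta> x * f x) \<le> norm (\<theta> x) * (1 + norm (f x) powr p)"
        unfolding norm_mult using p by (intro mult_left_mono powr_le_1_add) auto
      also have "\<dots> \<le> norm (\<theta> x) + C * norm (f x) powr p"
        using C(2)[of x] by (simp add: distrib_left mult_right_mono)
      finally show "norm (\<theta> x * f x) \<le> norm (norm (\<theta> x) + C * norm (f x) powr p)" by simp
    qed
    show "(\<lambda>x. \<theta> x * f x) \<in> borel_measurable lborel" by measurable
  qed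
qed

text \<open>Convolution with the kernel is hereby recognised as the multiplier acting on the
  distribution that \<open>f\<close> represents. The uniform bound on the convolution of absolute
  values justifies the exchange of integrals.\<close>

lemma integral_conv_mult_op:
  assumes p: "p > 1" and m: "bump m" and f: "lp p f F" and \<theta>: "\<theta> \<in> schwartz"
  shows "integrable lborel (\<lambda>x. \<theta> x * conv (kern m) f x)"
    and "(\<integral>x. \<theta> x * conv (kern m) f x \<partial>lborel) = (\<integral>y. mult_op m \<theta> y * f y \<partial>lborel)"
proof -
  obtain A where "\<And>j. kernel_bound (kern (dilate j m)) A (A * (2 powi j) ^ 3)"
    using ex_kernel_bound[OF m] by blast
  from this[of 0] have k: "kernel_bound (kern m) A A" by (simp add: dilate_def)
  have [measurable]: "f \<in> borel_measurable borel" "\<theta> \<in> borel_measurable borel" "kern m \<in> borel_measurable borel"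
    using f \<theta> by (auto simp: lp_def schwartz_measurable kern_schwartz[OF m])
  define S where "S = A powr (1 - 1 / p) * A powr (1 / p) * F"
  have S: "norm (conv (kern m) f x) \<le> S" for x
    unfolding S_def by (rule conv_sup[OF p k f])
  have "S \<ge> 0" using order_trans[OF norm_ge_zero S] .
  show "integrable lborel (\<lambda>x. \<theta> x * conv (kern m) f x)"
  proof (rule Bochner_Integration.integrable_bound)
    show "integrable lborel (\<lambda>x. S * norm (\<theta> x))" using schwartz_integrable[OF \<theta>] by simp
    show "AE x in lborel. norm (\<theta> x * conv (kern m) f x) \<le> norm (S * norm (\<theta> x))"
      using mult_right_mono[OF S norm_ge_zero] \<open>S \<ge> 0\<close>
      by (intro AE_I2) (simp add: norm_mult abs_mult mult.commute[of "norm (\<theta> _)"])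
  qed measurable
  have int: "integrable (lborel \<Otimes>\<^sub>M lborel) (\<lambda>(x, y). \<theta> x * (kern m (x - y) * f y))"
  proof (rule lborel_pair.Fubini_integrable)
    show "integrable lborel (\<lambda>x. \<integral>y. norm (case (x, y) of (x, y) \<Rightarrow> \<theta> x * (kern m (x - y) * f y)) \<partial>lborel)"
    proof (rule Bochner_Integration.integrable_bound)
      show "integrable lborel (\<lambda>x. S * norm (\<theta> x))" using schwartz_integrable[OF \<theta>] by simp
      have "(\<integral>y. norm (\<theta> x * (kern m (x - y) * f y)) \<partial>lborel) \<le> S * norm (\<theta> x)" for x
        using mult_left_mono[OF conv_abs_sup[OF p k f, of x] norm_ge_zero[of "\<theta> x"]]
        by (simp add: norm_mult S_def mult.commute[of "norm (\<theta> x)"])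
      then show "AE x in lborel. norm (\<integral>y. norm (case (x, y) of (x, y) \<Rightarrow> \<theta> x * (kern m (x - y) * f y)) \<partial>lborel)
          \<le> norm (S * norm (\<theta> x))"
        using \<open>S \<ge> 0\<close> by (intro AE_I2) (simp add: abs_mult)
    qed measurable
    show "AE x in lborel. integrable lborel (\<lambda>y. case (x, y) of (x, y) \<Rightarrow> \<theta> x * (kern m (x - y) * f y))"
      using conv_integrable[OF p k f] by simp
  qed measurable
  have "(\<integral>x. \<theta> x * conv (kern m) f x \<partial>lborel) = (\<integral>x. (\<integral>y. \<theta> x * (kern m (x - y) * f y) \<partial>lborel) \<partial>lborel)"
    unfolding conv_def by simp
  also have "\<dots> = (\<integral>y. (\<integral>x. \<theta> x * (kern m (x - y) * f y) \<partial>lborel) \<partial>lborel)"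
    using lborel_pair.Fubini_integral[OF int] by simp
  also have "\<dots> = (\<integral>y. mult_op m \<theta> y * f y \<partial>lborel)"
  proof (rule Bochner_Integration.integral_cong[OF refl])
    fix y
    have "(\<integral>x. \<theta> x * (kern m (x - y) * f y) \<partial>lborel) = (\<integral>x. (kern m (x - y) * \<theta> x) * f y \<partial>lborel)"
      by (intro Bochner_Integration.integral_cong) (auto simp: mult_ac)
    then show "(\<integral>x. \<theta> x * (kern m (x - y) * f y) \<partial>lborel) = mult_op m \<theta> y * f y"
      by (simp add: mult_op_eq_integral[OF m \<theta>])
  qed
  finally show "(\<integral>x. \<theta> x * conv (kern m) f x \<partial>lborel) = (\<integral>y. mult_op m \<theta> y * f y \<partial>lborel)" .
qed

section \<open>Distributions represented by functions\<close>

lemma bounded_linear_axis: "bounded_linear (axis a :: 'b::real_normed_vector \<Rightarrow> 'b ^ 'n)"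
proof (rule bounded_linear_intro[where K = 1])
  show "norm (axis a x :: 'b ^ 'n) \<le> norm x * 1" for x
  proof -
    have "norm (axis a x :: 'b ^ 'n) \<le> (\<Sum>i\<in>UNIV. norm ((axis a x :: 'b ^ 'n) $ i))"
      unfolding norm_vec_def by (rule L2_set_le_sum) simp
    also have "\<dots> = (\<Sum>i\<in>UNIV. if i = a then norm x else 0)"
      by (intro sum.cong) (auto simp: axis_def)
    finally show ?thesis by simp
  qed
qed (auto simp: vec_eq_iff axis_def)

lemma vec_eq_sum_axis: "(x :: complex^3) = (\<Sum>a\<in>UNIV. axis a (x $ a))"
proof -
  have "(\<Sum>a\<in>UNIV. axis a (x $ a)) $ i = (\<Sum>a\<in>UNIV. if a = i then x $ a else 0)" for i
    unfolding sum_component by (intro sum.cong) (auto simp: axis_def)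
  then show ?thesis by (simp add: vec_eq_iff)
qed

lemma vec_measurableI:
  fixes f :: "'b \<Rightarrow> complex^3"
  assumes "\<And>a. (\<lambda>x. f x $ a) \<in> borel_measurable M"
  shows "f \<in> borel_measurable M"
proof -
  have "(axis a :: complex \<Rightarrow> complex^3) \<in> borel_measurable borel" for a
    by (intro borel_measurable_continuous_onI linear_continuous_on bounded_linear_axis)
  then have "(\<lambda>x. axis a (f x $ a) :: complex^3) \<in> borel_measurable M" for a
    using assms measurable_compose by blast
  then have "(\<lambda>x. \<Sum>a\<in>UNIV. axis a (f x $ a)) \<in> borel_measurable M" by simp
  then show ?thesis by (simp flip: vec_eq_sum_axis)
qed

lemma vec_measurableD:
  fixes f :: "'b \<Rightarrow> complex^3"
  assumes "f \<in> borel_measurable M"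
  shows "(\<lambda>x. f x $ a) \<in> borel_measurable M"
proof -
  have "(\<lambda>x::complex^3. x $ a) \<in> borel_measurable borel"
    by (intro borel_measurable_continuous_onI linear_continuous_on bounded_linear_vec_nth)
  then show ?thesis using assms measurable_compose by blast
qed

lemma norm_le_sum_components: "norm (x :: complex^3) \<le> (\<Sum>a\<in>UNIV. norm (x $ a))"
  unfolding norm_vec_def by (rule L2_set_le_sum) simp

lemma representsI:
  assumes f: "f \<in> borel_measurable borel"
    and I: "\<And>\<theta> a. \<theta> \<in> schwartz \<Longrightarrow> integrable lborel (\<lambda>x. \<theta> x * f x $ a)"
    and E: "\<And>\<theta> a. \<theta> \<in> schwartz \<Longrightarrow> T \<theta> $ a = (\<integral>x. \<theta> x * f x $ a \<partial>lborel)"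
  shows "represents f T"
  unfolding represents_def
proof (intro conjI ballI f)
  fix \<theta> assume \<theta>: "\<theta> \<in> schwartz"
  have "integrable lborel (\<lambda>x. \<Sum>a\<in>UNIV. axis a (\<theta> x * f x $ a) :: complex^3)"
    by (intro Bochner_Integration.integrable_sum integrable_bounded_linear[OF bounded_linear_axis] I \<theta>)
  moreover have "(\<Sum>a\<in>UNIV. axis a (\<theta> x * f x $ a)) = \<theta> x *s f x" for x
    using vec_eq_sum_axis[of "\<theta> x *s f x"] by simp
  ultimately show J: "integrable lborel (\<lambda>x. \<theta> x *s f x)" by simp
  have "(\<integral>x. \<theta> x *s f x \<partial>lborel) $ a = T \<theta> $ a" for a
    using integral_bounded_linear[OF bounded_linear_vec_nth J, of a] E[OF \<theta>, of a] by simp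
  then show "T \<theta> = (\<integral>x. \<theta> x *s f x \<partial>lborel)" by (simp add: vec_eq_iff)
qed

lemma representsD:
  assumes "represents f T" "\<theta> \<in> schwartz"
  shows "integrable lborel (\<lambda>x. \<theta> x * f x $ a)" "T \<theta> $ a = (\<integral>x. \<theta> x * f x $ a \<partial>lborel)"
proof -
  have J: "integrable lborel (\<lambda>x. \<theta> x *s f x)" "T \<theta> = (\<integral>x. \<theta> x *s f x \<partial>lborel)"
    using assms by (auto simp: represents_def)
  show "integrable lborel (\<lambda>x. \<theta> x * f x $ a)"
    using integrable_bounded_linear[OF bounded_linear_vec_nth J(1), of a] by simp
  show "T \<theta> $ a = (\<integral>x. \<theta> x * f x $ a \<partial>lborel)"
    using integral_bounded_linear[OF bounded_linear_vec_nth J(1), of a] J(2) by simp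
qed

lemma dist_Lp_norm_cong:
  assumes "\<And>\<theta>. \<theta> \<in> schwartz \<Longrightarrow> T \<theta> = U \<theta>"
  shows "dist_Lp_norm p T = dist_Lp_norm p U"
proof -
  have "represents f T \<longleftrightarrow> represents f U" for f using assms by (auto simp: represents_def)
  then show ?thesis by (simp add: dist_Lp_norm_def)
qed

lemma epowr_ennreal: "0 \<le> r \<Longrightarrow> epowr (ennreal r) p = ennreal (r powr p)"
  by (simp add: epowr_def)

lemma epowr_mono: "x \<le> y \<Longrightarrow> 0 \<le> p \<Longrightarrow> epowr x p \<le> epowr y p"
  by (cases x; cases y) (auto simp: epowr_def top_unique intro!: ennreal_leI powr_mono2)

lemma Lp_norm_eq:
  assumes "p > 0"
  shows "Lp_norm (ennreal p) f = epowr (\<integral>\<^sup>+x. ennreal (norm (f x) powr p) \<partial>lborel) (1 / p)"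
  using assms by (simp add: Lp_norm_def epowr_ennreal)

lemma lp_imp_Lp_norm_le:
  assumes "lp p f F" "p > 0"
  shows "Lp_norm (ennreal p) f \<le> ennreal F"
proof -
  have "epowr (\<integral>\<^sup>+x. ennreal (norm (f x) powr p) \<partial>lborel) (1 / p) \<le> epowr (ennreal (F powr p)) (1 / p)"
    using assms by (intro epowr_mono) (auto simp: lp_def)
  also have "\<dots> = ennreal F" using assms by (simp add: epowr_ennreal powr_powr lp_def)
  finally show ?thesis by (simp add: Lp_norm_eq assms)
qed

lemma Lp_norm_less_imp_lp:
  assumes f: "f \<in> borel_measurable borel" and less: "Lp_norm (ennreal p) f < ennreal F" and p: "p > 0"
  shows "lp p f F"
proof -
  let ?I = "\<integral>\<^sup>+x. ennreal (norm (f x) powr p) \<partial>lborel"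
  have F: "F > 0" using less by (metis ennreal_eq_0_iff linorder_not_le not_less_zero)
  have less': "epowr ?I (1 / p) < ennreal F" using less by (simp add: Lp_norm_eq p)
  then have "?I \<noteq> \<infinity>" by (auto simp: epowr_def)
  then obtain r where r: "0 \<le> r" "?I = ennreal r" by (cases ?I) auto
  then have "r powr (1 / p) < F" using less' F by (simp add: epowr_ennreal ennreal_less_iff)
  then have "(r powr (1 / p)) powr p \<le> F powr p" using p by (intro powr_mono2) auto
  then have "?I \<le> ennreal (F powr p)" using r p by (simp add: powr_powr ennreal_leI)
  then show ?thesis using f F by (simp add: lp_def)
qed

lemma dist_Lp_norm_le:
  assumes "represents f T" "lp p f F" "p > 0"
  shows "dist_Lp_norm (ennreal p) T \<le> ennreal F"
  unfolding dist_Lp_norm_def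
  by (rule order_trans[OF Inf_lower lp_imp_Lp_norm_le[OF assms(2,3)]]) (use assms(1) in auto)

text \<open>Strictness is needed to extract a representing function from the infimum; this is why
  the constant \<open>K\<close> later exceeds the Besov norm strictly.\<close>

lemma dist_Lp_norm_lessE:
  assumes "dist_Lp_norm (ennreal p) T < ennreal F" "p > 0"
  obtains f where "represents f T" "lp p f F"
proof -
  obtain f where "represents f T" "Lp_norm (ennreal p) f < ennreal F"
    using assms(1) unfolding dist_Lp_norm_def Inf_less_iff by auto
  then show ?thesis
    using that Lp_norm_less_imp_lp[of f p F] assms(2) by (auto simp: represents_def)
qed

lemma dist_Linfty_norm_zero:
  assumes "\<And>\<theta>. \<theta> \<in> schwartz \<Longrightarrow> T \<theta> = 0"
  shows "dist_Lp_norm \<infinity> T = 0"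
proof -
  have "represents (\<lambda>x. 0) T" unfolding represents_def using assms by simp
  then have "dist_Lp_norm \<infinity> T \<le> Lp_norm \<infinity> (\<lambda>x. 0)"
    unfolding dist_Lp_norm_def by (intro Inf_lower) auto
  also have "\<dots> \<le> 0"
    by (simp add: Lp_norm_def esssup_const)
  finally show ?thesis by simp
qed

subsection \<open>Tempered distributions\<close>

lemma tempered_add:
  "T \<in> tempered \<Longrightarrow> \<theta> \<in> schwartz \<Longrightarrow> \<eta> \<in> schwartz \<Longrightarrow> T (\<lambda>x. \<theta> x + \<eta> x) = T \<theta> + T \<eta>"
  by (simp add: tempered_def)

lemma tempered_cmult: "T \<in> tempered \<Longrightarrow> \<theta> \<in> schwartz \<Longrightarrow> T (\<lambda>x. c * \<theta> x) = c *s T \<theta>"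
  by (simp add: tempered_def)

lemma tempered_zero: "T \<in> tempered \<Longrightarrow> T (\<lambda>x. 0) = 0"
  using tempered_cmult[of T "\<lambda>x. 0" 0] schwartz_zero by simp

lemma tempered_sum:
  assumes T: "T \<in> tempered" and "\<And>i. i \<in> I \<Longrightarrow> \<theta> i \<in> schwartz"
  shows "T (\<lambda>x. \<Sum>i\<in>I. \<theta> i x) = (\<Sum>i\<in>I. T (\<theta> i))"
  using assms(2)
  by (induction I rule: infinite_finite_induct)
    (auto simp: tempered_zero[OF T] tempered_add[OF T] schwartz_sum)

text \<open>Reality is only required on real test functions; splitting a test function into real and
  imaginary parts turns it into compatibility with conjugation.\<close>

lemma tempered_cnj:
  assumes T: "T \<in> tempered" and \<theta>: "\<theta> \<in> schwartz"
  shows "T (\<lambda>x. cnj (\<theta> x)) $ a = cnj (T \<theta> $ a)"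
proof -
  let ?u = "\<lambda>x. complex_of_real (Re (\<theta> x))" and ?v = "\<lambda>x. complex_of_real (Im (\<theta> x))"
  have u: "?u \<in> schwartz" and v: "?v \<in> schwartz"
    by (intro schwartz_linear[OF bounded_linear_compose[OF bounded_linear_of_real bounded_linear_Re] \<theta>]
        schwartz_linear[OF bounded_linear_compose[OF bounded_linear_of_real bounded_linear_Im] \<theta>])+
  have real: "T ?u $ a \<in> \<real>" "T ?v $ a \<in> \<real>"
    using T u v unfolding tempered_def by auto
  have "T \<theta> = T (\<lambda>x. ?u x + \<i> * ?v x)" by (simp flip: complex_eq)
  also have "\<dots> = T ?u + \<i> *s T ?v"
    using u v schwartz_cmult[OF v] by (simp add: tempered_add[OF T] tempered_cmult[OF T])
  finally have 1: "T \<theta> $ a = T ?u $ a + \<i> * T ?v $ a" by simp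
  have cnj: "(\<lambda>x. cnj (\<theta> x)) = (\<lambda>x. ?u x + (- \<i>) * ?v x)"
    by (auto simp: fun_eq_iff complex_eq_iff)
  have "T (\<lambda>x. cnj (\<theta> x)) = T ?u + (- \<i>) *s T ?v"
    using u v schwartz_cmult[OF v, of "- \<i>"] tempered_add[OF T u, of "\<lambda>x. (- \<i>) * ?v x"]
      tempered_cmult[OF T v, of "- \<i>"] by (simp only: cnj)
  then have "T (\<lambda>x. cnj (\<theta> x)) $ a = T ?u $ a - \<i> * T ?v $ a" by simp
  then show ?thesis using 1 real by (simp add: Reals_cnj_iff)
qed

lemma mult_op_half_reflect:
  assumes m: "bump m" and \<theta>: "\<theta> \<in> schwartz"
  shows "mult_op (\<lambda>\<xi>. (m \<xi> + m (- \<xi>)) / 2) \<theta>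
    = (\<lambda>x. (1 / 2) * mult_op m \<theta> x + (1 / 2) * mult_op (\<lambda>\<xi>. m (- \<xi>)) \<theta> x)"
proof -
  let ?F = "inv_fourier \<theta>"
  have S: "(\<lambda>\<xi>. of_real (m \<xi>) * ?F \<xi>) \<in> schwartz" "(\<lambda>\<xi>. of_real (m (- \<xi>)) * ?F \<xi>) \<in> schwartz"
    by (intro mult_op_symbol_schwartz m bump_reflect \<theta>)+
  have "mult_op (\<lambda>\<xi>. (m \<xi> + m (- \<xi>)) / 2) \<theta> x = fourier (\<lambda>\<xi>. (1 / 2) * (of_real (m \<xi>) * ?F \<xi>)
      + (1 / 2) * (of_real (m (- \<xi>)) * ?F \<xi>)) x" for x
    unfolding mult_op_def by (simp add: algebra_simps add_divide_distrib)
  also have "\<dots> x = (1 / 2) * mult_op m \<theta> x + (1 / 2) * mult_op (\<lambda>\<xi>. m (- \<xi>)) \<theta> x" for x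
    unfolding mult_op_def
    by (subst fourier_add[OF schwartz_cmult[OF S(1)] schwartz_cmult[OF S(2)]]) (simp only: fourier_cmult)
  finally show ?thesis by blast
qed

text \<open>Since \<open>g\<close> is real, replacing the multiplier by its even part replaces the representing
  function by its real part.\<close>

lemma represents_even_part:
  assumes g: "g \<in> tempered" and m: "bump m" and f: "represents f (\<lambda>\<theta>. g (mult_op m \<theta>))"
    and \<theta>: "\<theta> \<in> schwartz"
  shows "integrable lborel (\<lambda>x. \<theta> x * of_real (Re (f x $ a)))"
    and "g (mult_op (\<lambda>\<xi>. (m \<xi> + m (- \<xi>)) / 2) \<theta>) $ a = (\<integral>x. \<theta> x * of_real (Re (f x $ a)) \<partial>lborel)"
proof -
  note c = schwartz_cnj[OF \<theta>]
  have I1: "integrable lborel (\<lambda>x. \<theta> x * f x $ a)" by (rule representsD[OF f \<theta>])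
  have I2: "integrable lborel (\<lambda>x. \<theta> x * cnj (f x $ a))"
    using integrable_cnj[OF representsD(1)[OF f c, of a]] by simp
  have Re: "\<theta> x * of_real (Re (f x $ a)) = (1 / 2) * (\<theta> x * f x $ a) + (1 / 2) * (\<theta> x * cnj (f x $ a))" for x
  proof -
    have "of_real (Re (f x $ a)) = (1 / 2) * (f x $ a + cnj (f x $ a))"
      unfolding complex_add_cnj by simp
    then show ?thesis by (simp only: distrib_left mult.left_commute)
  qed
  show "integrable lborel (\<lambda>x. \<theta> x * of_real (Re (f x $ a)))"
    unfolding Re using I1 I2 by simp
  have "g (mult_op (\<lambda>\<xi>. m (- \<xi>)) \<theta>) $ a = cnj (g (mult_op m (\<lambda>x. cnj (\<theta> x))) $ a)"
  proof -
    have "mult_op (\<lambda>\<xi>. m (- \<xi>)) \<theta> = (\<lambda>y. cnj (mult_op m (\<lambda>x. cnj (\<theta> x)) y))"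
      by (simp add: cnj_mult_op[OF m c])
    then show ?thesis by (simp only: tempered_cnj[OF g mult_op_schwartz[OF m c]])
  qed
  also have "\<dots> = (\<integral>x. \<theta> x * cnj (f x $ a) \<partial>lborel)"
    using representsD(2)[OF f c, of a] by (simp flip: Bochner_Integration.integral_cnj)
  finally have 2: "g (mult_op (\<lambda>\<xi>. m (- \<xi>)) \<theta>) $ a = (\<integral>x. \<theta> x * cnj (f x $ a) \<partial>lborel)" .
  have "g (mult_op (\<lambda>\<xi>. (m \<xi> + m (- \<xi>)) / 2) \<theta>)
      = (1 / 2) *s g (mult_op m \<theta>) + (1 / 2) *s g (mult_op (\<lambda>\<xi>. m (- \<xi>)) \<theta>)"
    unfolding mult_op_half_reflect[OF m \<theta>]
    using mult_op_schwartz[OF m \<theta>] mult_op_schwartz[OF bump_reflect[OF m] \<theta>]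
    by (simp only: tempered_add[OF g] tempered_cmult[OF g] schwartz_cmult)
  then have "g (mult_op (\<lambda>\<xi>. (m \<xi> + m (- \<xi>)) / 2) \<theta>) $ a
      = (1 / 2) * (\<integral>x. \<theta> x * f x $ a \<partial>lborel) + (1 / 2) * (\<integral>x. \<theta> x * cnj (f x $ a) \<partial>lborel)"
    using representsD(2)[OF f \<theta>, of a] 2 by simp
  also have "\<dots> = (\<integral>x. \<theta> x * of_real (Re (f x $ a)) \<partial>lborel)"
    unfolding Re using I1 I2 by simp
  finally show "g (mult_op (\<lambda>\<xi>. (m \<xi> + m (- \<xi>)) / 2) \<theta>) $ a = (\<integral>x. \<theta> x * of_real (Re (f x $ a)) \<partial>lborel)" .
qed

text \<open>The weight with exponent 6 is integrable and at most 1, so its product with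
  \<open>G a\<close> is integrable by \<open>powr_le_1_add\<close>. The Schwartz norm of order 6
  therefore controls the functional.\<close>

lemma tempered_of_lp:
  fixes G :: "3 \<Rightarrow> real^3 \<Rightarrow> real"
  assumes p: "p > 1" and G: "\<And>a. lp p (G a) F"
  shows "(\<lambda>\<theta>. \<chi> a. \<integral>x. \<theta> x * of_real (G a x) \<partial>lborel) \<in> tempered" (is "?T \<in> _")
proof -
  have [measurable]: "G a \<in> borel_measurable borel" for a using G by (rule lp_measurable)
  have "(\<lambda>x. complex_of_real (G a x)) \<in> borel_measurable borel" for a by measurable
  then have G': "lp p (\<lambda>x. complex_of_real (G a x)) F" for a
    using G[of a] by (simp add: lp_def)
  have I: "integrable lborel (\<lambda>x. \<theta> x * of_real (G a x))" if "\<theta> \<in> schwartz" for \<theta> a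
    by (rule lp_schwartz_integrable[OF p G' that])
  let ?w = "\<lambda>x::real^3. inverse ((1 + norm x) ^ 6)"
  have w: "integrable lborel (\<lambda>x. ?w x * \<bar>G a x\<bar>)" for a
  proof (rule Bochner_Integration.integrable_bound)
    show "integrable lborel (\<lambda>x. ?w x + norm (G a x) powr p)"
      using integrable_weight lp_integrable(1)[OF G] by simp
    show "AE x in lborel. norm (?w x * \<bar>G a x\<bar>) \<le> norm (?w x + norm (G a x) powr p)"
    proof (rule AE_I2)
      fix x :: "real^3"
      have "1 \<le> (1 + norm x) ^ 6" by (rule one_le_power) simp
      then have w1: "0 \<le> ?w x" "?w x \<le> 1" by (auto simp: inverse_le_1_iff)
      have "?w x * \<bar>G a x\<bar> \<le> ?w x * (1 + norm (G a x) powr p)"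
        using w1 p powr_le_1_add[of "\<bar>G a x\<bar>" p] by (intro mult_left_mono) auto
      also have "\<dots> \<le> ?w x + norm (G a x) powr p"
        using w1 by (simp add: distrib_left mult_left_le_one_le)
      finally show "norm (?w x * \<bar>G a x\<bar>) \<le> norm (?w x + norm (G a x) powr p)"
        using w1 by (simp add: abs_mult)
    qed
  qed measurable
  show ?thesis
    unfolding tempered_def
  proof (intro CollectI conjI ballI allI impI)
    show "?T (\<lambda>x. \<theta> x + \<eta> x) = ?T \<theta> + ?T \<eta>" if "\<theta> \<in> schwartz" "\<eta> \<in> schwartz" for \<theta> \<eta>
      using I[OF that(1)] I[OF that(2)] by (simp add: vec_eq_iff distrib_right)
    show "?T (\<lambda>x. c * \<theta> x) = c *s ?T \<theta>" for c \<theta>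
      by (simp add: vec_eq_iff mult.assoc)
    show "?T \<theta> $ i \<in> \<real>" if "\<theta> \<in> schwartz" "\<forall>x. \<theta> x \<in> \<real>" for \<theta> i
    proof -
      have "cnj (\<theta> x) = \<theta> x" for x using that(2) Reals_cnj_iff by blast
      then have "cnj (\<integral>x. \<theta> x * of_real (G i x) \<partial>lborel) = (\<integral>x. \<theta> x * of_real (G i x) \<partial>lborel)"
        by (simp flip: Bochner_Integration.integral_cnj)
      then show ?thesis by (simp add: Reals_cnj_iff)
    qed
    show "\<exists>C m. \<forall>\<theta>\<in>schwartz. norm (?T \<theta>) \<le> C * schwartz_norm m \<theta>"
    proof (intro exI ballI)
      fix \<theta> assume \<theta>: "\<theta> \<in> schwartz"
      have "norm (?T \<theta>) \<le> (\<Sum>a\<in>UNIV. norm (?T \<theta> $ a))" by (rule norm_le_sum_components)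
      also have "\<dots> \<le> (\<Sum>a\<in>UNIV. (\<integral>x. ?w x * \<bar>G a x\<bar> \<partial>lborel) * schwartz_norm 6 \<theta>)"
      proof (rule sum_mono)
        fix a
        have "norm (?T \<theta> $ a) \<le> (\<integral>x. norm (\<theta> x * of_real (G a x)) \<partial>lborel)"
          by (simp add: integral_norm_bound)
        also have "\<dots> \<le> (\<integral>x. ?w x * \<bar>G a x\<bar> * schwartz_norm 6 \<theta> \<partial>lborel)"
        proof (rule integral_mono)
          fix x
          have "norm (\<theta> x) * \<bar>G a x\<bar> \<le> (schwartz_norm 6 \<theta> * ?w x) * \<bar>G a x\<bar>"
            by (intro mult_right_mono le_weight schwartz_norm_ge \<theta>) simp
          then show "norm (\<theta> x * of_real (G a x)) \<le> ?w x * \<bar>G a x\<bar> * schwartz_norm 6 \<theta>"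
            by (simp add: norm_mult mult_ac)
        qed (use I[OF \<theta>] w in \<open>auto intro: integrable_norm\<close>)
        finally show "norm (?T \<theta> $ a) \<le> (\<integral>x. ?w x * \<bar>G a x\<bar> \<partial>lborel) * schwartz_norm 6 \<theta>" by simp
      qed
      also have "\<dots> = (\<Sum>a\<in>UNIV. (\<integral>x. ?w x * \<bar>G a x\<bar> \<partial>lborel)) * schwartz_norm 6 \<theta>"
        by (simp add: sum_distrib_right)
      finally show "norm (?T \<theta>) \<le> (\<Sum>a\<in>UNIV. (\<integral>x. ?w x * \<bar>G a x\<bar> \<partial>lborel)) * schwartz_norm 6 \<theta>" .
    qed
  qed
qed

lemma schwartz_norm_nonneg: "\<theta> \<in> schwartz \<Longrightarrow> 0 \<le> schwartz_norm m \<theta>"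
  by (rule order_trans[OF _ schwartz_norm_ge[of \<theta> 0 m]]) simp_all

lemma schwartz_norm_mono:
  assumes \<theta>: "\<theta> \<in> schwartz" and "m \<le> n"
  shows "schwartz_norm m \<theta> \<le> schwartz_norm n \<theta>"
  unfolding schwartz_norm_def
proof (rule cSUP_mono)
  show "bdd_above ((\<lambda>(\<alpha>, x). (1 + norm x) ^ n * norm (iter_deriv \<alpha> \<theta> x)) ` ({\<alpha>. length \<alpha> \<le> n} \<times> UNIV))"
    by (rule schwartz_norm_bdd[OF \<theta>])
  fix y assume "y \<in> {\<alpha> :: 3 list. length \<alpha> \<le> m} \<times> (UNIV :: (real^3) set)"
  then obtain \<alpha> x where y: "y = (\<alpha>, x)" "length \<alpha> \<le> m" by auto
  have "(1 + norm x) ^ m \<le> (1 + norm x) ^ n" using assms(2) by (intro power_increasing) auto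
  then have "(1 + norm x) ^ m * norm (iter_deriv \<alpha> \<theta> x) \<le> (1 + norm x) ^ n * norm (iter_deriv \<alpha> \<theta> x)"
    by (rule mult_right_mono) simp
  then show "\<exists>z\<in>{\<alpha>. length \<alpha> \<le> n} \<times> UNIV. (case y of (\<alpha>, x) \<Rightarrow> (1 + norm x) ^ m * norm (iter_deriv \<alpha> \<theta> x))
      \<le> (case z of (\<alpha>, x) \<Rightarrow> (1 + norm x) ^ n * norm (iter_deriv \<alpha> \<theta> x))"
    using y assms(2) by (intro bexI[of _ y]) auto
qed (auto intro: exI[of _ "[]"])

lemma tempered_diff:
  assumes T: "T \<in> tempered" and U: "U \<in> tempered"
  shows "(\<lambda>\<theta>. T \<theta> - U \<theta>) \<in> tempered"
proof -
  obtain C m where C: "\<And>\<theta>. \<theta> \<in> schwartz \<Longrightarrow> norm (T \<theta>) \<le> C * schwartz_norm m \<theta>"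
    using T unfolding tempered_def by blast
  obtain D n where D: "\<And>\<theta>. \<theta> \<in> schwartz \<Longrightarrow> norm (U \<theta>) \<le> D * schwartz_norm n \<theta>"
    using U unfolding tempered_def by blast
  have mono: "schwartz_norm k \<theta> \<le> schwartz_norm (max m n) \<theta>" "0 \<le> schwartz_norm k \<theta>"
    if "\<theta> \<in> schwartz" "k \<le> max m n" for k \<theta>
    using schwartz_norm_mono[OF that] schwartz_norm_nonneg[OF that(1)] by auto
  have "\<exists>C m. \<forall>\<theta>\<in>schwartz. norm (T \<theta> - U \<theta>) \<le> C * schwartz_norm m \<theta>"
  proof (intro exI ballI)
    fix \<theta> assume \<theta>: "\<theta> \<in> schwartz"
    have "norm (T \<theta> - U \<theta>) \<le> C * schwartz_norm m \<theta> + D * schwartz_norm n \<theta>"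
      using norm_triangle_ineq4[of "T \<theta>" "U \<theta>"] C[OF \<theta>] D[OF \<theta>] by simp
    \<comment> \<open>The definition of \<open>tempered\<close> does not fix the signs of
      \<open>C\<close> and \<open>D\<close>; with absolute values the Schwartz norms may be enlarged
      to a common order.\<close>
    also have "\<dots> \<le> \<bar>C\<bar> * schwartz_norm (max m n) \<theta> + \<bar>D\<bar> * schwartz_norm (max m n) \<theta>"
      using mono[OF \<theta>] by (intro add_mono mult_mono) auto
    finally show "norm (T \<theta> - U \<theta>) \<le> (\<bar>C\<bar> + \<bar>D\<bar>) * schwartz_norm (max m n) \<theta>"
      by (simp add: distrib_right)
  qed
  then show ?thesis
    using T U by (auto simp: tempered_def vector_sub_rdistrib vector_ssub_ldistrib intro!: Reals_diff)
qed

subsection \<open>Geometric sums in \<open>L\<^sub>2\<close>\<close>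

text \<open>Cauchy-Schwarz after writing \<open>a n\<close> as \<open>s ^ n * (a n / s ^ n)\<close>.
  It bounds the square of a sum by a sum of squares, so that an \<open>L_2\<close> norm of a series
  needs only one exchange of sum and integral.\<close>

lemma geometric_square_bound:
  fixes a :: "nat \<Rightarrow> real"
  assumes s: "0 < s" "s < 1" and a: "\<And>n. 0 \<le> a n" and S: "summable (\<lambda>n. (a n)\<^sup>2 / (s ^ n)\<^sup>2)"
  shows "summable a" and "(\<Sum>n. a n)\<^sup>2 \<le> (1 / (1 - s\<^sup>2)) * (\<Sum>n. (a n)\<^sup>2 / (s ^ n)\<^sup>2)"
proof -
  have s2: "s\<^sup>2 < 1" using s by (simp add: power_less_one_iff)
  have gs: "summable (\<lambda>n. (s ^ n)\<^sup>2)" "(\<Sum>n. (s ^ n)\<^sup>2) = 1 / (1 - s\<^sup>2)"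
  proof -
    have "(\<lambda>n. (s ^ n)\<^sup>2) = (\<lambda>n. (s\<^sup>2) ^ n)" by (simp add: fun_eq_iff power_mult[symmetric] mult.commute)
    then show "summable (\<lambda>n. (s ^ n)\<^sup>2)" "(\<Sum>n. (s ^ n)\<^sup>2) = 1 / (1 - s\<^sup>2)"
      using s2 summable_geometric[of "s\<^sup>2"] suminf_geometric[of "s\<^sup>2"] by simp_all
  qed
  have fin: "(\<Sum>n<N. a n)\<^sup>2 \<le> (1 / (1 - s\<^sup>2)) * (\<Sum>n. (a n)\<^sup>2 / (s ^ n)\<^sup>2)" for N
  proof -
    have "(\<Sum>n<N. a n)\<^sup>2 = (\<Sum>n<N. s ^ n * (a n / s ^ n))\<^sup>2" using s by simp
    also have "\<dots> \<le> (\<Sum>n<N. (s ^ n)\<^sup>2) * (\<Sum>n<N. (a n / s ^ n)\<^sup>2)"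
      by (rule Cauchy_Schwarz_ineq_sum)
    also have "\<dots> \<le> (1 / (1 - s\<^sup>2)) * (\<Sum>n. (a n)\<^sup>2 / (s ^ n)\<^sup>2)"
      unfolding power_divide gs(2)[symmetric]
      by (intro mult_mono sum_le_suminf gs S sum_nonneg suminf_nonneg) auto
    finally show ?thesis .
  qed
  show sa: "summable a"
  proof (rule bounded_imp_summable)
    let ?B = "(1 / (1 - s\<^sup>2)) * (\<Sum>n. (a n)\<^sup>2 / (s ^ n)\<^sup>2)"
    show "(\<Sum>n\<le>N. a n) \<le> sqrt ?B" for N
      using fin[of "Suc N"] by (intro real_le_rsqrt) (simp add: lessThan_Suc_atMost)
  qed (rule a)
  have "(\<lambda>N. (\<Sum>n<N. a n)\<^sup>2) \<longlonglongrightarrow> (\<Sum>n. a n)\<^sup>2"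
    by (intro tendsto_power summable_LIMSEQ sa)
  then show "(\<Sum>n. a n)\<^sup>2 \<le> (1 / (1 - s\<^sup>2)) * (\<Sum>n. (a n)\<^sup>2 / (s ^ n)\<^sup>2)"
    by (rule LIMSEQ_le_const2) (use fin in auto)
qed

text \<open>The decay \<open>s ^ (2 * n)\<close> is spent in two halves: one is the weight of
  \<open>geometric_square_bound\<close>, the other makes the integrals of the weighted squares
  summable. Each half costs a geometric series, which after taking the root gives the factor
  \<open>1 / (1 - s\<^sup>2)\<close>.\<close>

lemma lp2_geometric_series:
  fixes h :: "nat \<Rightarrow> real^3 \<Rightarrow> real"
  assumes s: "0 < s" "s < 1" and c: "c > 0" and h: "\<And>n. lp 2 (h n) (c * s ^ (2 * n))"
  shows "lp 2 (\<lambda>x. \<Sum>n. h n x) (c / (1 - s\<^sup>2))"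
    and "\<theta> \<in> schwartz \<Longrightarrow>
      (\<lambda>n. \<integral>x. \<theta> x * of_real (h n x) \<partial>lborel) sums (\<integral>x. \<theta> x * of_real (\<Sum>n. h n x) \<partial>lborel)"
proof -
  have [measurable]: "h n \<in> borel_measurable borel" for n using h by (rule lp_measurable)
  have s2: "0 < s\<^sup>2" "s\<^sup>2 < 1" using s by (auto simp: power_less_one_iff)
  define a where "a n x = (h n x)\<^sup>2 / (s ^ n)\<^sup>2" for n x
  have h2: "integrable lborel (\<lambda>x. (h n x)\<^sup>2)" "(\<integral>x. (h n x)\<^sup>2 \<partial>lborel) \<le> c\<^sup>2 * (s\<^sup>2) ^ n * (s\<^sup>2) ^ n" for n
  proof -
    have "(c * s ^ (2 * n)) powr 2 = c\<^sup>2 * (s\<^sup>2) ^ n * (s\<^sup>2) ^ n"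
      using c s by (simp add: powr_numeral power_mult_distrib power_mult power2_eq_square mult_ac)
    moreover have "(\<lambda>x. norm (h n x) powr 2) = (\<lambda>x. (h n x)\<^sup>2)"
      by (simp add: fun_eq_iff powr_numeral)
    ultimately show "integrable lborel (\<lambda>x. (h n x)\<^sup>2)"
      "(\<integral>x. (h n x)\<^sup>2 \<partial>lborel) \<le> c\<^sup>2 * (s\<^sup>2) ^ n * (s\<^sup>2) ^ n"
      using lp_integrable[OF h[of n]] by simp_all
  qed
  have aI: "integrable lborel (a n)" for n unfolding a_def[abs_def] using h2 by simp
  have ale: "(\<integral>x. a n x \<partial>lborel) \<le> c\<^sup>2 * (s\<^sup>2) ^ n" for n
  proof -
    have "(\<integral>x. a n x \<partial>lborel) = (\<integral>x. (h n x)\<^sup>2 \<partial>lborel) / (s ^ n)\<^sup>2" unfolding a_def by simp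
    also have "\<dots> \<le> (c\<^sup>2 * (s\<^sup>2) ^ n * (s\<^sup>2) ^ n) / (s ^ n)\<^sup>2"
      by (intro divide_right_mono h2) simp
    also have "(s ^ n)\<^sup>2 = (s\<^sup>2) ^ n" by (simp add: power_mult[symmetric] mult.commute)
    also have "(c\<^sup>2 * (s\<^sup>2) ^ n * (s\<^sup>2) ^ n) / (s\<^sup>2) ^ n = c\<^sup>2 * (s\<^sup>2) ^ n" using s by simp
    finally show ?thesis .
  qed
  have a0: "0 \<le> a n x" for n x by (simp add: a_def)
  have gsum: "(\<Sum>n. ennreal (c\<^sup>2 * (s\<^sup>2) ^ n)) = ennreal (c\<^sup>2 / (1 - s\<^sup>2))"
  proof (rule suminf_ennreal_eq)
    show "(\<lambda>n. c\<^sup>2 * (s\<^sup>2) ^ n) sums (c\<^sup>2 / (1 - s\<^sup>2))"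
      using sums_mult[OF geometric_sums[of "s\<^sup>2"], of "c\<^sup>2"] s2 by simp
  qed simp
  have nn: "(\<integral>\<^sup>+x. (\<Sum>n. ennreal (a n x)) \<partial>lborel) \<le> ennreal (c\<^sup>2 / (1 - s\<^sup>2))"
  proof -
    have "(\<integral>\<^sup>+x. (\<Sum>n. ennreal (a n x)) \<partial>lborel) = (\<Sum>n. \<integral>\<^sup>+x. ennreal (a n x) \<partial>lborel)"
      by (rule nn_integral_suminf) (simp add: a_def)
    also have "\<dots> \<le> (\<Sum>n. ennreal (c\<^sup>2 * (s\<^sup>2) ^ n))"
      using ale by (intro suminf_le) (auto simp: nn_integral_eq_integral[OF aI] a0 intro: ennreal_leI)
    finally show ?thesis by (simp add: gsum)
  qed
  have "AE x in lborel. (\<Sum>n. ennreal (a n x)) \<noteq> \<infinity>"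
    using nn by (intro nn_integral_noteq_infinite) (auto simp: a_def top_unique)
  then have AEs: "AE x in lborel. summable (\<lambda>n. a n x)"
    by eventually_elim (use a0 in \<open>auto intro!: summable_suminf_not_top\<close>)
  have pw: "summable (\<lambda>n. \<bar>h n x\<bar>)" "(\<Sum>n. h n x)\<^sup>2 \<le> (1 / (1 - s\<^sup>2)) * (\<Sum>n. a n x)"
    if "summable (\<lambda>n. a n x)" for x
  proof -
    note * = geometric_square_bound[OF s, of "\<lambda>n. \<bar>h n x\<bar>"]
    show sm: "summable (\<lambda>n. \<bar>h n x\<bar>)" using *(1) that by (simp add: a_def)
    have "\<bar>\<Sum>n. h n x\<bar> \<le> (\<Sum>n. \<bar>h n x\<bar>)" by (rule summable_rabs[OF sm])
    then have "(\<Sum>n. h n x)\<^sup>2 \<le> (\<Sum>n. \<bar>h n x\<bar>)\<^sup>2" by (simp add: abs_le_square_iff[symmetric])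
    also have "\<dots> \<le> (1 / (1 - s\<^sup>2)) * (\<Sum>n. a n x)" using *(2) that by (simp add: a_def)
    finally show "(\<Sum>n. h n x)\<^sup>2 \<le> (1 / (1 - s\<^sup>2)) * (\<Sum>n. a n x)" .
  qed
  show "lp 2 (\<lambda>x. \<Sum>n. h n x) (c / (1 - s\<^sup>2))"
    unfolding lp_def
  proof (intro conjI)
    show "0 < c / (1 - s\<^sup>2)" using c s2 by simp
    have "(\<integral>\<^sup>+x. ennreal (norm (\<Sum>n. h n x) powr 2) \<partial>lborel)
        \<le> (\<integral>\<^sup>+x. ennreal (1 / (1 - s\<^sup>2)) * (\<Sum>n. ennreal (a n x)) \<partial>lborel)"
    proof (rule nn_integral_mono_AE, use AEs in eventually_elim)
      fix x assume x: "summable (\<lambda>n. a n x)"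
      have "ennreal (norm (\<Sum>n. h n x) powr 2) \<le> ennreal ((1 / (1 - s\<^sup>2)) * (\<Sum>n. a n x))"
        using pw(2)[OF x] by (intro ennreal_leI) (simp add: powr_numeral)
      also have "\<dots> = ennreal (1 / (1 - s\<^sup>2)) * (\<Sum>n. ennreal (a n x))"
        using s2 ennreal_mult[of "1 / (1 - s\<^sup>2)" "\<Sum>n. a n x"]
        by (simp add: suminf_ennreal2[OF a0 x] suminf_nonneg[OF x a0])
      finally show "ennreal (norm (\<Sum>n. h n x) powr 2) \<le> ennreal (1 / (1 - s\<^sup>2)) * (\<Sum>n. ennreal (a n x))" .
    qed
    also have "\<dots> = ennreal (1 / (1 - s\<^sup>2)) * (\<integral>\<^sup>+x. (\<Sum>n. ennreal (a n x)) \<partial>lborel)"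
      by (rule nn_integral_cmult) (simp add: a_def)
    also have "\<dots> \<le> ennreal (1 / (1 - s\<^sup>2)) * ennreal (c\<^sup>2 / (1 - s\<^sup>2))"
      by (intro mult_left_mono nn) simp
    also have "\<dots> = ennreal ((c / (1 - s\<^sup>2)) powr 2)"
      using s2 c by (simp add: ennreal_mult'[symmetric] powr_numeral power2_eq_square)
    finally show "(\<integral>\<^sup>+x. ennreal (norm (\<Sum>n. h n x) powr 2) \<partial>lborel) \<le> ennreal ((c / (1 - s\<^sup>2)) powr 2)" .
  qed measurable
  assume \<theta>: "\<theta> \<in> schwartz"
  have [measurable]: "\<theta> \<in> borel_measurable borel" by (rule schwartz_measurable[OF \<theta>])
  obtain C where C: "C > 0" "\<And>x. norm (\<theta> x) \<le> C" using schwartz_bounded[OF \<theta>] by metis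
  have I: "integrable lborel (\<lambda>x. \<theta> x * of_real (h n x))" for n
    using h[of n] by (intro lp_schwartz_integrable[where p = 2 and F = "c * s ^ (2 * n)"] \<theta>) (auto simp: lp_def)
  have "(\<lambda>n. \<integral>x. \<theta> x * of_real (h n x) \<partial>lborel) sums (\<integral>x. (\<Sum>n. \<theta> x * of_real (h n x)) \<partial>lborel)"
  proof (rule sums_integral[OF I])
    show "AE x in lborel. summable (\<lambda>n. norm (\<theta> x * of_real (h n x)))"
      using AEs
    proof eventually_elim
      fix x assume "summable (\<lambda>n. a n x)"
      from summable_mult[OF pw(1)[OF this], of "norm (\<theta> x)"]
      show "summable (\<lambda>n. norm (\<theta> x * of_real (h n x)))" by (simp add: norm_mult)
    qed
    let ?B = "(\<integral>x. norm (\<theta> x) \<partial>lborel) + C * c\<^sup>2"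
    have "(\<integral>x. norm (\<theta> x * of_real (h n x)) \<partial>lborel) \<le> ?B * s ^ n" for n
    proof -
      have "(\<integral>x. norm (\<theta> x * of_real (h n x)) \<partial>lborel) \<le> (\<integral>x. s ^ n * norm (\<theta> x) + C * (a n x * s ^ n) \<partial>lborel)"
      proof (rule integral_mono)
        show "integrable lborel (\<lambda>x. norm (\<theta> x * of_real (h n x)))" using I by (rule integrable_norm)
        show "integrable lborel (\<lambda>x. s ^ n * norm (\<theta> x) + C * (a n x * s ^ n))"
          using schwartz_integrable[OF \<theta>] aI by simp
        fix x
        \<comment> \<open>Trades square integrability for a summable \<open>L_1\<close> bound
          against a Schwartz function: the linear term is at most one plus the square, taken at
          height \<open>s ^ n\<close>.\<close>
        have "\<bar>h n x\<bar> \<le> s ^ n * (1 + (\<bar>h n x\<bar> / s ^ n)\<^sup>2)"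
        proof -
          have "\<bar>h n x\<bar> / s ^ n \<le> 1 + (\<bar>h n x\<bar> / s ^ n)\<^sup>2"
            using s powr_le_1_add[of "\<bar>h n x\<bar> / s ^ n" 2] by (simp add: powr_numeral)
          then show ?thesis using s by (simp add: divide_le_eq mult.commute)
        qed
        also have "\<dots> = s ^ n + a n x * s ^ n" by (simp add: a_def power_divide algebra_simps)
        finally have "norm (\<theta> x) * \<bar>h n x\<bar> \<le> norm (\<theta> x) * (s ^ n + a n x * s ^ n)"
          by (intro mult_left_mono) auto
        also have "\<dots> \<le> s ^ n * norm (\<theta> x) + C * (a n x * s ^ n)"
          using mult_right_mono[OF C(2)[of x], of "a n x * s ^ n"] a0[of n x] s
          by (simp add: distrib_left mult_ac)
        finally show "norm (\<theta> x * of_real (h n x)) \<le> s ^ n * norm (\<theta> x) + C * (a n x * s ^ n)"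
          by (simp add: norm_mult)
      qed
      also have "\<dots> = s ^ n * (\<integral>x. norm (\<theta> x) \<partial>lborel) + C * ((\<integral>x. a n x \<partial>lborel) * s ^ n)"
        using schwartz_integrable[OF \<theta>] aI by simp
      also have "\<dots> \<le> s ^ n * (\<integral>x. norm (\<theta> x) \<partial>lborel) + C * (c\<^sup>2 * s ^ n)"
      proof -
        have "(s\<^sup>2) ^ n \<le> 1" by (rule power_le_one) (use s2 in auto)
        then have "c\<^sup>2 * (s\<^sup>2) ^ n \<le> c\<^sup>2 * 1" by (intro mult_left_mono) auto
        then have "(\<integral>x. a n x \<partial>lborel) \<le> c\<^sup>2" using ale[of n] by simp
        then show ?thesis using C s by (intro add_left_mono mult_left_mono mult_right_mono) auto
      qed
      also have "\<dots> = ?B * s ^ n" by (simp add: algebra_simps)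
      finally show ?thesis .
    qed
    then have le: "norm (\<integral>x. norm (\<theta> x * of_real (h n x)) \<partial>lborel) \<le> ?B * s ^ n" for n by simp
    have "summable (\<lambda>n. ?B * s ^ n)"
      by (intro summable_mult summable_geometric) (use s in simp)
    then show "summable (\<lambda>n. \<integral>x. norm (\<theta> x * of_real (h n x)) \<partial>lborel)"
      by (rule summable_comparison_test') (rule le)
  qed
  moreover have "(\<integral>x. (\<Sum>n. \<theta> x * of_real (h n x)) \<partial>lborel) = (\<integral>x. \<theta> x * of_real (\<Sum>n. h n x) \<partial>lborel)"
  proof (rule integral_cong_AE)
    show "AE x in lborel. (\<Sum>n. \<theta> x * of_real (h n x)) = \<theta> x * of_real (\<Sum>n. h n x)"
      using AEs
    proof eventually_elim
      fix x assume "summable (\<lambda>n. a n x)"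
      from summable_rabs_cancel[OF pw(1)[OF this]] have sm: "summable (\<lambda>n. h n x)" .
      then have "(\<lambda>n. \<theta> x * of_real (h n x)) sums (\<theta> x * of_real (\<Sum>n. h n x))"
        by (intro sums_mult sums_of_real summable_sums)
      then show "(\<Sum>n. \<theta> x * of_real (h n x)) = \<theta> x * of_real (\<Sum>n. h n x)" by (rule sums_unique[symmetric])
    qed
  qed measurable
  ultimately show "(\<lambda>n. \<integral>x. \<theta> x * of_real (h n x) \<partial>lborel) sums (\<integral>x. \<theta> x * of_real (\<Sum>n. h n x) \<partial>lborel)"
    by simp
qed

section \<open>Littlewood-Paley symbols\<close>

lemma powi_2_le: "i \<le> j \<Longrightarrow> (2::real) powi i \<le> 2 powi j"
  by (rule power_int_increasing) auto

lemma bump_of_support: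
  assumes "smooth m" "\<And>x. m x \<noteq> 0 \<Longrightarrow> norm x \<le> R"
  shows "bump m"
  using assms unfolding bump_def by (meson not_le)

lemma bump_reflect_average: "bump m \<Longrightarrow> bump (\<lambda>\<xi>. (m \<xi> + m (- \<xi>)) / 2)"
  using bump_mult(2)[OF bump_add[OF _ bump_reflect], of m m "\<lambda>_. 1 / 2"] by simp

lemma norm_powi_scale: "norm (2 powi i *\<^sub>R (\<xi> :: real^3)) = 2 powi i * norm \<xi>"
  by simp

locale littlewood_paley_pair =
  fixes \<chi>\<^sub>0 \<phi> :: "real^3 \<Rightarrow> real"
  assumes LP: "littlewood_paley \<chi>\<^sub>0 \<phi>"
begin

lemma phi_support: "\<phi> \<xi> \<noteq> 0 \<Longrightarrow> 3/4 \<le> norm \<xi> \<and> norm \<xi> \<le> 8/3"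
  using LP closure_subset[of "{\<xi>. \<phi> \<xi> \<noteq> 0}"] unfolding littlewood_paley_def by blast

lemma chi_support: "\<chi>\<^sub>0 \<xi> \<noteq> 0 \<Longrightarrow> norm \<xi> < 4/3"
proof -
  assume "\<chi>\<^sub>0 \<xi> \<noteq> 0"
  then have "\<xi> \<in> closure {\<xi>. \<chi>\<^sub>0 \<xi> \<noteq> 0}" using closure_subset[of "{\<xi>. \<chi>\<^sub>0 \<xi> \<noteq> 0}"] by blast
  then have "\<xi> \<in> ball 0 (4/3)" using LP unfolding littlewood_paley_def by blast
  then show ?thesis by simp
qed

lemma bump_phi: "bump \<phi>" and bump_chi: "bump \<chi>\<^sub>0"
  using LP phi_support chi_support bump_of_support[of \<phi> "8/3"] bump_of_support[of "\<chi>\<^sub>0" "4/3"]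
  unfolding littlewood_paley_def by (blast intro: less_imp_le)+

text \<open>The radii of the annulus have ratio 32/9, which is less than 4, so copies at least two
  dyadic scales apart are disjoint.\<close>

lemma phi_scale_zero:
  assumes "3/4 \<le> norm \<xi>" "norm \<xi> \<le> 8/3" "i \<notin> {-1..1}"
  shows "\<phi> (2 powi (- i) *\<^sub>R \<xi>) = 0"
proof (rule ccontr)
  assume "\<phi> (2 powi (- i) *\<^sub>R \<xi>) \<noteq> 0"
  from phi_support[OF this] have b: "3/4 \<le> 2 powi (- i) * norm \<xi>" "2 powi (- i) * norm \<xi> \<le> 8/3"
    unfolding norm_powi_scale by auto
  show False
  proof (cases "i \<ge> 2")
    case True
    then have "(2::real) powi (- i) \<le> 2 powi (- 2)" by (intro powi_2_le) simp
    then have "2 powi (- i) * norm \<xi> \<le> 1/4 * (8/3)"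
      using assms by (intro mult_mono) auto
    then show False using b by simp
  next
    case False
    then have "(2::real) powi 2 \<le> 2 powi (- i)" using assms(3) by (intro powi_2_le) simp
    then have "4 * (3/4) \<le> 2 powi (- i) * norm \<xi>"
      using assms by (intro mult_mono) auto
    then show False using b by simp
  qed
qed

lemma phi_sum:
  assumes "3/4 \<le> norm \<xi>" "norm \<xi> \<le> 8/3" and I: "finite I" "{-1..1} \<subseteq> I"
  shows "(\<Sum>i\<in>I. \<phi> (2 powi (- i) *\<^sub>R \<xi>)) = 1"
proof -
  have "\<xi> \<noteq> 0" using assms by auto
  then have "((\<lambda>j::int. \<phi> (2 powi (- j) *\<^sub>R \<xi>)) has_sum 1) UNIV"
    using LP unfolding littlewood_paley_def by blast
  moreover have "((\<lambda>j::int. \<phi> (2 powi (- j) *\<^sub>R \<xi>)) has_sum 1) UNIV \<longleftrightarrow>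
      ((\<lambda>j::int. \<phi> (2 powi (- j) *\<^sub>R \<xi>)) has_sum 1) I"
    by (rule has_sum_cong_neutral) (use I(2) phi_scale_zero[OF assms(1,2)] in blast)+
  ultimately have "((\<lambda>j::int. \<phi> (2 powi (- j) *\<^sub>R \<xi>)) has_sum 1) I" by blast
  then show ?thesis using has_sum_finite[OF I(1)] has_sum_unique by blast
qed

text \<open>Its multiplier preserves real fields, and by \<open>eta_sum\<close> it is still a dyadic
  partition of unity, since reflection does not change the annulus.\<close>

definition \<eta> :: "real^3 \<Rightarrow> real" where
  "\<eta> \<xi> = (\<phi> \<xi> + \<phi> (- \<xi>)) / 2"

lemma eta_even: "\<eta> (- \<xi>) = \<eta> \<xi>"
  by (simp add: \<eta>_def)

lemma eta_support: "\<eta> \<xi> \<noteq> 0 \<Longrightarrow> 3/4 \<le> norm \<xi> \<and> norm \<xi> \<le> 8/3"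
  using phi_support[of \<xi>] phi_support[of "- \<xi>"]
  by (cases "\<phi> \<xi> = 0"; cases "\<phi> (- \<xi>) = 0") (simp_all add: \<eta>_def)

lemma bump_eta: "bump \<eta>"
  using bump_reflect_average[OF bump_phi] by (simp add: \<eta>_def[abs_def])

lemma eta_sum:
  assumes "3/4 \<le> norm \<xi>" "norm \<xi> \<le> 8/3" and I: "finite I" "{-1..1} \<subseteq> I"
  shows "(\<Sum>i\<in>I. \<eta> (2 powi (- i) *\<^sub>R \<xi>)) = 1"
proof -
  have "(\<Sum>i\<in>I. \<eta> (2 powi (- i) *\<^sub>R \<xi>)) =
      ((\<Sum>i\<in>I. \<phi> (2 powi (- i) *\<^sub>R \<xi>)) + (\<Sum>i\<in>I. \<phi> (2 powi (- i) *\<^sub>R (- \<xi>)))) / 2"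
    by (simp add: \<eta>_def sum.distrib sum_divide_distrib[symmetric])
  then show ?thesis using phi_sum[OF assms] phi_sum[of "- \<xi>" I] assms by simp
qed

text \<open>A wider cut-off that equals 1 on the annulus carrying \<open>\<phi>\<close> and
  \<open>\<eta>\<close> and still vanishes near 0.\<close>

definition \<omega> :: "real^3 \<Rightarrow> real" where
  "\<omega> \<xi> = (\<Sum>i\<in>{-1..1}. \<eta> (2 powi (- i) *\<^sub>R \<xi>))"

lemma omega_even: "\<omega> (- \<xi>) = \<omega> \<xi>"
  by (simp add: \<omega>_def eta_even)

lemma omega_eq_1: "3/4 \<le> norm \<xi> \<Longrightarrow> norm \<xi> \<le> 8/3 \<Longrightarrow> \<omega> \<xi> = 1"
  unfolding \<omega>_def by (rule eta_sum) auto

lemma omega_support: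
  assumes "\<omega> \<xi> \<noteq> 0"
  shows "3/8 \<le> norm \<xi> \<and> norm \<xi> \<le> 16/3"
proof -
  obtain i :: int where i: "i \<in> {-1..1}" "\<eta> (2 powi (- i) *\<^sub>R \<xi>) \<noteq> 0"
    using assms unfolding \<omega>_def by (meson sum.not_neutral_contains_not_neutral)
  then have b: "3/4 \<le> 2 powi (- i) * norm \<xi>" "2 powi (- i) * norm \<xi> \<le> 8/3"
    using eta_support[OF i(2)] unfolding norm_powi_scale by auto
  have "(2::real) powi (- i) \<le> 2 powi 1" "(2::real) powi (-1) \<le> 2 powi (- i)"
    using i by (intro powi_2_le; simp)+
  then have "2 powi (- i) * norm \<xi> \<le> 2 * norm \<xi>" "1/2 * norm \<xi> \<le> 2 powi (- i) * norm \<xi>"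
    using mult_right_mono[OF _ norm_ge_zero[of \<xi>]] by fastforce+
  then show ?thesis using b by linarith
qed

lemma bump_omega: "bump \<omega>"
  unfolding \<omega>_def by (intro bump_sum bump_scale bump_eta) auto

text \<open>The Leray projector, whose matrix symbol is homogeneous of degree 0, cut off by
  \<open>\<omega>\<close> to a compactly supported smooth symbol.\<close>

definition leray :: "3 \<Rightarrow> 3 \<Rightarrow> real^3 \<Rightarrow> real" where
  "leray a b \<xi> = (if a = b then \<omega> \<xi> else 0) - \<omega> \<xi> * (\<xi> $ a * \<xi> $ b) / (\<xi> \<bullet> \<xi>)"

lemma leray_even: "leray a b (- \<xi>) = leray a b \<xi>"
  by (simp add: leray_def omega_even)

lemma leray_support: "leray a b \<xi> \<noteq> 0 \<Longrightarrow> 3/8 \<le> norm \<xi> \<and> norm \<xi> \<le> 16/3"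
  using omega_support[of \<xi>] by (cases "\<omega> \<xi> = 0") (simp_all add: leray_def split: if_splits)

lemma bump_quotient:
  assumes "bump m" "r > 0" "\<And>\<xi>. m \<xi> \<noteq> 0 \<Longrightarrow> r \<le> norm \<xi>" "smooth f"
  shows "bump (\<lambda>\<xi>. m \<xi> * f \<xi> / (\<xi> \<bullet> \<xi>))"
proof -
  have "smooth (\<lambda>\<xi>. m \<xi> * f \<xi> / (\<xi> \<bullet> \<xi>) ^ 1)"
  proof (rule smooth_divide_norm_power[OF smooth_mult, OF bump_smooth])
    show "m \<xi> * f \<xi> = 0" if "norm \<xi> < r" for \<xi>
      using assms(3)[of \<xi>] that by (cases "m \<xi> = 0") simp_all
  qed (use assms in auto)
  moreover obtain R where "\<forall>x. norm x > R \<longrightarrow> m x = 0" using assms(1) by (auto simp: bump_def)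
  ultimately show ?thesis unfolding bump_def by auto
qed

lemma bump_leray: "bump (leray a b)"
proof -
  have 1: "bump (\<lambda>\<xi>. if a = b then \<omega> \<xi> else 0)"
    using bump_omega bump_zero by (cases "a = b") simp_all
  have "bump (\<lambda>\<xi>. \<omega> \<xi> * (- (\<xi> $ a * \<xi> $ b)) / (\<xi> \<bullet> \<xi>))"
    using omega_support
    by (intro bump_quotient[where r = "3/8"] bump_omega smooth_uminus smooth_mult smooth_coord) auto
  from bump_add[OF 1 this] show ?thesis by (simp add: leray_def[abs_def])
qed

lemma leray_div: "(\<Sum>a\<in>UNIV. leray a b \<xi> * \<xi> $ a) = 0"
proof (cases "\<xi> = 0")
  case False
  have "(\<Sum>a\<in>UNIV. leray a b \<xi> * \<xi> $ a)
      = (\<Sum>a\<in>UNIV. (if a = b then \<omega> \<xi> * \<xi> $ a else 0) - \<omega> \<xi> * \<xi> $ b / (\<xi> \<bullet> \<xi>) * (\<xi> $ a * \<xi> $ a))"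
    by (intro sum.cong) (auto simp: leray_def algebra_simps)
  also have "\<dots> = \<omega> \<xi> * \<xi> $ b - \<omega> \<xi> * \<xi> $ b / (\<xi> \<bullet> \<xi>) * (\<xi> \<bullet> \<xi>)"
    by (simp add: sum_subtractf sum_distrib_left inner_vec_def)
  finally show ?thesis using False by simp
qed simp

text \<open>The offset \<open>i\<close> is relative: dilation by \<open>k\<close> puts the projector
  at scale \<open>k + i\<close> and \<open>\<phi>\<close> at scale \<open>k\<close>. Thus all blocks
  use dilates of finitely many symbols and share their kernel constants.\<close>

definition block_symbol :: "int \<Rightarrow> 3 \<Rightarrow> 3 \<Rightarrow> real^3 \<Rightarrow> real" where
  "block_symbol i a b \<xi> = leray a b (2 powi (- i) *\<^sub>R \<xi>) * \<phi> \<xi>"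

lemma bump_block_symbol: "bump (block_symbol i a b)"
  unfolding block_symbol_def by (intro bump_mult bump_phi smooth_scale bump_smooth bump_leray)

lemma dilate_block_symbol: "dilate k (block_symbol i a b) \<xi> = dilate (k + i) (leray a b) \<xi> * dilate k \<phi> \<xi>"
proof -
  have "(2::real) powi (- i) * 2 powi (- k) = 2 powi (- (k + i))"
    by (subst power_int_add[symmetric]) (auto simp: algebra_simps)
  then show ?thesis by (simp add: dilate_def block_symbol_def)
qed

text \<open>On the annulus of \<open>\<phi>\<close>, an offset of at least 3 gives rescaled radius
  at most 1/3, below 3/8; an offset of at most -3 gives at least 6, above 16/3.\<close>

lemma block_symbol_eq_0:
  assumes "i \<notin> {-2..2}"
  shows "block_symbol i a b \<xi> = 0"
proof (rule ccontr)
  assume "block_symbol i a b \<xi> \<noteq> 0"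
  then have b: "3/4 \<le> norm \<xi>" "norm \<xi> \<le> 8/3" "3/8 \<le> 2 powi (- i) * norm \<xi>" "2 powi (- i) * norm \<xi> \<le> 16/3"
    using phi_support[of \<xi>] leray_support[of a b "2 powi (- i) *\<^sub>R \<xi>"]
    unfolding norm_powi_scale block_symbol_def by auto
  show False
  proof (cases "i \<ge> 3")
    case True
    then have "(2::real) powi (- i) \<le> 2 powi (- 3)" by (intro powi_2_le) simp
    then have "2 powi (- i) * norm \<xi> \<le> 1/8 * (8/3)"
      using b by (intro mult_mono) auto
    then show False using b by simp
  next
    case False
    then have "(2::real) powi 3 \<le> 2 powi (- i)" using assms by (intro powi_2_le) simp
    then have "8 * (3/4) \<le> 2 powi (- i) * norm \<xi>"
      using b by (intro mult_mono) auto
    then show False using b by simp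
  qed
qed

text \<open>The low-frequency ball ends at 4/3 times \<open>2 powi j\<close>, which is at most 1/3
  times \<open>2 powi i\<close>, while the projector symbol begins at 3/8 times
  \<open>2 powi i\<close>.\<close>

lemma dilate_leray_chi:
  assumes "j + 2 \<le> i"
  shows "dilate i (leray a b) \<xi> * dilate j \<chi>\<^sub>0 \<xi> = 0"
proof (rule ccontr)
  assume "dilate i (leray a b) \<xi> * dilate j \<chi>\<^sub>0 \<xi> \<noteq> 0"
  then have b: "3/8 \<le> 2 powi (- i) * norm \<xi>" "2 powi (- j) * norm \<xi> < 4/3"
    using chi_support[of "2 powi (- j) *\<^sub>R \<xi>"] leray_support[of a b "2 powi (- i) *\<^sub>R \<xi>"]
    unfolding norm_powi_scale dilate_def by auto
  have "(2::real) powi (- i) \<le> 2 powi (- 2 + - j)" using assms by (intro powi_2_le) simp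
  also have "\<dots> = 1/4 * 2 powi (- j)" by (subst power_int_add) auto
  finally have "2 powi (- i) * norm \<xi> \<le> 1/4 * 2 powi (- j) * norm \<xi>" by (rule mult_right_mono) simp
  then show False using b by simp
qed

text \<open>Where \<open>\<eta>\<close> at scale \<open>k + i\<close> is nonzero,
  \<open>\<omega>\<close> at that scale is 1 and \<open>leray\<close> is the exact projector,
  independent of \<open>i\<close>. The remaining sum of the \<open>\<eta>\<close> is 1 on the
  annulus of the k-th block.\<close>

lemma block_symbol_partition:
  "(\<Sum>i\<in>{-2..2}. dilate (k + i) \<eta> \<xi> * dilate k (block_symbol i a b) \<xi>)
    = (if a = b then dilate k \<phi> \<xi> else 0) - dilate k \<phi> \<xi> * (\<xi> $ a * \<xi> $ b) / (\<xi> \<bullet> \<xi>)"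
proof (cases "dilate k \<phi> \<xi> = 0")
  case True
  then show ?thesis by (simp add: dilate_block_symbol)
next
  case False
  define \<zeta> where "\<zeta> = 2 powi (- k) *\<^sub>R \<xi>"
  have \<phi>: "dilate k \<phi> \<xi> = \<phi> \<zeta>" by (simp add: dilate_def \<zeta>_def)
  with False have b: "3/4 \<le> norm \<zeta>" "norm \<zeta> \<le> 8/3" using phi_support[of \<zeta>] by auto
  let ?P = "(if a = b then 1 else 0) - (\<xi> $ a * \<xi> $ b) / (\<xi> \<bullet> \<xi>)"
  have "dilate (k + i) \<eta> \<xi> * dilate k (block_symbol i a b) \<xi> = \<eta> (2 powi (- i) *\<^sub>R \<zeta>) * (?P * \<phi> \<zeta>)" for i
  proof -
    define c where "c = (2::real) powi (- (k + i))"
    have c: "c > 0" "c = 2 powi (- i) * 2 powi (- k)"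
      unfolding c_def by (auto simp: power_int_add[symmetric] algebra_simps)
    have sc: "2 powi (- i) *\<^sub>R \<zeta> = c *\<^sub>R \<xi>" by (simp add: \<zeta>_def c(2))
    show ?thesis
    proof (cases "\<eta> (c *\<^sub>R \<xi>) = 0")
      case True
      then show ?thesis by (simp add: sc dilate_def c_def)
    next
      case nz: False
      then have "\<omega> (c *\<^sub>R \<xi>) = 1" using eta_support[OF nz] omega_eq_1 by blast
      then have "leray a b (c *\<^sub>R \<xi>) = ?P"
        using c(1) by (simp add: leray_def)
      moreover have "dilate (k + i) \<eta> \<xi> = \<eta> (c *\<^sub>R \<xi>)" "dilate (k + i) (leray a b) \<xi> = leray a b (c *\<^sub>R \<xi>)"
        unfolding dilate_def c_def by simp_all
      ultimately show ?thesis unfolding dilate_block_symbol \<phi> sc by simp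
    qed
  qed
  then have "(\<Sum>i\<in>{-2..2}. dilate (k + i) \<eta> \<xi> * dilate k (block_symbol i a b) \<xi>)
      = (\<Sum>i\<in>{-2..2}. \<eta> (2 powi (- i) *\<^sub>R \<zeta>)) * (?P * \<phi> \<zeta>)"
    by (simp only: sum_distrib_right)
  also have "(\<Sum>i\<in>{-2..2}. \<eta> (2 powi (- i) *\<^sub>R \<zeta>)) = 1"
    by (rule eta_sum[OF b]) auto
  finally show ?thesis unfolding \<phi> by (simp add: algebra_simps)
qed

end

section \<open>Blocks of the solenoidal decomposition\<close>

lemma ex_kernel_bound_family:
  assumes "finite I" "\<And>i. i \<in> I \<Longrightarrow> bump (m i)"
  shows "\<exists>A>0. \<forall>i\<in>I. \<forall>j. kernel_bound (kern (dilate j (m i))) A (A * (2 powi j) ^ 3)"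
proof -
  have "\<forall>i\<in>I. \<exists>A. \<forall>j. kernel_bound (kern (dilate j (m i))) A (A * (2 powi j) ^ 3)"
    using ex_kernel_bound assms(2) by blast
  then obtain A where A: "\<And>i j. i \<in> I \<Longrightarrow> kernel_bound (kern (dilate j (m i))) (A i) (A i * (2 powi j) ^ 3)"
    by metis
  let ?A = "Max (insert 1 (A ` I))"
  have le: "i \<in> I \<Longrightarrow> A i \<le> ?A" "1 \<le> ?A" for i using assms(1) by auto
  have "kernel_bound (kern (dilate j (m i))) ?A (?A * (2 powi j) ^ 3)" if "i \<in> I" for i j
    by (rule kernel_bound_mono[OF A[OF that] le(1)[OF that]]) (intro mult_right_mono le that, simp)
  then show ?thesis using le(2) by (intro exI[of _ ?A]) auto
qed

lemma kern_real:
  assumes "bump m" "\<And>\<xi>. m (- \<xi>) = m \<xi>"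
  shows "kern m x \<in> \<real>"
  using cnj_kern[OF assms(1), of x] assms(2) by (simp add: Reals_cnj_iff)

lemma conv_real:
  assumes "\<And>x. k x \<in> \<real>" "\<And>x. f x \<in> \<real>"
  shows "conv k f x \<in> \<real>"
proof -
  have "cnj (k (x - y) * f y) = k (x - y) * f y" for y
    using assms by (simp add: Reals_cnj_iff)
  then have "cnj (conv k f x) = conv k f x"
    unfolding conv_def by (simp flip: Bochner_Integration.integral_cnj)
  then show ?thesis by (simp add: Reals_cnj_iff)
qed

lemma lp_component:
  fixes f :: "real^3 \<Rightarrow> complex^3"
  assumes "lp p f F" "p > 0"
  shows "lp p (\<lambda>x. f x $ a) F"
  by (rule lp_norm_le[OF assms(1) vec_measurableD[OF lp_measurable[OF assms(1)]] _ assms(2)])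
    (rule Finite_Cartesian_Product.norm_nth_le)

context littlewood_paley_pair
begin

subsection \<open>Blocks of a divergence free distribution\<close>

text \<open>The k-th block symbol times the identity matrix splits into its Leray part
  \<open>?q\<close> and its gradient part \<open>?r \<xi> * \<xi> $ b\<close>. The gradient part
  tests the divergence of \<open>g\<close> and vanishes; the Leray part factors through
  \<open>\<eta>\<close> at neighbouring scales, where \<open>F\<close> represents
  \<open>g\<close>.\<close>

lemma div_free_block:
  assumes g: "g \<in> tempered" "div_free g"
    and F: "\<And>j b \<theta>. \<theta> \<in> schwartz \<Longrightarrow> g (mult_op (dilate j \<eta>) \<theta>) $ b = (\<integral>x. \<theta> x * F j x $ b \<partial>lborel)"
    and \<theta>: "\<theta> \<in> schwartz"
  shows "g (mult_op (dilate k \<phi>) \<theta>) $ a =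
    (\<Sum>i\<in>{-2..2}. \<Sum>b\<in>UNIV. \<integral>x. mult_op (dilate k (block_symbol i a b)) \<theta> x * F (k + i) x $ b \<partial>lborel)"
proof -
  let ?h = "dilate k \<phi>"
  let ?r = "\<lambda>\<xi>. ?h \<xi> * \<xi> $ a / (\<xi> \<bullet> \<xi>)"
  let ?q = "\<lambda>b \<xi>. (if a = b then ?h \<xi> else 0) - ?h \<xi> * (\<xi> $ a * \<xi> $ b) / (\<xi> \<bullet> \<xi>)"
  let ?n = "\<lambda>i b. dilate k (block_symbol i a b)"
  have bh: "bump ?h" by (rule bump_dilate[OF bump_phi])
  have supp: "(3/4) / 2 powi (- k) \<le> norm \<xi>" if "?h \<xi> \<noteq> 0" for \<xi>
    using phi_support[of "2 powi (- k) *\<^sub>R \<xi>"] that unfolding dilate_def norm_powi_scale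
    by (simp add: divide_le_eq mult.commute)
  have br: "bump ?r"
    by (rule bump_quotient[OF bh _ supp smooth_coord]) simp_all
  have brb: "bump (\<lambda>\<xi>. ?r \<xi> * \<xi> $ b)" for b
    by (rule bump_mult(2)[OF br smooth_coord])
  have bn: "bump (\<lambda>\<xi>. dilate (k + i) \<eta> \<xi> * ?n i b \<xi>)" for i b
    by (rule bump_mult(1)[OF bump_dilate[OF bump_block_symbol] bump_smooth[OF bump_dilate[OF bump_eta]]])
  have part: "?q b = (\<lambda>\<xi>. \<Sum>i\<in>{-2..2}. dilate (k + i) \<eta> \<xi> * ?n i b \<xi>)" for b
    by (simp add: fun_eq_iff block_symbol_partition)
  have bq: "bump (?q b)" for b
    unfolding part by (rule bump_sum) (rule bn)
  have gq: "g (mult_op (?q b) \<theta>) $ b = (\<Sum>i\<in>{-2..2}. \<integral>x. mult_op (?n i b) \<theta> x * F (k + i) x $ b \<partial>lborel)" for b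
  proof -
    have "mult_op (?q b) \<theta> = (\<lambda>x. \<Sum>i\<in>{-2..2}. mult_op (dilate (k + i) \<eta>) (mult_op (?n i b) \<theta>) x)"
      unfolding part mult_op_comp[OF bump_dilate[OF bump_block_symbol] \<theta>]
      by (rule mult_op_sum[OF bn \<theta>])
    then have "g (mult_op (?q b) \<theta>) = (\<Sum>i\<in>{-2..2}. g (mult_op (dilate (k + i) \<eta>) (mult_op (?n i b) \<theta>)))"
      by (simp only:) (intro tempered_sum g mult_op_schwartz bump_dilate bump_eta bump_block_symbol \<theta>)
    then show ?thesis
      by (simp add: F mult_op_schwartz bump_dilate bump_block_symbol \<theta>)
  qed
  have div: "(\<Sum>b\<in>UNIV. g (mult_op (\<lambda>\<xi>. ?r \<xi> * \<xi> $ b) \<theta>) $ b) = 0"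
  proof -
    let ?R = "mult_op ?r \<theta>"
    have R: "?R \<in> schwartz" by (rule mult_op_schwartz[OF br \<theta>])
    \<comment> \<open>The factor \<open>\<xi> $ b\<close> is a derivative of the single Schwartz
      function \<open>?R\<close>, so the sum over \<open>b\<close> is the divergence of
      \<open>g\<close> tested by \<open>?R\<close>.\<close>
    have "mult_op (\<lambda>\<xi>. ?r \<xi> * \<xi> $ b) \<theta> = (\<lambda>x. \<i> * partial_deriv b ?R x)" for b
      by (simp add: partial_deriv_mult_op[OF br \<theta>])
    then have "g (mult_op (\<lambda>\<xi>. ?r \<xi> * \<xi> $ b) \<theta>) $ b = \<i> * g (partial_deriv b ?R) $ b" for b
      by (simp add: tempered_cmult[OF g(1) schwartz_partial_deriv[OF R]])
    then have "(\<Sum>b\<in>UNIV. g (mult_op (\<lambda>\<xi>. ?r \<xi> * \<xi> $ b) \<theta>) $ b) = \<i> * (\<Sum>b\<in>UNIV. g (partial_deriv b ?R) $ b)"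
      by (simp add: sum_distrib_left)
    also have "(\<Sum>b\<in>UNIV. g (partial_deriv b ?R) $ b) = 0"
      using g(2) R unfolding div_free_def dist_div_def by simp
    finally show ?thesis by simp
  qed
  have split: "(if a = b then g (mult_op ?h \<theta>) $ b else 0)
      = g (mult_op (?q b) \<theta>) $ b + g (mult_op (\<lambda>\<xi>. ?r \<xi> * \<xi> $ b) \<theta>) $ b" for b
  proof -
    have "mult_op (\<lambda>\<xi>. if a = b then ?h \<xi> else 0) \<theta> = mult_op (\<lambda>\<xi>. ?q b \<xi> + ?r \<xi> * \<xi> $ b) \<theta>"
      by simp
    also have "\<dots> = (\<lambda>x. mult_op (?q b) \<theta> x + mult_op (\<lambda>\<xi>. ?r \<xi> * \<xi> $ b) \<theta> x)"
      by (rule mult_op_add[OF bq brb \<theta>])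
    finally have "g (mult_op (\<lambda>\<xi>. if a = b then ?h \<xi> else 0) \<theta>)
        = g (mult_op (?q b) \<theta>) + g (mult_op (\<lambda>\<xi>. ?r \<xi> * \<xi> $ b) \<theta>)"
      by (simp only: tempered_add[OF g(1) mult_op_schwartz[OF bq \<theta>] mult_op_schwartz[OF brb \<theta>]])
    moreover have "(if a = b then g (mult_op ?h \<theta>) $ b else 0)
        = g (mult_op (\<lambda>\<xi>. if a = b then ?h \<xi> else 0) \<theta>) $ b"
      by (simp add: mult_op_zero tempered_zero[OF g(1)])
    ultimately show ?thesis by (simp only: vector_add_component)
  qed
  have "g (mult_op ?h \<theta>) $ a = (\<Sum>b\<in>UNIV. if a = b then g (mult_op ?h \<theta>) $ b else 0)" by simp
  also have "\<dots> = (\<Sum>b\<in>UNIV. g (mult_op (?q b) \<theta>) $ b)"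
    unfolding split sum.distrib div by simp
  also have "\<dots> = (\<Sum>i\<in>{-2..2}. \<Sum>b\<in>UNIV. \<integral>x. mult_op (?n i b) \<theta> x * F (k + i) x $ b \<partial>lborel)"
    unfolding gq by (rule sum.swap)
  finally show ?thesis .
qed

subsection \<open>Solenoidal series\<close>

text \<open>Projecting costs only the uniform kernel constant, so the geometric decay of the pieces
  survives. The sum is real because even symbols have real kernels. The constant is chosen before
  \<open>c\<close>, \<open>u\<close> and \<open>J\<close>; this independence is what the final
  bounds rest on.\<close>

lemma solenoidal_series:
  assumes s: "0 < s" "s < 1"
  shows "\<exists>D>0. \<forall>c u J. 0 < c \<longrightarrow> (\<forall>n. lp 2 (u (J + 1 + int n)) (c * s ^ (2 * n))) \<longrightarrow> (\<forall>j x b. u j x $ b \<in> \<real>) \<longrightarrow>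
    (\<exists>G :: 3 \<Rightarrow> real^3 \<Rightarrow> real. (\<forall>a. lp 2 (G a) (D * c)) \<and>
      (\<forall>\<theta>\<in>schwartz. \<forall>a. (\<lambda>n. \<Sum>b\<in>UNIV. \<integral>x. mult_op (dilate (J + 1 + int n) (leray a b)) \<theta> x
          * u (J + 1 + int n) x $ b \<partial>lborel) sums (\<integral>x. \<theta> x * of_real (G a x) \<partial>lborel)))"
proof -
  obtain A where A: "A > 0"
    "\<And>a b j. kernel_bound (kern (dilate j (leray a b))) A (A * (2 powi j) ^ 3)"
    using ex_kernel_bound_family[of "UNIV :: (3 \<times> 3) set" "\<lambda>(a, b). leray a b"] bump_leray by force
  have s2: "s\<^sup>2 < 1" using s by (auto simp: power_less_one_iff)
  show ?thesis
  \<comment> \<open>The 9 is the squared number of components from \<open>lp_sum\<close>; the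
    denominator comes from \<open>lp2_geometric_series\<close>.\<close>
  proof (intro exI[of _ "9 * A / (1 - s\<^sup>2)"] conjI allI impI)
    show "0 < 9 * A / (1 - s\<^sup>2)" using A s2 by simp
    fix c :: real and u :: "int \<Rightarrow> real^3 \<Rightarrow> complex^3" and J :: int
    assume c: "0 < c" and u: "\<forall>n. lp 2 (u (J + 1 + int n)) (c * s ^ (2 * n))" and ur: "\<forall>j x b. u j x $ b \<in> \<real>"
    let ?j = "\<lambda>n. J + 1 + int n"
    let ?c = "\<lambda>n a b. conv (kern (dilate (?j n) (leray a b))) (\<lambda>y. u (?j n) y $ b)"
    have ub: "lp 2 (\<lambda>y. u (?j n) y $ b) (c * s ^ (2 * n))" for n b
      using u lp_component[of 2] by simp
    have lc: "lp 2 (?c n a b) (A * (c * s ^ (2 * n)))" for n a b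
      by (rule lp_conv[OF _ A(2) ub]) simp
    have cr: "?c n a b x \<in> \<real>" for n a b x
      using ur leray_even
      by (intro conv_real kern_real bump_dilate bump_leray) (auto simp: dilate_def)
    define h where "h a n x = (\<Sum>b\<in>UNIV. Re (?c n a b x))" for a n x
    have hc: "of_real (h a n x) = (\<Sum>b\<in>UNIV. ?c n a b x)" for a n x
      unfolding h_def of_real_sum by (intro sum.cong refl of_real_Re cr)
    have hl: "lp 2 (h a n) (9 * A * c * s ^ (2 * n))" for a n
    proof -
      have [measurable]: "?c n a b \<in> borel_measurable borel" for b using lc by (rule lp_measurable)
      have "lp 2 (h a n) ((real (card (UNIV :: 3 set)))\<^sup>2 * (A * (c * s ^ (2 * n))))"
      proof (rule lp_sum[where f = "\<lambda>b. ?c n a b"])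
        show "h a n \<in> borel_measurable borel" unfolding h_def by measurable
        show "norm (h a n x) \<le> (\<Sum>b\<in>UNIV. norm (?c n a b x))" for x
          unfolding h_def by (rule order_trans[OF norm_sum sum_mono]) (simp add: abs_Re_le_cmod)
      qed (use lc in auto)
      then show ?thesis by (simp add: mult.assoc)
    qed
    let ?G = "\<lambda>a x. \<Sum>n. h a n x"
    have pos: "0 < 9 * A * c" using A c by simp
    show "\<exists>G. (\<forall>a. lp 2 (G a) (9 * A / (1 - s\<^sup>2) * c)) \<and> (\<forall>\<theta>\<in>schwartz. \<forall>a.
        (\<lambda>n. \<Sum>b\<in>UNIV. \<integral>x. mult_op (dilate (?j n) (leray a b)) \<theta> x * u (?j n) x $ b \<partial>lborel)
          sums (\<integral>x. \<theta> x * of_real (G a x) \<partial>lborel))"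
    proof (intro exI[of _ ?G] conjI allI ballI)
      show "lp 2 (?G a) (9 * A / (1 - s\<^sup>2) * c)" for a using lp2_geometric_series(1)[OF s pos hl[where a = a]] by simp
      fix \<theta> a assume \<theta>: "\<theta> \<in> schwartz"
      have "(\<integral>x. \<theta> x * of_real (h a n x) \<partial>lborel)
          = (\<Sum>b\<in>UNIV. \<integral>x. mult_op (dilate (?j n) (leray a b)) \<theta> x * u (?j n) x $ b \<partial>lborel)" for n
      proof -
        note * = integral_conv_mult_op[OF _ bump_dilate[OF bump_leray] ub \<theta>]
        have "(\<integral>x. \<theta> x * of_real (h a n x) \<partial>lborel) = (\<integral>x. (\<Sum>b\<in>UNIV. \<theta> x * ?c n a b x) \<partial>lborel)"
          unfolding hc by (simp add: sum_distrib_left)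
        also have "\<dots> = (\<Sum>b\<in>UNIV. \<integral>x. \<theta> x * ?c n a b x \<partial>lborel)"
          by (rule Bochner_Integration.integral_sum) (rule *(1), simp)
        also have "\<dots> = (\<Sum>b\<in>UNIV. \<integral>x. mult_op (dilate (?j n) (leray a b)) \<theta> x * u (?j n) x $ b \<partial>lborel)"
          by (intro sum.cong refl *(2)) simp
        finally show ?thesis .
      qed
      then show "(\<lambda>n. \<Sum>b\<in>UNIV. \<integral>x. mult_op (dilate (?j n) (leray a b)) \<theta> x * u (?j n) x $ b \<partial>lborel)
          sums (\<integral>x. \<theta> x * of_real (?G a x) \<partial>lborel)"
        using lp2_geometric_series(2)[OF s pos hl[where a = a] \<theta>] by simp
    qed
  qed
qed

context
  fixes u :: "int \<Rightarrow> real^3 \<Rightarrow> complex^3" and J :: int and T :: dist3 and F :: "int \<Rightarrow> real"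
  assumes u: "\<And>j. lp 2 (u j) (F j)"
    and u0: "\<And>j x. j \<le> J \<Longrightarrow> u j x = 0"
    and T: "\<And>\<theta> a. \<theta> \<in> schwartz \<Longrightarrow> (\<lambda>n. \<Sum>b\<in>UNIV. \<integral>x. mult_op (dilate (J + 1 + int n) (leray a b)) \<theta> x
          * u (J + 1 + int n) x $ b \<partial>lborel) sums (T \<theta> $ a)"
begin

text \<open>Each term vanishes separately: a derivative of the test function multiplies the symbol
  by a coordinate, and contracting \<open>leray\<close> with the frequency gives 0.\<close>

lemma series_div_free: "div_free T"
  unfolding div_free_def dist_div_def
proof
  fix \<theta> assume \<theta>: "\<theta> \<in> schwartz"
  let ?j = "\<lambda>n. J + 1 + int n"
  let ?t = "\<lambda>n a b x. mult_op (dilate (?j n) (leray a b)) (partial_deriv a \<theta>) x * u (?j n) x $ b"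
  have I: "integrable lborel (?t n a b)" for n a b
    by (rule lp_schwartz_integrable[of 2 _ "F (?j n)"])
      (use lp_component[OF u] in \<open>auto intro!: mult_op_schwartz bump_dilate bump_leray schwartz_partial_deriv \<theta>\<close>)
  have sym: "(\<Sum>a\<in>UNIV. dilate j (leray a b) \<xi> * \<xi> $ a) = 0" for j b \<xi>
  proof -
    have "(\<Sum>a\<in>UNIV. leray a b (2 powi (- j) *\<^sub>R \<xi>) * (2 powi (- j) *\<^sub>R \<xi>) $ a) = 0" by (rule leray_div)
    then have "2 powi (- j) * (\<Sum>a\<in>UNIV. dilate j (leray a b) \<xi> * \<xi> $ a) = 0"
      by (simp add: dilate_def sum_distrib_left mult.left_commute)
    then show ?thesis by simp
  qed
  have z: "(\<Sum>a\<in>UNIV. mult_op (dilate j (leray a b)) (partial_deriv a \<theta>) x) = 0" for j b x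
  proof -
    have "(\<Sum>a\<in>UNIV. mult_op (dilate j (leray a b)) (partial_deriv a \<theta>) x)
        = - \<i> * (\<Sum>a\<in>UNIV. mult_op (\<lambda>\<xi>. dilate j (leray a b) \<xi> * \<xi> $ a) \<theta> x)"
      by (simp add: mult_op_partial_deriv[OF \<theta>] sum_distrib_left)
    also have "(\<Sum>a\<in>UNIV. mult_op (\<lambda>\<xi>. dilate j (leray a b) \<xi> * \<xi> $ a) \<theta> x)
        = mult_op (\<lambda>\<xi>. \<Sum>a\<in>UNIV. dilate j (leray a b) \<xi> * \<xi> $ a) \<theta> x"
      unfolding mult_op_sum[OF bump_mult(2)[OF bump_dilate[OF bump_leray] smooth_coord] \<theta>] ..
    finally show ?thesis by (simp add: sym mult_op_zero)
  qed
  have "(\<lambda>n. \<Sum>a\<in>UNIV. \<Sum>b\<in>UNIV. \<integral>x. ?t n a b x \<partial>lborel) sums (\<Sum>a\<in>UNIV. T (partial_deriv a \<theta>) $ a)"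
    by (intro sums_sum T schwartz_partial_deriv \<theta>)
  moreover have "(\<Sum>a\<in>UNIV. \<Sum>b\<in>UNIV. \<integral>x. ?t n a b x \<partial>lborel) = 0" for n
  proof -
    have "(\<Sum>a\<in>UNIV. \<Sum>b\<in>UNIV. \<integral>x. ?t n a b x \<partial>lborel) = (\<Sum>b\<in>UNIV. \<integral>x. (\<Sum>a\<in>UNIV. ?t n a b x) \<partial>lborel)"
      using I by (subst sum.swap) (simp add: Bochner_Integration.integral_sum)
    also have "\<dots> = 0" by (simp add: z sum_distrib_right[symmetric])
    finally show ?thesis .
  qed
  ultimately show "- (\<Sum>i\<in>UNIV. T (partial_deriv i \<theta>) $ i) = 0"
    using sums_unique2[OF _ sums_zero] by simp
qed

text \<open>The series starts at scale \<open>J + 1\<close>, so \<open>j \<le> J - 1\<close> leaves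
  the two scales that \<open>dilate_leray_chi\<close> asks for.\<close>

lemma series_low_frequency:
  assumes j: "j \<le> J - 1" and \<theta>: "\<theta> \<in> schwartz"
  shows "T (mult_op (dilate j \<chi>\<^sub>0) \<theta>) = 0"
proof -
  have "mult_op (dilate (J + 1 + int n) (leray a b)) (mult_op (dilate j \<chi>\<^sub>0) \<theta>) = (\<lambda>x. 0)" for n a b
  proof -
    have "(\<lambda>\<xi>. dilate (J + 1 + int n) (leray a b) \<xi> * dilate j \<chi>\<^sub>0 \<xi>) = (\<lambda>\<xi>. 0)"
      using j by (auto intro!: dilate_leray_chi)
    then show ?thesis
      by (simp only: mult_op_comp[OF bump_dilate[OF bump_chi] \<theta>] mult_op_zero)
  qed
  then have "(\<lambda>n. 0) sums (T (mult_op (dilate j \<chi>\<^sub>0) \<theta>) $ a)" for a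
    using T[OF mult_op_schwartz[OF bump_dilate[OF bump_chi] \<theta>], of a j] by simp
  then show ?thesis using sums_unique2[OF _ sums_zero] by (auto simp: vec_eq_iff)
qed

text \<open>Testing against the k-th block leaves only offsets between -2 and 2, so the series is a
  finite sum. The result has the form of \<open>div_free_block\<close>, with \<open>u\<close> in
  place of \<open>F\<close>.\<close>

lemma series_block:
  assumes \<theta>: "\<theta> \<in> schwartz"
  shows "T (mult_op (dilate k \<phi>) \<theta>) $ a =
    (\<Sum>i\<in>{-2..2}. \<Sum>b\<in>UNIV. \<integral>x. mult_op (dilate k (block_symbol i a b)) \<theta> x * u (k + i) x $ b \<partial>lborel)"
proof -
  let ?f = "\<lambda>i. \<Sum>b\<in>UNIV. \<integral>x. mult_op (dilate k (block_symbol i a b)) \<theta> x * u (k + i) x $ b \<partial>lborel"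
  let ?i = "\<lambda>n. J + 1 + int n - k"
  have S: "(\<lambda>n. ?f (?i n)) sums (T (mult_op (dilate k \<phi>) \<theta>) $ a)"
  proof -
    have "mult_op (dilate (J + 1 + int n) (leray a b)) (mult_op (dilate k \<phi>) \<theta>)
        = mult_op (dilate k (block_symbol (?i n) a b)) \<theta>" for n b
    proof -
      have "k + ?i n = J + 1 + int n" by simp
      then have "dilate k (block_symbol (?i n) a b) = (\<lambda>\<xi>. dilate (J + 1 + int n) (leray a b) \<xi> * dilate k \<phi> \<xi>)"
        by (intro ext) (simp only: dilate_block_symbol)
      then show ?thesis by (simp only: mult_op_comp[OF bump_dilate[OF bump_phi] \<theta>])
    qed
    moreover have "k + ?i n = J + 1 + int n" for n by simp
    ultimately show ?thesis
      using T[OF mult_op_schwartz[OF bump_dilate[OF bump_phi] \<theta>], of a k] by (simp only:)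
  qed
  have f0: "?f i = 0" if "i \<notin> {-2..2}" for i
  proof -
    have "dilate k (block_symbol i a b) = (\<lambda>\<xi>. 0)" for b
      unfolding dilate_def using block_symbol_eq_0[OF that] by simp
    then show ?thesis by (simp add: mult_op_zero)
  qed
  define N where "N = {n. ?i n \<in> {-2..2}}"
  have "N \<subseteq> {..nat (k + 2 - J)}" unfolding N_def by auto
  then have fin: "finite N" using finite_subset by blast
  have "?f (?i n) = 0" if "n \<notin> N" for n
    using f0[of "?i n"] that unfolding N_def by blast
  then have "(\<lambda>n. ?f (?i n)) sums (\<Sum>n\<in>N. ?f (?i n))"
    by (rule sums_finite[OF fin])
  then have "T (mult_op (dilate k \<phi>) \<theta>) $ a = (\<Sum>n\<in>N. ?f (?i n))"
    using S sums_unique2 by blast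
  also have "\<dots> = (\<Sum>i\<in>?i ` N. ?f i)"
    by (subst sum.reindex) (auto simp: inj_on_def)
  also have "\<dots> = (\<Sum>i\<in>{-2..2}. ?f i)"
  proof (rule sum.mono_neutral_left)
    show "\<forall>i\<in>{-2..2} - ?i ` N. ?f i = 0"
    proof
      fix i assume i: "i \<in> {-2..2} - ?i ` N"
      \<comment> \<open>Offsets that the series does not reach belong to scales up to
        \<open>J\<close>, where \<open>u\<close> vanishes, so they may be added to the sum.\<close>
      have "k + i \<le> J"
      proof (rule ccontr)
        assume "\<not> k + i \<le> J"
        then have "i = ?i (nat (k + i - J - 1))" by simp
        moreover from this have "nat (k + i - J - 1) \<in> N" using i by (simp add: N_def)
        ultimately show False using i by blast
      qed
      then show "?f i = 0" by (simp add: u0)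
    qed
  qed (auto simp: N_def)
  finally show ?thesis .
qed

end

subsection \<open>Estimates of blocks\<close>

text \<open>The function that represents the common right-hand side of \<open>div_free_block\<close>
  and \<open>series_block\<close>; its linearity in \<open>w\<close> lets the two be
  subtracted.\<close>

definition block :: "int \<Rightarrow> (int \<Rightarrow> real^3 \<Rightarrow> complex^3) \<Rightarrow> real^3 \<Rightarrow> complex^3" where
  "block k w x = (\<chi> a. \<Sum>i\<in>{-2..2}. \<Sum>b\<in>UNIV.
     conv (kern (dilate k (block_symbol i a b))) (\<lambda>y. w (k + i) y $ b) x)"

lemma block_measurable:
  assumes "\<And>j. w j \<in> borel_measurable borel"
  shows "block k w \<in> borel_measurable borel"
proof (rule vec_measurableI)
  have [measurable]: "(\<lambda>y. w j y $ b) \<in> borel_measurable borel" for j b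
    using assms by (rule vec_measurableD)
  have [measurable]: "kern (dilate k (block_symbol i a b)) \<in> borel_measurable borel" for i a b
    by (intro schwartz_measurable kern_schwartz bump_dilate bump_block_symbol)
  show "(\<lambda>x. block k w x $ a) \<in> borel_measurable borel" for a
    by (simp add: block_def)
qed

lemma represents_block:
  assumes p: "p > 1" and w: "\<And>j. lp p (w j) (F j)"
    and T: "\<And>\<theta> a. \<theta> \<in> schwartz \<Longrightarrow> T (mult_op (dilate k \<phi>) \<theta>) $ a =
      (\<Sum>i\<in>{-2..2}. \<Sum>b\<in>UNIV. \<integral>x. mult_op (dilate k (block_symbol i a b)) \<theta> x * w (k + i) x $ b \<partial>lborel)"
  shows "represents (block k w) (dyadic_cutoff \<phi> k T)"
proof (rule representsI)
  show "block k w \<in> borel_measurable borel"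
    using w by (intro block_measurable lp_measurable)
  fix \<theta> a assume \<theta>: "\<theta> \<in> schwartz"
  have wb: "lp p (\<lambda>y. w j y $ b) (F j)" for j b using w p by (intro lp_component) auto
  note * = integral_conv_mult_op[OF p bump_dilate[OF bump_block_symbol] wb \<theta>]
  have eq: "\<theta> x * block k w x $ a = (\<Sum>i\<in>{-2..2}. \<Sum>b\<in>UNIV.
     \<theta> x * conv (kern (dilate k (block_symbol i a b))) (\<lambda>y. w (k + i) y $ b) x)" for x
    by (simp add: block_def sum_distrib_left)
  show "integrable lborel (\<lambda>x. \<theta> x * block k w x $ a)"
    unfolding eq by (intro Bochner_Integration.integrable_sum *)
  show "dyadic_cutoff \<phi> k T \<theta> $ a = (\<integral>x. \<theta> x * block k w x $ a \<partial>lborel)"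
    unfolding dyadic_cutoff_eq T[OF \<theta>] eq
    by (subst Bochner_Integration.integral_sum, intro Bochner_Integration.integrable_sum *,
        intro sum.cong refl, subst Bochner_Integration.integral_sum, rule *, intro sum.cong refl *(2)[symmetric])
qed

text \<open>One constant serves for all exponents and all \<open>k\<close>: the kernel constants are
  uniform in the scale, and the loss of integrability appears only in the explicit Bernstein
  factor.\<close>

lemma block_estimate:
  "\<exists>A\<ge>1. \<forall>p q k w F. p > 1 \<longrightarrow> q \<ge> p \<longrightarrow> (\<forall>j. w j \<in> borel_measurable borel) \<longrightarrow>
      (\<forall>i\<in>{-2..2}. lp p (w (k + i)) F) \<longrightarrow>
      lp q (block k w) (A * F * 2 powr (3 * of_int k * (1 / p - 1 / q)))"
proof -
  obtain A where A: "A > 0" "\<And>i a b j. i \<in> {-2..2} \<Longrightarrow>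
      kernel_bound (kern (dilate j (block_symbol i a b))) A (A * (2 powi j) ^ 3)"
    using ex_kernel_bound_family[of "{-2..2} \<times> (UNIV :: (3 \<times> 3) set)" "\<lambda>(i, a, b). block_symbol i a b"]
      bump_block_symbol by force
  let ?I = "(UNIV :: 3 set) \<times> {-2..2::int} \<times> (UNIV :: 3 set)"
  let ?c = "\<lambda>k w (a, i, b). conv (kern (dilate k (block_symbol i a b))) (\<lambda>y. w (k + i) y $ b)"
  \<comment> \<open>The factor of \<open>lp_sum\<close> for 3 components, 5 offsets and 3 summation
    indices.\<close>
  define c where "c = (real (card ?I))\<^sup>2"
  have comb: "lp q (block k w) (c * F)"
    if "q \<ge> 1" "\<And>j. w j \<in> borel_measurable borel" "\<And>a i b. i \<in> {-2..2} \<Longrightarrow> lp q (?c k w (a, i, b)) F"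
    for q k F and w :: "int \<Rightarrow> real^3 \<Rightarrow> complex^3"
    unfolding c_def
  proof (rule lp_sum[where f = "?c k w"])
    show "block k w \<in> borel_measurable borel" using that(2) by (rule block_measurable)
    fix x
    have "norm (block k w x) \<le> (\<Sum>a\<in>UNIV. norm (block k w x $ a))" by (rule norm_le_sum_components)
    also have "\<dots> \<le> (\<Sum>a\<in>UNIV. \<Sum>i\<in>{-2..2}. \<Sum>b\<in>UNIV. norm (?c k w (a, i, b) x))"
      by (intro sum_mono) (simp add: block_def order_trans[OF norm_sum sum_mono[OF norm_sum]])
    also have "\<dots> = (\<Sum>z\<in>?I. norm (?c k w z x))"
      by (simp add: sum.cartesian_product split_beta)
    finally show "norm (block k w x) \<le> (\<Sum>z\<in>?I. norm (?c k w z x))" .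
    fix z :: "3 \<times> int \<times> 3" assume z: "z \<in> ?I"
    obtain a i b where "z = (a, i, b)" by (cases z) auto
    then show "lp q (?c k w z) F" using that(3)[of i a b] z by (simp only:) simp
  qed (use that(1) in auto)
  define B where "B = max 1 (c * A)"
  have B: "B \<ge> 1" "c * A \<le> B" by (auto simp: B_def)
  show ?thesis
  proof (intro exI[of _ B] conjI allI impI)
    show "B \<ge> 1" by (rule B)
    fix p q F :: real and k :: int and w :: "int \<Rightarrow> real^3 \<Rightarrow> complex^3"
    assume p: "p > 1" and q: "q \<ge> p" and m: "\<forall>j. w j \<in> borel_measurable borel"
      and w: "\<forall>i\<in>{-2..2}. lp p (w (k + i)) F"
    have F: "F > 0" using lp_pos[OF bspec[OF w, of 0]] by simp
    have wb: "lp p (\<lambda>y. w (k + i) y $ b) F" if "i \<in> {-2..2}" for i b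
      by (rule lp_component[OF bspec[OF w that]]) (use p in simp)
    let ?e = "2 powr (3 * of_int k * (1 / p - 1 / q))"
    have "lp q (block k w) (c * (A * F * ?e))"
    proof (rule comb[OF _ spec[OF m]])
      show "lp q (?c k w (a, i, b)) (A * F * ?e)" if "i \<in> {-2..2}" for a i b
        using bernstein[OF p q A(2)[OF that] wb[OF that]] by simp
    qed (use p q in simp)
    moreover have "c * (A * F * ?e) \<le> B * F * ?e"
      using B F by (simp add: mult.assoc[symmetric] mult_right_mono)
    ultimately show "lp q (block k w) (B * F * ?e)" by (rule lp_mono) (use p q in simp)
  qed
qed

end

section \<open>Truncation and summation over dyadic blocks\<close>

text \<open>Above the height \<open>l\<close> the factor \<open>norm (f x) powr (2 - p)\<close> has
  a nonpositive exponent and is at most \<open>l powr (2 - p)\<close>.\<close>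

lemma lp_truncate_high:
  fixes f :: "real^3 \<Rightarrow> complex^3"
  assumes f: "lp p f F" and l: "l > 0" and p: "p \<ge> 2"
  shows "lp 2 (\<lambda>x. if norm (f x) > l then f x else 0) (l powr ((2 - p) / 2) * F powr (p / 2))"
proof -
  have [measurable]: "f \<in> borel_measurable borel" using f by (rule lp_measurable)
  have F: "F > 0" using f by (rule lp_pos)
  have "(\<integral>\<^sup>+x. ennreal (norm (if norm (f x) > l then f x else 0) powr 2) \<partial>lborel)
      \<le> (\<integral>\<^sup>+x. ennreal (l powr (2 - p)) * ennreal (norm (f x) powr p) \<partial>lborel)"
  proof (rule nn_integral_mono)
    fix x
    have "norm (f x) powr 2 \<le> l powr (2 - p) * norm (f x) powr p" if "norm (f x) > l"
    proof -
      have "norm (f x) powr 2 = norm (f x) powr (2 - p) * norm (f x) powr p"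
        by (simp add: powr_add[symmetric])
      also have "\<dots> \<le> l powr (2 - p) * norm (f x) powr p"
        using that l p by (intro mult_right_mono powr_mono2') auto
      finally show ?thesis .
    qed
    then show "ennreal (norm (if norm (f x) > l then f x else 0) powr 2)
        \<le> ennreal (l powr (2 - p)) * ennreal (norm (f x) powr p)"
      by (simp add: ennreal_mult'[symmetric] ennreal_leI)
  qed
  also have "\<dots> = ennreal (l powr (2 - p)) * (\<integral>\<^sup>+x. ennreal (norm (f x) powr p) \<partial>lborel)"
    by (rule nn_integral_cmult) measurable
  also have "\<dots> \<le> ennreal (l powr (2 - p)) * ennreal (F powr p)"
    using f by (intro mult_left_mono) (auto simp: lp_def)
  also have "\<dots> = ennreal ((l powr ((2 - p) / 2) * F powr (p / 2)) powr 2)"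
  proof -
    have "(l powr ((2 - p) / 2)) powr 2 = l powr (2 - p)"
      unfolding powr_powr by (rule arg_cong[where f = "\<lambda>e. l powr e"]) simp
    then show ?thesis using l F by (simp add: ennreal_mult'[symmetric] powr_mult powr_powr)
  qed
  finally show ?thesis using l F by (simp add: lp_def)
qed

text \<open>Counterpart of \<open>lp_truncate_high\<close>: below the height the surplus exponent
  \<open>q - p\<close> is nonnegative, so the surplus power is bounded by that of
  \<open>l\<close>.\<close>

lemma lp_truncate_low:
  fixes f :: "real^3 \<Rightarrow> complex^3"
  assumes f: "lp p f F" and l: "l > 0" and p: "p > 0" and q: "q \<ge> p"
  shows "lp q (\<lambda>x. if norm (f x) > l then 0 else f x) (l powr ((q - p) / q) * F powr (p / q))"
proof -
  have [measurable]: "f \<in> borel_measurable borel" using f by (rule lp_measurable)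
  have F: "F > 0" using f by (rule lp_pos)
  have "(\<integral>\<^sup>+x. ennreal (norm (if norm (f x) > l then 0 else f x) powr q) \<partial>lborel)
      \<le> (\<integral>\<^sup>+x. ennreal (l powr (q - p)) * ennreal (norm (f x) powr p) \<partial>lborel)"
  proof (rule nn_integral_mono)
    fix x
    have "norm (f x) powr q \<le> l powr (q - p) * norm (f x) powr p" if "\<not> norm (f x) > l"
    proof -
      have "norm (f x) powr q = norm (f x) powr (q - p) * norm (f x) powr p"
        by (simp add: powr_add[symmetric])
      also have "\<dots> \<le> l powr (q - p) * norm (f x) powr p"
        using that l q by (intro mult_right_mono powr_mono2) auto
      finally show ?thesis .
    qed
    then show "ennreal (norm (if norm (f x) > l then 0 else f x) powr q)
        \<le> ennreal (l powr (q - p)) * ennreal (norm (f x) powr p)"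
      by (simp add: ennreal_mult'[symmetric] ennreal_leI)
  qed
  also have "\<dots> = ennreal (l powr (q - p)) * (\<integral>\<^sup>+x. ennreal (norm (f x) powr p) \<partial>lborel)"
    by (rule nn_integral_cmult) measurable
  also have "\<dots> \<le> ennreal (l powr (q - p)) * ennreal (F powr p)"
    using f by (intro mult_left_mono) (auto simp: lp_def)
  also have "\<dots> = ennreal ((l powr ((q - p) / q) * F powr (p / q)) powr q)"
    using l F p q by (simp add: ennreal_mult'[symmetric] powr_mult powr_powr)
  finally show ?thesis using l F by (simp add: lp_def)
qed

lemma sum_geometric_int:
  fixes r :: real
  assumes r: "0 \<le> r" "r < 1" and fin: "finite S"
  shows "(\<Sum>k\<in>S. r ^ nat \<bar>k - J\<bar>) \<le> 2 / (1 - r)"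
proof -
  have half: "(\<Sum>k\<in>S'. r ^ nat \<bar>k - J\<bar>) \<le> 1 / (1 - r)"
    if "finite S'" "inj_on (\<lambda>k. nat \<bar>k - J\<bar>) S'" for S'
  proof -
    have "(\<Sum>k\<in>S'. r ^ nat \<bar>k - J\<bar>) = (\<Sum>n\<in>(\<lambda>k. nat \<bar>k - J\<bar>) ` S'. r ^ n)"
      using that(2) by (simp add: sum.reindex)
    also have "\<dots> \<le> (\<Sum>n. r ^ n)"
      using that(1) r by (intro sum_le_suminf summable_geometric) auto
    also have "\<dots> = 1 / (1 - r)" using r by (intro suminf_geometric) auto
    finally show ?thesis .
  qed
  have "(\<Sum>k\<in>S. r ^ nat \<bar>k - J\<bar>)
      = (\<Sum>k\<in>S \<inter> {J..}. r ^ nat \<bar>k - J\<bar>) + (\<Sum>k\<in>S - {J..}. r ^ nat \<bar>k - J\<bar>)"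
    by (rule sum.Int_Diff[OF fin])
  also have "\<dots> \<le> 1 / (1 - r) + 1 / (1 - r)"
    using fin by (intro add_mono half) (auto simp: inj_on_def)
  finally show ?thesis by simp
qed

text \<open>Decay in the distance from one distinguished scale \<open>J\<close> turns blockwise
  bounds into a summable series; the resulting constant does not depend on \<open>J\<close>.\<close>

lemma besov_norm_le_geometric:
  assumes q: "q > 0" and X: "X > 0" and d: "d > 0"
    and le: "\<And>k. dist_Lp_norm (ennreal q) (dyadic_cutoff \<phi> k T)
        \<le> ennreal (X * 2 powr (- of_int k * \<sigma>) * 2 powr (- of_int \<bar>k - J\<bar> * d))"
  shows "besov_norm \<phi> \<sigma> (ennreal q) (ennreal q) T \<le> ennreal (X * (2 / (1 - 2 powr (- q * d))) powr (1 / q))"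
proof -
  define r where "r = 2 powr (- q * d)"
  have r: "0 \<le> r" "r < 1" unfolding r_def using q d by (auto intro!: powr_less_one)
  let ?a = "\<lambda>k. ennreal (2 powr (of_int k * \<sigma> * q)) * epowr (dist_Lp_norm (ennreal q) (dyadic_cutoff \<phi> k T)) q"
  have a: "?a k \<le> ennreal (X powr q * r ^ nat \<bar>k - J\<bar>)" for k
  proof -
    let ?b = "X * 2 powr (- of_int k * \<sigma>) * 2 powr (- of_int \<bar>k - J\<bar> * d)"
    have "?a k \<le> ennreal (2 powr (of_int k * \<sigma> * q)) * epowr (ennreal ?b) q"
      using q by (intro mult_left_mono epowr_mono le) auto
    also have "\<dots> = ennreal (2 powr (of_int k * \<sigma> * q) * ?b powr q)"
      using X by (subst epowr_ennreal) (simp_all add: ennreal_mult')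
    also have "2 powr (of_int k * \<sigma> * q) * ?b powr q = X powr q * r ^ nat \<bar>k - J\<bar>"
    proof -
      have "r ^ nat \<bar>k - J\<bar> = r powr of_int \<bar>k - J\<bar>"
        by (simp add: powr_realpow[symmetric] r_def)
      also have "\<dots> = 2 powr (- of_int \<bar>k - J\<bar> * d * q)"
        by (simp add: r_def powr_powr mult_ac)
      finally have 1: "r ^ nat \<bar>k - J\<bar> = 2 powr (- of_int \<bar>k - J\<bar> * d * q)" .
      have "?b powr q = X powr q * 2 powr (- of_int k * \<sigma> * q) * 2 powr (- of_int \<bar>k - J\<bar> * d * q)"
        using X by (simp add: powr_mult powr_powr)
      moreover have "2 powr (of_int k * \<sigma> * q) * 2 powr (- of_int k * \<sigma> * q) = 1"
        by (simp add: powr_add[symmetric])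
      ultimately show ?thesis unfolding 1 by (simp add: mult.assoc mult.left_commute)
    qed
    finally show ?thesis .
  qed
  have "(\<Sum>\<^sub>\<infinity>k. ?a k) \<le> ennreal (X powr q * (2 / (1 - r)))"
  proof (rule infsum_le_finite_sums)
    show "?a summable_on UNIV" by (intro nonneg_summable_on_complete) simp
    fix S :: "int set" assume S: "finite S"
    have "(\<Sum>k\<in>S. ?a k) \<le> (\<Sum>k\<in>S. ennreal (X powr q * r ^ nat \<bar>k - J\<bar>))" by (intro sum_mono a)
    also have "\<dots> = ennreal (X powr q * (\<Sum>k\<in>S. r ^ nat \<bar>k - J\<bar>))"
      using r by (subst sum_ennreal) (auto simp: sum_distrib_left)
    also have "\<dots> \<le> ennreal (X powr q * (2 / (1 - r)))"
      by (intro ennreal_leI mult_left_mono sum_geometric_int r S) auto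
    finally show "(\<Sum>k\<in>S. ?a k) \<le> ennreal (X powr q * (2 / (1 - r)))" .
  qed
  then have "epowr (\<Sum>\<^sub>\<infinity>k. ?a k) (1 / q) \<le> epowr (ennreal (X powr q * (2 / (1 - r)))) (1 / q)"
    using q by (intro epowr_mono) auto
  also have "\<dots> = ennreal (X * (2 / (1 - r)) powr (1 / q))"
    using q X r by (subst epowr_ennreal) (auto simp: powr_mult powr_powr powr_divide)
  finally show ?thesis using q by (simp add: besov_norm_def r_def)
qed

lemma besov_norm_infinity_le:
  assumes "X > 0" "\<And>k. dist_Lp_norm p (dyadic_cutoff \<phi> k T) \<le> ennreal (X * 2 powr (- of_int k * \<sigma>))"
  shows "besov_norm \<phi> \<sigma> p \<infinity> T \<le> ennreal X"
proof -
  have "ennreal (2 powr (of_int k * \<sigma>)) * dist_Lp_norm p (dyadic_cutoff \<phi> k T) \<le> ennreal X" for k :: int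
  proof -
    have "ennreal (2 powr (of_int k * \<sigma>)) * dist_Lp_norm p (dyadic_cutoff \<phi> k T)
        \<le> ennreal (2 powr (of_int k * \<sigma>)) * ennreal (X * 2 powr (- of_int k * \<sigma>))"
      by (intro mult_left_mono assms) simp
    also have "\<dots> = ennreal (X * (2 powr (of_int k * \<sigma>) * 2 powr (- of_int k * \<sigma>)))"
      by (simp add: ennreal_mult'[symmetric] mult_ac)
    also have "2 powr (of_int k * \<sigma>) * 2 powr (- of_int k * \<sigma>) = 1" by (simp add: powr_add[symmetric])
    finally show ?thesis by simp
  qed
  then show ?thesis by (simp add: besov_norm_def SUP_le_iff)
qed

lemma besov_norm_infinityE:
  assumes fin: "besov_norm \<phi> \<sigma> (ennreal p) \<infinity> T < \<infinity>" and p: "p > 0"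
    and K: "enn2real (besov_norm \<phi> \<sigma> (ennreal p) \<infinity> T) < K"
  obtains f where "represents f (dyadic_cutoff \<phi> k T)" "lp p f (K * 2 powr (- of_int k * \<sigma>))"
proof -
  let ?d = "dist_Lp_norm (ennreal p) (dyadic_cutoff \<phi> k T)" and ?e = "2 powr (of_int k * \<sigma>)"
  have K0: "K > 0" using K enn2real_nonneg by (rule le_less_trans[rotated])
  have "ennreal ?e * ?d \<le> besov_norm \<phi> \<sigma> (ennreal p) \<infinity> T"
    unfolding besov_norm_def by (auto intro: SUP_upper2[of k])
  also have "\<dots> < ennreal K"
    using fin K K0 by (cases "besov_norm \<phi> \<sigma> (ennreal p) \<infinity> T") (auto simp: ennreal_less_iff)
  finally have *: "ennreal ?e * ?d < ennreal K" .
  have "?d < ennreal (K * 2 powr (- of_int k * \<sigma>))"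
  proof (cases ?d)
    case (real r)
    with * have "?e * r < K" by (simp add: ennreal_mult'[symmetric] ennreal_less_iff)
    then have "r < K / ?e" by (simp add: less_divide_eq mult.commute)
    also have "\<dots> = K * 2 powr (- of_int k * \<sigma>)" by (simp add: powr_minus divide_inverse)
    finally show ?thesis using real by (simp add: ennreal_less_iff)
  next
    case top
    then show ?thesis using * by (simp add: ennreal_mult_top)
  qed
  from dist_Lp_norm_lessE[OF this p] that show ?thesis by blast
qed

section \<open>The decomposition\<close>

text \<open>Exponent arithmetic at scale \<open>J + l\<close>, resting on
  \<open>crit p * p = 3 - p\<close>. The number \<open>\<alpha>\<close> is the midpoint between
  \<open>(p - 3) / (p - 2)\<close> and 1, so \<open>\<alpha> * (2 - p) = 5 / 2 - p\<close>. In
  \<open>L_2\<close> this leaves the rate 1/4 per scale and \<open>- J / 2\<close> from the start;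
  in \<open>L_2p\<close> the critical exponent \<open>crit (2 * p)\<close> appears exactly, with
  gain \<open>(1 - \<alpha>) / 2\<close> per scale.\<close>

lemma truncation_exponents:
  fixes p J l K :: real
  assumes p: "p > 3" and K: "K > 0"
  defines "\<alpha> \<equiv> 1 - 1 / (2 * (p - 2))"
  shows "(2 powr (J + l * \<alpha>)) powr ((2 - p) / 2) * (K * 2 powr (- (J + l) * crit p)) powr (p / 2)
      = K powr (p / 2) * 2 powr (- J / 2) * 2 powr (- l / 4)" (is ?u)
    and "(2 powr (J + l * \<alpha>)) powr ((2 * p - p) / (2 * p)) * (K * 2 powr (- (J + l) * crit p)) powr (p / (2 * p))
      = K powr (1 / 2) * 2 powr (- (J + l) * crit (2 * p) - l / (4 * (p - 2)))" (is ?v)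
proof -
  have nz: "p \<noteq> 0" "p - 2 \<noteq> 0" using p by auto
  have comb: "(2 powr x) powr a * (K * 2 powr y) powr b = K powr b * 2 powr (x * a + y * b)" for x y a b :: real
    using K by (simp add: powr_mult powr_powr powr_add)
  have a: "\<alpha> * (2 - p) = 5/2 - p" using nz by (simp add: \<alpha>_def left_diff_distrib) (simp add: divide_simps)
  have s: "crit p * p = 3 - p" using nz by (simp add: crit_def field_simps)
  have "(J + l * \<alpha>) * ((2 - p) / 2) + (- (J + l) * crit p) * (p / 2)
      = (J * (2 - p) + l * (\<alpha> * (2 - p)) - (J + l) * (crit p * p)) / 2"
    by (simp add: field_simps)
  also have "\<dots> = - J / 2 + - l / 4" unfolding a s by (simp add: field_simps)
  finally have e1: "(J + l * \<alpha>) * ((2 - p) / 2) + (- (J + l) * crit p) * (p / 2) = - J / 2 + - l / 4" .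
  have "(2 powr (J + l * \<alpha>)) powr ((2 - p) / 2) * (K * 2 powr (- (J + l) * crit p)) powr (p / 2)
      = K powr (p / 2) * 2 powr ((J + l * \<alpha>) * ((2 - p) / 2) + (- (J + l) * crit p) * (p / 2))"
    by (rule comb)
  also have "\<dots> = K powr (p / 2) * 2 powr (- J / 2) * 2 powr (- l / 4)"
    unfolding e1 powr_add by (simp only: mult.assoc)
  finally show ?u .
  have h: "(2 * p - p) / (2 * p) = 1 / 2" "p / (2 * p) = 1 / 2" using nz by auto
  have e2: "(J + l * \<alpha>) * (1 / 2) + (- (J + l) * crit p) * (1 / 2)
      = - (J + l) * crit (2 * p) - l / (4 * (p - 2))"
  proof -
    have 1: "(1 - crit p) / 2 = - crit (2 * p)" using nz by (simp add: crit_def field_simps)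
    have 2: "(J + l * \<alpha>) * (1 / 2) + (- (J + l) * crit p) * (1 / 2)
        = (J + l) * ((1 - crit p) / 2) - l * ((1 - \<alpha>) / 2)" by (simp add: field_simps)
    have 3: "(1 - \<alpha>) / 2 = 1 / (4 * (p - 2))" by (simp add: \<alpha>_def)
    show ?thesis
      unfolding 2 1 3 by (simp only: mult_minus_left mult_minus_right times_divide_eq_right mult_1_right)
  qed
  have "(2 powr (J + l * \<alpha>)) powr (1 / 2) * (K * 2 powr (- (J + l) * crit p)) powr (1 / 2)
      = K powr (1 / 2) * 2 powr ((J + l * \<alpha>) * (1 / 2) + (- (J + l) * crit p) * (1 / 2))"
    by (rule comb)
  then show ?v unfolding h e2 .
qed

context littlewood_paley_pair
begin

text \<open>Taking real parts does not increase the norm, and by \<open>represents_even_part\<close>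
  it amounts to replacing \<open>\<phi>\<close> by \<open>\<eta>\<close>.\<close>

lemma even_blocks:
  assumes p: "p > 0" and g: "g \<in> besov \<chi>\<^sub>0 \<phi> \<sigma> (ennreal p) \<infinity>"
    and K: "enn2real (besov_norm \<phi> \<sigma> (ennreal p) \<infinity> g) < K"
  obtains F :: "int \<Rightarrow> real^3 \<Rightarrow> complex^3" where
    "\<And>j. lp p (F j) (K * 2 powr (- of_int j * \<sigma>))" "\<And>j x b. F j x $ b \<in> \<real>"
    "\<And>j b \<theta>. \<theta> \<in> schwartz \<Longrightarrow> g (mult_op (dilate j \<eta>) \<theta>) $ b = (\<integral>x. \<theta> x * F j x $ b \<partial>lborel)"
proof -
  have gt: "g \<in> tempered" and fin: "besov_norm \<phi> \<sigma> (ennreal p) \<infinity> g < \<infinity>"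
    using g by (auto simp: besov_def)
  have "\<forall>j. \<exists>f. represents f (dyadic_cutoff \<phi> j g) \<and> lp p f (K * 2 powr (- of_int j * \<sigma>))"
    using besov_norm_infinityE[OF fin p K] by metis
  then obtain f where f: "\<And>j. represents (f j) (dyadic_cutoff \<phi> j g)"
    "\<And>j. lp p (f j) (K * 2 powr (- of_int j * \<sigma>))"
    by metis
  define F :: "int \<Rightarrow> real^3 \<Rightarrow> complex^3" where "F j x = (\<chi> b. of_real (Re (f j x $ b)))" for j x
  show ?thesis
  proof (rule that[of F])
    fix j
    have [measurable]: "(\<lambda>x. f j x $ b) \<in> borel_measurable borel" for b
      using f(2) by (intro vec_measurableD lp_measurable)
    show "lp p (F j) (K * 2 powr (- of_int j * \<sigma>))"
    proof (rule lp_norm_le[OF f(2)])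
      show "F j \<in> borel_measurable borel" unfolding F_def by (rule vec_measurableI) simp
      show "norm (F j x) \<le> norm (f j x)" for x
        unfolding norm_vec_def by (rule L2_set_mono) (auto simp: F_def abs_Re_le_cmod)
    qed (rule p)
    show "F j x $ b \<in> \<real>" for x b by (simp add: F_def)
    have "dilate j \<eta> = (\<lambda>\<xi>. (dilate j \<phi> \<xi> + dilate j \<phi> (- \<xi>)) / 2)"
      by (simp add: dilate_def \<eta>_def fun_eq_iff)
    then show "g (mult_op (dilate j \<eta>) \<theta>) $ b = (\<integral>x. \<theta> x * F j x $ b \<partial>lborel)" if "\<theta> \<in> schwartz" for b \<theta>
      using represents_even_part(2)[OF gt bump_dilate[OF bump_phi] _ that, of "f j" j b] f(1)[of j]
      by (simp add: dyadic_cutoff_eq F_def)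
  qed
qed

text \<open>The constant \<open>\<delta>\<close> is half of the gain per scale above
  \<open>J\<close> from \<open>truncation_exponents\<close>. In the last clause one half raises the
  regularity index by \<open>\<delta>\<close>, at the price
  \<open>2 powr (of_int J * \<delta>)\<close>; the other half is the decay in the distance from
  \<open>J\<close>. At scales below \<open>J\<close> the two effects cancel exactly.\<close>

definition remainder :: "real \<Rightarrow> real \<Rightarrow> real \<Rightarrow> int \<Rightarrow> dist3 \<Rightarrow> dist3 \<Rightarrow> bool" where
  "remainder p A K J g h \<longleftrightarrow>
    (let \<delta> = 1 / (8 * (p - 2)) in
        h \<in> tempered \<and> div_free h \<and> (\<forall>j\<le>J - 1. \<forall>\<theta>\<in>schwartz. h (mult_op (dilate j \<chi>\<^sub>0) \<theta>) = 0) \<and>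
        dist_Lp_norm 2 h \<le> ennreal (A * K powr (p / 2) * 2 powr (- of_int J / 2)) \<and>
        (\<forall>k. dist_Lp_norm (ennreal p) (dyadic_cutoff \<phi> k h) \<le> ennreal (A * K * 2 powr (- of_int k * crit p))) \<and>
        (\<forall>k. dist_Lp_norm (ennreal p) (dyadic_cutoff \<phi> k (\<lambda>\<theta>. g \<theta> - h \<theta>))
          \<le> ennreal (A * K * 2 powr (- of_int k * crit p))) \<and>
        (\<forall>k. dist_Lp_norm (ennreal (2 * p)) (dyadic_cutoff \<phi> k (\<lambda>\<theta>. g \<theta> - h \<theta>))
          \<le> ennreal (A * K * 2 powr (of_int J * \<delta>) * 2 powr (- of_int k * (crit (2 * p) + \<delta>))
                * 2 powr (- of_int \<bar>k - J\<bar> * \<delta>))))"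

text \<open>At frequencies above \<open>2\<^sup>J\<close> the blocks of \<open>g\<close> are truncated at height
  \<open>2\<^sup>J 2\<^bsup>(j-J)\<alpha>\<^esup>\<close>. The choice of \<open>\<alpha>\<close>, strictly between \<open>(p-3)/(p-2)\<close> and \<open>1\<close>, makes the high
  parts summable in \<open>L\<^sub>2\<close> and leaves a gain in the low parts; the gain is spent on \<open>\<delta>\<close>.\<close>

lemma decomposition:
  assumes p: "p > 3"
  defines "\<delta> \<equiv> 1 / (8 * (p - 2))"
  obtains A where "A > 0"
    "\<And>g K J. g \<in> besov \<chi>\<^sub>0 \<phi> (crit p) (ennreal p) \<infinity> \<Longrightarrow> div_free g \<Longrightarrow> 1 \<le> K \<Longrightarrow>
      enn2real (besov_norm \<phi> (crit p) (ennreal p) \<infinity> g) < K \<Longrightarrow>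
      \<exists>h. remainder p A K J g h"
proof -
  define s where "s = crit p"
  define \<alpha> where "\<alpha> = 1 - 1 / (2 * (p - 2))"
  \<comment> \<open>Chosen so that \<open>r ^ (2 * n)\<close> is \<open>2 powr (- n / 4)\<close>,
    the decay of the tall parts in \<open>L_2\<close>.\<close>
  define r where "r = (2::real) powr (- 1 / 8)"
  have r: "0 < r" "r < 1" unfolding r_def by (auto intro!: powr_less_one)
  have s: "-1 \<le> s" "s \<le> 0" using p by (auto simp: s_def crit_def)
  have s2: "-1 \<le> crit (2 * p)" "crit (2 * p) \<le> 0" using p by (auto simp: crit_def)
  have d: "0 < \<delta>" "\<delta> \<le> 1 / 8" using p by (auto simp: \<delta>_def divide_simps)
  obtain B where B: "B \<ge> 1" and B2: "\<forall>p q k w F. p > 1 \<longrightarrow> q \<ge> p \<longrightarrow> (\<forall>j. w j \<in> borel_measurable borel) \<longrightarrow>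
      (\<forall>i\<in>{-2..2}. lp p (w (k + i)) F) \<longrightarrow>
      lp q (block k w) (B * F * 2 powr (3 * of_int k * (1 / p - 1 / q)))"
    using block_estimate by (elim exE conjE) (rule that)
  have B1: "lp p (block k w) (B * F)" if "p > 1" "\<And>j. w j \<in> borel_measurable borel"
    "\<And>i. i \<in> {-2..2} \<Longrightarrow> lp p (w (k + i)) F" for p k w F
    using B2[THEN spec, of p, THEN spec, of p, THEN spec, of k, THEN spec, of w, THEN spec, of F] that
    by simp
  obtain D where D: "D > 0" and D1: "\<forall>c u J. 0 < c \<longrightarrow> (\<forall>n. lp 2 (u (J + 1 + int n)) (c * r ^ (2 * n))) \<longrightarrow> (\<forall>j x b. u j x $ b \<in> \<real>) \<longrightarrow>
    (\<exists>G :: 3 \<Rightarrow> real^3 \<Rightarrow> real. (\<forall>a. lp 2 (G a) (D * c)) \<and>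
      (\<forall>\<theta>\<in>schwartz. \<forall>a. (\<lambda>n. \<Sum>b\<in>UNIV. \<integral>x. mult_op (dilate (J + 1 + int n) (leray a b)) \<theta> x
          * u (J + 1 + int n) x $ b \<partial>lborel) sums (\<integral>x. \<theta> x * of_real (G a x) \<partial>lborel)))"
    using solenoidal_series[OF r] by (elim exE conjE) (rule that)
  \<comment> \<open>\<open>9 * D\<close> covers the three components of \<open>h\<close> in
    \<open>L_2\<close>; \<open>8 * B\<close> covers the block estimates together with the shifts to
    neighbouring scales.\<close>
  define A where "A = max (9 * D) (8 * B)"
  have A: "A > 0" "9 * D \<le> A" "8 * B \<le> A" using D by (auto simp: A_def)
  show thesis
  proof (rule that[OF A(1)])
    fix g K and J :: int
    assume g: "g \<in> besov \<chi>\<^sub>0 \<phi> (crit p) (ennreal p) \<infinity>" "div_free g" and K: "1 \<le> K"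
      "enn2real (besov_norm \<phi> (crit p) (ennreal p) \<infinity> g) < K"
    have gt: "g \<in> tempered" using g(1) by (simp add: besov_def)
    obtain F where F: "\<And>j. lp p (F j) (K * 2 powr (- of_int j * s))" "\<And>j x b. F j x $ b \<in> \<real>"
      "\<And>j b \<theta>. \<theta> \<in> schwartz \<Longrightarrow> g (mult_op (dilate j \<eta>) \<theta>) $ b = (\<integral>x. \<theta> x * F j x $ b \<partial>lborel)"
      using even_blocks[OF _ g(1) K(2)] p unfolding s_def by auto

    \<comment> \<open>Splitting the even blocks by height\<close>
    define \<Lambda> where "\<Lambda> j = (2::real) powr (of_int J + of_int (j - J) * \<alpha>)" for j
    define u where "u j x = (if j \<le> J then 0 else if norm (F j x) > \<Lambda> j then F j x else 0)" for j x
    define v where "v j x = F j x - u j x" for j x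
    define c where "c = K powr (p / 2) * 2 powr (- of_int J / 2)"
    have c: "c > 0" using K by (simp add: c_def)
    have [measurable]: "F j \<in> borel_measurable borel" for j using F(1) by (rule lp_measurable)
    have um [measurable]: "u j \<in> borel_measurable borel" for j
      unfolding u_def[abs_def] by (cases "j \<le> J") simp_all
    have vm [measurable]: "v j \<in> borel_measurable borel" for j
      unfolding v_def[abs_def] by measurable
    have up: "lp p (u j) (K * 2 powr (- of_int j * s))" for j
      by (rule lp_norm_le[OF F(1) um]) (use p in \<open>auto simp: u_def\<close>)
    have vp: "lp p (v j) (K * 2 powr (- of_int j * s))" for j
      by (rule lp_norm_le[OF F(1) vm]) (use p in \<open>auto simp: u_def v_def\<close>)
    have K0: "K > 0" using K by simp
    have eJ: "real_of_int J + of_int (j - J) = of_int j" for j by simp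
    have u2: "lp 2 (u j) (c * 2 powr (- of_int (j - J) / 4))" if "J < j" for j
    proof -
      have "lp 2 (\<lambda>x. if norm (F j x) > \<Lambda> j then F j x else 0)
          (\<Lambda> j powr ((2 - p) / 2) * (K * 2 powr (- of_int j * s)) powr (p / 2))"
        by (rule lp_truncate_high[OF F(1)]) (use p in \<open>auto simp: \<Lambda>_def\<close>)
      also have "\<Lambda> j powr ((2 - p) / 2) * (K * 2 powr (- of_int j * s)) powr (p / 2)
          = c * 2 powr (- of_int (j - J) / 4)"
        unfolding \<Lambda>_def \<alpha>_def s_def c_def
        by (rule truncation_exponents(1)[OF p K0, of "of_int J" "of_int (j - J)", unfolded eJ])
      finally show ?thesis using that by (simp add: u_def[abs_def])
    qed
    have u2': "lp 2 (u (J + 1 + int n)) (c * r ^ (2 * n))" for n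
    proof (rule lp_mono[OF u2])
      have "r ^ (2 * n) = 2 powr (- real n / 4)"
        using r by (simp add: powr_realpow[symmetric]) (simp add: r_def powr_powr)
      moreover have "(2::real) powr (- of_int (J + 1 + int n - J) / 4) \<le> 2 powr (- real n / 4)"
        by (intro powr_mono) auto
      ultimately show "c * 2 powr (- of_int (J + 1 + int n - J) / 4) \<le> c * r ^ (2 * n)"
        using c by (simp add: mult_left_mono)
    qed auto
    \<comment> \<open>The bound 1 for the zero function is a placeholder: \<open>lp\<close> demands
      a positive bound, and the series lemmas ask for a bound at every scale.\<close>
    have u2all: "lp 2 (u j) (if j \<le> J then 1 else c * 2 powr (- of_int (j - J) / 4))" for j
    proof (cases "j \<le> J")
      case True
      then have "u j = (\<lambda>x. 0)" by (simp add: u_def[abs_def])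
      then show ?thesis using True by (simp add: lp_def)
    qed (use u2 in simp)
    have v2: "lp (2 * p) (v j) (K * 2 powr (- of_int j * crit (2 * p) - 2 * \<delta> * of_int (j - J)))" if "J < j" for j
    proof -
      have "lp (2 * p) (\<lambda>x. if norm (F j x) > \<Lambda> j then 0 else F j x)
          (\<Lambda> j powr ((2 * p - p) / (2 * p)) * (K * 2 powr (- of_int j * s)) powr (p / (2 * p)))"
        by (rule lp_truncate_low[OF F(1)]) (use p in \<open>auto simp: \<Lambda>_def\<close>)
      moreover have "v j = (\<lambda>x. if norm (F j x) > \<Lambda> j then 0 else F j x)"
        using that by (auto simp: v_def u_def fun_eq_iff)
      moreover have "\<Lambda> j powr ((2 * p - p) / (2 * p)) * (K * 2 powr (- of_int j * s)) powr (p / (2 * p))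
          = K powr (1 / 2) * 2 powr (- of_int j * crit (2 * p) - 2 * \<delta> * of_int (j - J))"
      proof -
        have e: "real_of_int (j - J) / (4 * (p - 2)) = 2 * \<delta> * of_int (j - J)"
          using p by (simp add: \<delta>_def divide_simps) (simp add: algebra_simps)
        show ?thesis
          unfolding \<Lambda>_def \<alpha>_def s_def
          by (rule truncation_exponents(2)[OF p K0, of "of_int J" "of_int (j - J)", unfolded eJ e])
      qed
      ultimately have "lp (2 * p) (v j) (K powr (1 / 2) * 2 powr (- of_int j * crit (2 * p) - 2 * \<delta> * of_int (j - J)))"
        by (simp only:)
      \<comment> \<open>This is where \<open>1 \<le> K\<close> enters; it makes the bound linear in
        \<open>K\<close>, as in the low-frequency case.\<close>
      moreover have "K powr (1 / 2) \<le> K" using powr_mono[of "1 / 2" 1 K] K by simp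
      ultimately show ?thesis
        using lp_mono[of "2 * p" "v j"] p by (simp add: mult_right_mono)
    qed

    \<comment> \<open>The distribution \<open>h\<close> and the blocks of \<open>h\<close> and
      \<open>g - h\<close>\<close>
    have ur: "u j x $ b \<in> \<real>" for j x b using F(2) by (simp add: u_def)
    obtain G :: "3 \<Rightarrow> real^3 \<Rightarrow> real" where G: "\<And>a. lp 2 (G a) (D * c)"
      and Gs: "\<And>\<theta> a. \<theta> \<in> schwartz \<Longrightarrow> (\<lambda>n. \<Sum>b\<in>UNIV. \<integral>x. mult_op (dilate (J + 1 + int n) (leray a b)) \<theta> x
          * u (J + 1 + int n) x $ b \<partial>lborel) sums (\<integral>x. \<theta> x * of_real (G a x) \<partial>lborel)"
      using D1[rule_format, of c u J, OF c u2' ur] by blast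
    define h :: dist3 where "h = (\<lambda>\<theta>. \<chi> a. \<integral>x. \<theta> x * of_real (G a x) \<partial>lborel)"
    have hs: "\<theta> \<in> schwartz \<Longrightarrow> (\<lambda>n. \<Sum>b\<in>UNIV. \<integral>x. mult_op (dilate (J + 1 + int n) (leray a b)) \<theta> x
          * u (J + 1 + int n) x $ b \<partial>lborel) sums (h \<theta> $ a)" for \<theta> a
      using Gs by (simp add: h_def)
    have u0: "\<And>j x. j \<le> J \<Longrightarrow> u j x = 0" by (simp add: u_def)
    have ht: "h \<in> tempered" unfolding h_def by (rule tempered_of_lp[OF _ G]) simp
    have hblock: "h (mult_op (dilate k \<phi>) \<theta>) $ a =
      (\<Sum>i\<in>{-2..2}. \<Sum>b\<in>UNIV. \<integral>x. mult_op (dilate k (block_symbol i a b)) \<theta> x * u (k + i) x $ b \<partial>lborel)"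
      if "\<theta> \<in> schwartz" for k \<theta> a
      by (rule series_block[OF u2all u0 hs that])
    have hrep: "represents (block k u) (dyadic_cutoff \<phi> k h)" for k
      by (rule represents_block[OF _ up hblock]) (use p in simp)
    \<comment> \<open>Both block identities are finite and have the same coefficients, so their
      difference is the identity for \<open>v\<close>.\<close>
    have brep: "represents (block k v) (dyadic_cutoff \<phi> k (\<lambda>\<theta>. g \<theta> - h \<theta>))" for k
    proof (rule represents_block[OF _ vp])
      fix \<theta> a assume \<theta>: "\<theta> \<in> schwartz"
      have I: "integrable lborel (\<lambda>x. mult_op (dilate k (block_symbol i a b)) \<theta> x * w x $ b)"
        if "lp p w E" for w E i b
        by (rule lp_schwartz_integrable[OF _ lp_component[OF that] mult_op_schwartz[OF bump_dilate[OF bump_block_symbol] \<theta>]])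
          (use p in auto)
      show "(g (mult_op (dilate k \<phi>) \<theta>) - h (mult_op (dilate k \<phi>) \<theta>)) $ a =
        (\<Sum>i\<in>{-2..2}. \<Sum>b\<in>UNIV. \<integral>x. mult_op (dilate k (block_symbol i a b)) \<theta> x * v (k + i) x $ b \<partial>lborel)"
        using I[OF F(1)] I[OF up]
        by (simp add: div_free_block[OF gt g(2) F(3) \<theta>] hblock[OF \<theta>] v_def right_diff_distrib
            sum_subtractf)
    qed (use p in simp)

    \<comment> \<open>Norm estimates of the blocks\<close>
    have shift: "lp p (w (k + i)) (4 * K * 2 powr (- of_int k * s))"
      if "\<And>j. lp p (w j) (K * 2 powr (- of_int j * s))" "i \<in> {-2..2}" for w :: "int \<Rightarrow> real^3 \<Rightarrow> complex^3" and k i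
    proof (rule lp_mono[OF that(1)])
      \<comment> \<open>A neighbour is at most two scales away and \<open>s\<close> lies between -1
        and 0, so passing to it costs a factor of at most 4.\<close>
      have "- real_of_int i * s \<le> 2"
      proof -
        have "\<bar>- real_of_int i * s\<bar> \<le> 2 * 1" unfolding abs_mult using s that(2) by (intro mult_mono) auto
        then show ?thesis by simp
      qed
      then have "(2::real) powr (- of_int i * s) \<le> 2 powr 2" by (intro powr_mono) auto
      then have le4: "(2::real) powr (- of_int i * s) \<le> 4" by (simp add: powr_numeral)
      have "K * 2 powr (- of_int (k + i) * s) = K * 2 powr (- of_int k * s) * 2 powr (- of_int i * s)"
        by (simp add: powr_add[symmetric] algebra_simps)
      also have "\<dots> \<le> K * 2 powr (- of_int k * s) * 4" using K le4 by (intro mult_left_mono) auto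
      finally show "K * 2 powr (- of_int (k + i) * s) \<le> 4 * K * 2 powr (- of_int k * s)" by simp
    qed (use p in simp)
    have Lp: "lp p (block k w) (A * K * 2 powr (- of_int k * s))"
      if "\<And>j. w j \<in> borel_measurable borel" "\<And>j. lp p (w j) (K * 2 powr (- of_int j * s))" for w k
    proof (rule lp_mono)
      show "lp p (block k w) (B * (4 * K * 2 powr (- of_int k * s)))"
        using B1[where p = p and w = w and k = k and F = "4 * K * 2 powr (- of_int k * s)"] that(1)
          shift[OF that(2)] p by simp
      have "4 * B * (K * 2 powr (- of_int k * s)) \<le> A * (K * 2 powr (- of_int k * s))"
        using A B K by (intro mult_right_mono) auto
      then show "B * (4 * K * 2 powr (- of_int k * s)) \<le> A * K * 2 powr (- of_int k * s)"
        by (simp add: mult_ac)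
    qed (use p in simp)
    have L2p: "lp (2 * p) (block k v) (A * K * 2 powr (of_int J * \<delta>) * 2 powr (- of_int k * (crit (2 * p) + \<delta>))
                * 2 powr (- of_int \<bar>k - J\<bar> * \<delta>))" for k
    proof -
      let ?E = "2 powr (of_int J * \<delta>) * 2 powr (- of_int k * (crit (2 * p) + \<delta>)) * 2 powr (- of_int \<bar>k - J\<bar> * \<delta>)"
      let ?e = "of_int J * \<delta> + - of_int k * (crit (2 * p) + \<delta>) + - of_int \<bar>k - J\<bar> * \<delta>"
      have E: "?E = 2 powr ?e" by (simp only: powr_add)
      have 8: "lp (2 * p) (block k v) (8 * B * K * 2 powr ?e)"
      \<comment> \<open>Beyond \<open>J + 2\<close> all neighbours \<open>k + i\<close> lie above
        \<open>J\<close>, where the gain \<open>v2\<close> is available. Otherwise some neighbours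
        may be uncut, and Bernstein's inequality raises the exponent from \<open>p\<close> to
        \<open>2 * p\<close>.\<close>
      proof (cases "k \<le> J + 2")
        case True
        have "lp (2 * p) (block k v) (B * (4 * K * 2 powr (- of_int k * s)) * 2 powr (3 * of_int k * (1 / p - 1 / (2 * p))))"
          using B2[THEN spec, of p, THEN spec, of "2 * p", THEN spec, of k, THEN spec, of v, THEN spec,
              of "4 * K * 2 powr (- of_int k * s)"] vm shift[OF vp] p by simp
        then show ?thesis
        proof (rule lp_mono)
          have "- of_int k * s + 3 * of_int k * (1 / p - 1 / (2 * p)) = - real_of_int k * crit (2 * p)"
            using p by (simp add: s_def crit_def field_simps)
          then have "2 powr (- of_int k * s) * 2 powr (3 * of_int k * (1 / p - 1 / (2 * p))) = 2 powr (- real_of_int k * crit (2 * p))"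
            by (simp only: powr_add[symmetric])
          \<comment> \<open>For \<open>k \<le> J\<close> the exponents agree up to the added 1; the
            two scales above \<open>J\<close> cost at most \<open>4 * \<delta>\<close>, which is at
            most 1/2.\<close>
          moreover have "(2::real) powr (- of_int k * crit (2 * p)) \<le> 2 powr (1 + ?e)"
          proof (rule powr_mono)
            have "(real_of_int (k - J) + \<bar>real_of_int (k - J)\<bar>) * \<delta> \<le> 4 * (1 / 8)"
              using True d by (intro mult_mono) auto
            then show "- real_of_int k * crit (2 * p) \<le> 1 + ?e"
              by (simp add: algebra_simps)
          qed simp
          ultimately have "2 powr (- of_int k * s) * 2 powr (3 * of_int k * (1 / p - 1 / (2 * p))) \<le> 2 * 2 powr ?e"
            by (simp add: powr_add)
          then have "4 * B * K * (2 powr (- of_int k * s) * 2 powr (3 * of_int k * (1 / p - 1 / (2 * p)))) \<le> 4 * B * K * (2 * 2 powr ?e)"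
            using B K by (intro mult_left_mono) auto
          then show "B * (4 * K * 2 powr (- of_int k * s)) * 2 powr (3 * of_int k * (1 / p - 1 / (2 * p))) \<le> 8 * B * K * 2 powr ?e"
            by (simp add: mult_ac)
        qed (use p in simp)
      next
        case False
        have "lp (2 * p) (block k v) (B * (8 * K * 2 powr ?e))"
        proof (rule B1[where w = v and k = k, OF _ vm])
          show "lp (2 * p) (v (k + i)) (8 * K * 2 powr ?e)" if i: "i \<in> {-2..2}" for i
          proof -
            let ?x = "- of_int (k + i) * crit (2 * p) - 2 * \<delta> * of_int (k + i - J)"
            have "lp (2 * p) (v (k + i)) (K * 2 powr ?x)" by (rule v2) (use False i in auto)
            then show "lp (2 * p) (v (k + i)) (8 * K * 2 powr ?e)"
            proof (rule lp_mono)
              \<comment> \<open>The shift by \<open>i\<close> changes the exponent by at most 2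
                through the critical index and by at most 1/2 through the gain; rounding up to 3
                gives the factor 8.\<close>
              have "\<bar>- real_of_int i * crit (2 * p)\<bar> \<le> 2 * 1" unfolding abs_mult using s2 i by (intro mult_mono) auto
              moreover have "\<bar>- real_of_int i * (2 * \<delta>)\<bar> \<le> 2 * (1 / 4)" unfolding abs_mult using d i by (intro mult_mono) auto
              moreover have "\<bar>real_of_int k - real_of_int J\<bar> = real_of_int k - real_of_int J" using False by simp
              then have "?x = ?e + (- real_of_int i * crit (2 * p)) + (- real_of_int i * (2 * \<delta>))"
                by (simp add: algebra_simps)
              ultimately have "?x \<le> 3 + ?e" by linarith
              then have "(2::real) powr ?x \<le> 2 powr (3 + ?e)" by (intro powr_mono) auto
              also have "\<dots> = 8 * 2 powr ?e" by (simp add: powr_add powr_numeral)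
              finally show "K * 2 powr ?x \<le> 8 * K * 2 powr ?e" using K by (simp add: mult_left_mono)
            qed (use p in simp)
          qed
        qed (use p in simp)
        then show ?thesis by (simp add: mult_ac)
      qed
      moreover have "8 * B * K * 2 powr ?e \<le> A * K * 2 powr ?e"
        using A K by (intro mult_right_mono) auto
      ultimately have "lp (2 * p) (block k v) (A * K * 2 powr ?e)" by (rule lp_mono) (use p in simp)
      then show ?thesis unfolding E[symmetric] by (simp only: mult.assoc)
    qed
    show "\<exists>h. remainder p A K J g h"
      unfolding remainder_def \<delta>_def[symmetric] Let_def
    proof (intro exI[of _ h] conjI allI impI ballI)
      show "h \<in> tempered" by (rule ht)
      show "div_free h" by (rule series_div_free[OF u2all u0 hs])
      show "h (mult_op (dilate j \<chi>\<^sub>0) \<theta>) = 0" if "j \<le> J - 1" "\<theta> \<in> schwartz" for j \<theta>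
        by (rule series_low_frequency[OF u2all u0 hs that])
      show "dist_Lp_norm 2 h \<le> ennreal (A * K powr (p / 2) * 2 powr (- of_int J / 2))"
      proof -
        let ?G = "\<lambda>x. \<chi> a. complex_of_real (G a x)"
        have [measurable]: "G a \<in> borel_measurable borel" for a using G by (rule lp_measurable)
        have Gm: "?G \<in> borel_measurable borel" by (rule vec_measurableI) simp
        have Gc: "lp 2 (\<lambda>x. complex_of_real (G a x)) (D * c)" for a
          by (rule lp_norm_le[OF G[of a]]) simp_all
        have "lp 2 ?G ((real (card (UNIV :: 3 set)))\<^sup>2 * (D * c))"
          by (rule lp_sum[where f = "\<lambda>a x. G a x"])
            (use G Gm norm_le_sum_components[of "?G _"] in auto)
        then have "lp 2 ?G (9 * (D * c))" by simp
        then have lpG: "lp 2 ?G (A * c)"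
          by (rule lp_mono) (use A c in \<open>simp_all add: mult.assoc[symmetric] mult_right_mono\<close>)
        have "represents ?G h"
        proof (rule representsI[OF Gm])
          show "integrable lborel (\<lambda>x. \<theta> x * ?G x $ a)" if "\<theta> \<in> schwartz" for \<theta> a
            using lp_schwartz_integrable[OF _ Gc that, of a] by simp
        qed (simp add: h_def)
        from dist_Lp_norm_le[OF this lpG] show ?thesis by (simp add: c_def mult.assoc)
      qed
      show "dist_Lp_norm (ennreal p) (dyadic_cutoff \<phi> k h) \<le> ennreal (A * K * 2 powr (- of_int k * crit p))" for k
        using dist_Lp_norm_le[OF hrep Lp[OF um up]] p by (simp add: s_def)
      show "dist_Lp_norm (ennreal p) (dyadic_cutoff \<phi> k (\<lambda>\<theta>. g \<theta> - h \<theta>))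
          \<le> ennreal (A * K * 2 powr (- of_int k * crit p))" for k
        using dist_Lp_norm_le[OF brep Lp[OF vm vp]] p by (simp add: s_def)
      show "dist_Lp_norm (ennreal (2 * p)) (dyadic_cutoff \<phi> k (\<lambda>\<theta>. g \<theta> - h \<theta>))
          \<le> ennreal (A * K * 2 powr (of_int J * \<delta>) * 2 powr (- of_int k * (crit (2 * p) + \<delta>))
                * 2 powr (- of_int \<bar>k - J\<bar> * \<delta>))" for k
        by (rule dist_Lp_norm_le[OF brep L2p]) (use p in simp)
    qed
  qed
qed

end

lemma div_free_diff: "div_free g \<Longrightarrow> div_free h \<Longrightarrow> div_free (\<lambda>\<theta>. g \<theta> - h \<theta>)"
  by (simp add: div_free_def dist_div_def sum_subtractf)

text \<open>With \<open>J\<close> the floor of the binary logarithm, \<open>2 powr J\<close> lies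
  between \<open>N / 2\<close> and \<open>N\<close>; the factor 2 in the second bound absorbs the
  rounding.\<close>

lemma dyadic_scale:
  fixes N d :: real
  assumes N: "N > 0" and d: "d > 0"
  shows "2 powr (of_int \<lfloor>log 2 N\<rfloor> * d) \<le> N powr d"
    and "2 powr (- of_int \<lfloor>log 2 N\<rfloor> / 2) \<le> 2 * N powr (- (1 / 2))"
proof -
  let ?J = "real_of_int \<lfloor>log 2 N\<rfloor>"
  have J: "?J \<le> log 2 N" "log 2 N \<le> ?J + 1" by linarith+
  have pow: "2 powr (log 2 N * e) = N powr e" for e
    using N by (simp add: powr_powr[symmetric])
  have "2 powr (?J * d) \<le> 2 powr (log 2 N * d)" using J d by (intro powr_mono mult_right_mono) auto
  then show "2 powr (?J * d) \<le> N powr d" by (simp only: pow)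
  have "2 powr (- ?J / 2) \<le> 2 powr (1 + log 2 N * (- (1 / 2)))"
    by (rule powr_mono) (use J in linarith, simp)
  also have "\<dots> = 2 * N powr (- (1 / 2))" by (simp only: powr_add pow) simp
  finally show "2 powr (- ?J / 2) \<le> 2 * N powr (- (1 / 2))" .
qed

theorem proposition1p5:
  fixes \<chi>\<^sub>0 \<phi> :: "real^3 \<Rightarrow> real" and p :: real
  assumes "littlewood_paley \<chi>\<^sub>0 \<phi>" and "3 < p"
  shows "\<exists>p\<^sub>2 \<delta>\<^sub>2 \<gamma>\<^sub>1 \<gamma>\<^sub>2 :: real. \<exists>C\<^sub>1 C\<^sub>2 C\<^sub>3 C\<^sub>4 :: real \<Rightarrow> real.
    p < p\<^sub>2 \<and> 0 < \<delta>\<^sub>2 \<and> \<delta>\<^sub>2 < - crit p\<^sub>2 \<and> 0 < \<gamma>\<^sub>1 \<and> 0 < \<gamma>\<^sub>2 \<and>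
    (\<forall>g. g \<in> besov \<chi>\<^sub>0 \<phi> (crit p) (ennreal p) \<infinity> \<and> div_free g \<longrightarrow>
      (let M = enn2real (besov_norm \<phi> (crit p) (ennreal p) \<infinity> g) in
       \<forall>N::real. 0 < N \<longrightarrow>
        (\<exists>gbar gtil.
          gbar \<in> besov \<chi>\<^sub>0 \<phi> (crit p\<^sub>2 + \<delta>\<^sub>2) (ennreal p\<^sub>2) (ennreal p\<^sub>2)
                 \<inter> besov \<chi>\<^sub>0 \<phi> (crit p) (ennreal p) \<infinity> \<and>
          gtil \<in> Lp_space 2 \<inter> besov \<chi>\<^sub>0 \<phi> (crit p) (ennreal p) \<infinity> \<and>
          div_free gbar \<and> div_free gtil \<and>
          dist_eq g (dist_add gbar gtil) \<and>
          besov_norm \<phi> (crit p\<^sub>2 + \<delta>\<^sub>2) (ennreal p\<^sub>2) (ennreal p\<^sub>2) gbar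
            \<le> ennreal (N powr \<gamma>\<^sub>1 * C\<^sub>1 M) \<and>
          dist_Lp_norm 2 gtil \<le> ennreal (N powr (- \<gamma>\<^sub>2) * C\<^sub>2 M) \<and>
          besov_norm \<phi> (crit p) (ennreal p) \<infinity> gbar \<le> ennreal (C\<^sub>3 M) \<and>
          besov_norm \<phi> (crit p) (ennreal p) \<infinity> gtil \<le> ennreal (C\<^sub>4 M))))"
proof -
  note p = \<open>3 < p\<close>
  interpret littlewood_paley_pair \<chi>\<^sub>0 \<phi> by unfold_locales (rule assms(1))
  define \<delta> where "\<delta> = 1 / (8 * (p - 2))"
  have \<delta>: "0 < \<delta>" "\<delta> < - crit (2 * p)"
  proof -
    show "0 < \<delta>" using p by (simp add: \<delta>_def)
    have "\<delta> < 1 / 2" using p by (simp add: \<delta>_def divide_simps)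
    also have "1 / 2 \<le> - crit (2 * p)" using p by (simp add: crit_def divide_simps)
    finally show "\<delta> < - crit (2 * p)" .
  qed
  obtain A where A: "A > 0" and dec: "\<And>g K J. g \<in> besov \<chi>\<^sub>0 \<phi> (crit p) (ennreal p) \<infinity> \<Longrightarrow> div_free g \<Longrightarrow> 1 \<le> K \<Longrightarrow>
      enn2real (besov_norm \<phi> (crit p) (ennreal p) \<infinity> g) < K \<Longrightarrow>
      \<exists>h. remainder p A K J g h"
    using decomposition[OF p] by blast
  \<comment> \<open>The constant of \<open>besov_norm_le_geometric\<close> for exponent
    \<open>2 * p\<close> and decay \<open>\<delta>\<close>; it depends on \<open>p\<close>
    alone.\<close>
  define E where "E = (2 / (1 - 2 powr (- (2 * p) * \<delta>))) powr (1 / (2 * p))"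
  define C1 where "C1 M = A * (M + 1) * E" for M
  define C2 where "C2 M = 2 * A * (M + 1) powr (p / 2)" for M
  define C3 where "C3 M = A * (M + 1)" for M
  have main: "\<exists>gbar gtil.
          gbar \<in> besov \<chi>\<^sub>0 \<phi> (crit (2 * p) + \<delta>) (ennreal (2 * p)) (ennreal (2 * p))
                 \<inter> besov \<chi>\<^sub>0 \<phi> (crit p) (ennreal p) \<infinity> \<and>
          gtil \<in> Lp_space 2 \<inter> besov \<chi>\<^sub>0 \<phi> (crit p) (ennreal p) \<infinity> \<and>
          div_free gbar \<and> div_free gtil \<and>
          dist_eq g (dist_add gbar gtil) \<and>
          besov_norm \<phi> (crit (2 * p) + \<delta>) (ennreal (2 * p)) (ennreal (2 * p)) gbar \<le> ennreal (N powr \<delta> * C1 M) \<and>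
          dist_Lp_norm 2 gtil \<le> ennreal (N powr (- (1 / 2)) * C2 M) \<and>
          besov_norm \<phi> (crit p) (ennreal p) \<infinity> gbar \<le> ennreal (C3 M) \<and>
          besov_norm \<phi> (crit p) (ennreal p) \<infinity> gtil \<le> ennreal (C3 M)"
    if g: "g \<in> besov \<chi>\<^sub>0 \<phi> (crit p) (ennreal p) \<infinity>" "div_free g"
      and M: "M = enn2real (besov_norm \<phi> (crit p) (ennreal p) \<infinity> g)" and N: "0 < N" for g M N
  proof -
    let ?J = "\<lfloor>log 2 N\<rfloor>"
    \<comment> \<open>Adding 1 to the norm gives both requirements on \<open>K\<close>: strict
      excess over the norm, and a value of at least 1 even when the norm is 0.\<close>
    have K: "1 \<le> M + 1" "enn2real (besov_norm \<phi> (crit p) (ennreal p) \<infinity> g) < M + 1" by (auto simp: M)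
    obtain h where ht: "h \<in> tempered" and hd: "div_free h"
      and hlow: "\<forall>j\<le>?J - 1. \<forall>\<theta>\<in>schwartz. h (mult_op (dilate j \<chi>\<^sub>0) \<theta>) = 0"
      and h2: "dist_Lp_norm 2 h \<le> ennreal (A * (M + 1) powr (p / 2) * 2 powr (- of_int ?J / 2))"
      and hp: "\<forall>k. dist_Lp_norm (ennreal p) (dyadic_cutoff \<phi> k h) \<le> ennreal (A * (M + 1) * 2 powr (- of_int k * crit p))"
      and bp: "\<forall>k. dist_Lp_norm (ennreal p) (dyadic_cutoff \<phi> k (\<lambda>\<theta>. g \<theta> - h \<theta>))
          \<le> ennreal (A * (M + 1) * 2 powr (- of_int k * crit p))"
      and b2p: "\<forall>k. dist_Lp_norm (ennreal (2 * p)) (dyadic_cutoff \<phi> k (\<lambda>\<theta>. g \<theta> - h \<theta>))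
          \<le> ennreal (A * (M + 1) * 2 powr (of_int ?J * \<delta>) * 2 powr (- of_int k * (crit (2 * p) + \<delta>))
                * 2 powr (- of_int \<bar>k - ?J\<bar> * \<delta>))"
      using dec[OF g K, of ?J] unfolding remainder_def \<delta>_def[symmetric] Let_def
      by (elim exE conjE) (rule that)
    let ?b = "\<lambda>\<theta>. g \<theta> - h \<theta>"
    have gt: "g \<in> tempered" using g(1) by (simp add: besov_def)
    have bt: "?b \<in> tempered" by (rule tempered_diff[OF gt ht])
    have K0: "0 < A * (M + 1)" using A K by simp
    have hB: "besov_norm \<phi> (crit p) (ennreal p) \<infinity> h \<le> ennreal (C3 M)"
      unfolding C3_def by (rule besov_norm_infinity_le[OF K0]) (rule spec[OF hp])
    have bB: "besov_norm \<phi> (crit p) (ennreal p) \<infinity> ?b \<le> ennreal (C3 M)"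
      unfolding C3_def by (rule besov_norm_infinity_le[OF K0]) (rule spec[OF bp])
    have b2: "besov_norm \<phi> (crit (2 * p) + \<delta>) (ennreal (2 * p)) (ennreal (2 * p)) ?b \<le> ennreal (N powr \<delta> * C1 M)"
    proof -
      have "besov_norm \<phi> (crit (2 * p) + \<delta>) (ennreal (2 * p)) (ennreal (2 * p)) ?b
          \<le> ennreal (A * (M + 1) * 2 powr (of_int ?J * \<delta>) * E)"
        unfolding E_def
        by (rule besov_norm_le_geometric[where J = ?J, OF _ _ \<delta>(1)]) (use p K0 b2p in auto)
      also have "\<dots> \<le> ennreal (N powr \<delta> * C1 M)"
      proof (rule ennreal_leI)
        have "A * (M + 1) * E * 2 powr (of_int ?J * \<delta>) \<le> A * (M + 1) * E * N powr \<delta>"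
          using dyadic_scale(1)[OF N \<delta>(1)] K0 by (intro mult_left_mono) (auto simp: E_def)
        then show "A * (M + 1) * 2 powr (of_int ?J * \<delta>) * E \<le> N powr \<delta> * C1 M"
          by (simp add: C1_def mult_ac)
      qed
      finally show ?thesis .
    qed
    have h2': "dist_Lp_norm 2 h \<le> ennreal (N powr (- (1 / 2)) * C2 M)"
    proof (rule order_trans[OF h2 ennreal_leI])
      have "A * (M + 1) powr (p / 2) * 2 powr (- of_int ?J / 2) \<le> A * (M + 1) powr (p / 2) * (2 * N powr (- (1 / 2)))"
        using A by (intro mult_left_mono dyadic_scale(2)[OF N \<delta>(1)]) auto
      then show "A * (M + 1) powr (p / 2) * 2 powr (- of_int ?J / 2) \<le> N powr (- (1 / 2)) * C2 M"
        by (simp add: C2_def mult_ac)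
    qed
    have hlim: "((\<lambda>j. dist_Lp_norm \<infinity> (dyadic_cutoff \<chi>\<^sub>0 j h)) \<longlongrightarrow> 0) at_bot"
    proof (rule tendsto_eventually)
      have "dist_Lp_norm \<infinity> (dyadic_cutoff \<chi>\<^sub>0 j h) = 0" if "j \<le> ?J - 1" for j
        by (rule dist_Linfty_norm_zero) (use hlow that in \<open>simp add: dyadic_cutoff_eq\<close>)
      then show "\<forall>\<^sub>F j in at_bot. dist_Lp_norm \<infinity> (dyadic_cutoff \<chi>\<^sub>0 j h) = 0"
        unfolding eventually_at_bot_linorder by blast
    qed
    \<comment> \<open>For \<open>j \<le> ?J - 1\<close> the cut-off annihilates \<open>h\<close>, so
      \<open>g\<close> and \<open>g - h\<close> have the same low-frequency norms and the limit is
      inherited.\<close>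
    have blim: "((\<lambda>j. dist_Lp_norm \<infinity> (dyadic_cutoff \<chi>\<^sub>0 j ?b)) \<longlongrightarrow> 0) at_bot"
    proof (rule Lim_transform_eventually)
      show "((\<lambda>j. dist_Lp_norm \<infinity> (dyadic_cutoff \<chi>\<^sub>0 j g)) \<longlongrightarrow> 0) at_bot"
        using g(1) by (simp add: besov_def)
      have "dist_Lp_norm \<infinity> (dyadic_cutoff \<chi>\<^sub>0 j g) = dist_Lp_norm \<infinity> (dyadic_cutoff \<chi>\<^sub>0 j ?b)" if "j \<le> ?J - 1" for j
        by (rule dist_Lp_norm_cong) (use hlow that in \<open>simp add: dyadic_cutoff_eq\<close>)
      then show "\<forall>\<^sub>F j in at_bot. dist_Lp_norm \<infinity> (dyadic_cutoff \<chi>\<^sub>0 j g) = dist_Lp_norm \<infinity> (dyadic_cutoff \<chi>\<^sub>0 j ?b)"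
        unfolding eventually_at_bot_linorder by blast
    qed
    show ?thesis
    proof (rule exI[of _ ?b], rule exI[of _ h], intro conjI IntI)
      show "?b \<in> besov \<chi>\<^sub>0 \<phi> (crit (2 * p) + \<delta>) (ennreal (2 * p)) (ennreal (2 * p))"
        using bt blim order_le_less_trans[OF b2 ennreal_less_top] by (simp add: besov_def)
      show "?b \<in> besov \<chi>\<^sub>0 \<phi> (crit p) (ennreal p) \<infinity>"
        using bt blim order_le_less_trans[OF bB ennreal_less_top] by (simp add: besov_def)
      show "h \<in> besov \<chi>\<^sub>0 \<phi> (crit p) (ennreal p) \<infinity>"
        using ht hlim order_le_less_trans[OF hB ennreal_less_top] by (simp add: besov_def)
      show "h \<in> Lp_space 2"
        using ht order_le_less_trans[OF h2' ennreal_less_top] by (simp add: Lp_space_def)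
      show "dist_eq g (dist_add ?b h)" by (simp add: dist_eq_def dist_add_def)
    qed (fact div_free_diff[OF g(2) hd] hd b2 h2' bB hB)+
  qed
  show ?thesis
    unfolding Let_def
    \<comment> \<open>The rate \<open>\<gamma>\<^sub>1\<close> equals
      \<open>\<delta>\<^sub>2\<close>, because raising the regularity by \<open>\<delta>\<close>
      costs exactly \<open>2 powr (J * \<delta>)\<close>; the rate 1/2 is the \<open>- J / 2\<close>
      of the \<open>L_2\<close> bound. Both parts satisfy the same critical bound, so
      \<open>C3\<close> serves twice.\<close>
    by (rule exI[of _ "2 * p"], rule exI[of _ \<delta>], rule exI[of _ \<delta>], rule exI[of _ "1 / 2"],
        rule exI[of _ C1], rule exI[of _ C2], rule exI[of _ C3], rule exI[of _ C3], intro conjI allI impI)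
      (use p \<delta> main in simp_all)
qed

end
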